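(* Let $\mathcal A$ be a unital $C^*$-algebra. Say that a family $\alpha=(\alpha_{r,m}:C([-r,r]^m)\to[0,\infty])_{r>0,\,m\in\mathbb N}$ of possibly infinite norms is LFC-admissible for $\mathcal A$ if $\alpha_{r,m}(P|_{[-r,r]^m})<\infty$ for all $r>0$, $m\in\mathbb N$, $P\in\mathbb C[\lambda_1,\ldots,\lambda_m]$, and for every $m\ge2$, $P\in\mathbb C[\lambda_1,\ldots,\lambda_m]$, $b=(b_1,\ldots,b_{m-1})\in\mathcal A^{m-1}$, and $r>0$, $$\sup\{\|P_\otimes(\mathbf a)\# b\|:\mathbf a=(a_1,\ldots,a_m)\in\mathcal A^m,\ a_i^*=a_i,\ \|a_i\|\le r\}\le\alpha_{r,m}(P|_{[-r,r]^m})\prod_{i=1}^{m-1}\|b_i\|.$$ Let $u$ be the uniform family and $\beta$ the Varopoulos family. (i) If $\mathcal A$ is commutative, then $u$ is LFC-admissible for $\mathcal A$. (ii) If $\mathcal A$ is finite dimensional, then the family $u^{\mathcal A}:=((\dim\mathcal A)^{m-1}u_{r,m})_{r>0,\,m\in\mathbb N}$ is LFC-admissible for $\mathcal A$. (iii) $\beta$ is LFC-admissible for $\mathcal A$. In particular, the $u$-LFC in $\mathcal A$ is defined if $\mathcal A$ is commutative, the $u^{\mathcal A}$-LFC in $\mathcal A$ is defined if $\mathcal A$ is finite dimensional, and the $\beta$-LFC in $\mathcal A$ is defined for every unital $C^*$-algebra $\mathcal A$.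
   Context: A possibly infinite norm on a complex vector space $V$ is a function $\eta:V\to[0,\infty]$ with $\eta(cv)=|c|\eta(v)$ (with $0\cdot\infty=0$), $\eta(v+w)\le\eta(v)+\eta(w)$, and $\eta(v)=0$ iff $v=0$. $C(X)$ denotes complex-valued continuous functions. For $m\ge2$, $P(\boldsymbol\lambda)=\sum_{|\delta|\le d}c_\delta\lambda_1^{\delta_1}\cdots\lambda_m^{\delta_m}$, $\mathbf a\in\mathcal A^m$, $b\in\mathcal A^{m-1}$: $P_\otimes(\mathbf a)\# b=\sum_{|\delta|\le d}c_\delta\,a_1^{\delta_1}b_1\cdots a_{m-1}^{\delta_{m-1}}b_{m-1}a_m^{\delta_m}$. Uniform family: $u_{r,m}(\varphi):=\sup_{[-r,r]^m}|\varphi|$. Varopoulos family: $\beta_{r,m}(\varphi)$ is the infimum of $\sum_{n=1}^\infty\prod_{i=1}^m\|\varphi_{i,n}\|_{\ell^\infty([-r,r])}$ over all sequences $(\varphi_{i,n})_{n\in\mathbb N}$ in $C([-r,r])$, $i=1,\ldots,m$, for which this sum is finite and $\varphi(\lambda_1,\ldots,\lambda_m)=\sum_{n=1}^\infty\varphi_{1,n}(\lambda_1)\cdots\varphi_{m,n}(\lambda_m)$ for all $\boldsymbol\lambda\in[-r,r]^m$; $\beta_{r,m}(\varphi):=\infty$ if no such sequences exist. That "the $\alpha$-LFC (lexicographic functional calculus) in $\mathcal A$ is defined" means: for all $m\ge2$, $\mathbf a\in\mathcal A^m$ with self-adjoint entries, and $b\in\mathcal A^{m-1}$, the map $P\mapsto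 P_\otimes(\mathbf a)\# b$ on $\mathbb C[\lambda_1,\ldots,\lambda_m]$ extends uniquely to a continuous linear map $C_\alpha(\mathbb R^m)\to\mathcal A$. Here $C_\alpha(\mathbb R^m)$ is the closure of the polynomials in $\{\varphi\in C(\mathbb R^m):\alpha_{r,m}(\varphi|_{[-r,r]^m})<\infty\ \forall r>0\}$, with the topology generated by the seminorms $\varphi\mapsto\alpha_{r,m}(\varphi|_{[-r,r]^m})$, $r>0$. *)

theory Defs
  imports "HOL-Analysis.Analysis" "HOL-Library.Poly_Mapping"
begin

section \<open>Unital C*-algebras\<close>

text \<open>
  Nonzero unital complex C*-algebras. The complex scalar multiplication is required to extend
  the real one of the library class hierarchy. The axiom \<open>norm 1 = 1\<close>, inherited from
  \<open>real_normed_algebra_1\<close>, follows from the C*-identity in a nonzero algebra.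
\<close>

class unital_cstar_algebra = real_normed_algebra_1 + banach +
  fixes scaleC :: "complex \<Rightarrow> 'a \<Rightarrow> 'a"
    and adj :: "'a \<Rightarrow> 'a"
  assumes scaleC_add_right: "scaleC c (x + y) = scaleC c x + scaleC c y"
    and scaleC_add_left: "scaleC (c + d) x = scaleC c x + scaleC d x"
    and scaleC_scaleC: "scaleC c (scaleC d x) = scaleC (c * d) x"
    and scaleC_of_real: "scaleC (complex_of_real t) x = scaleR t x"
    and mult_scaleC_left: "scaleC c x * y = scaleC c (x * y)"
    and mult_scaleC_right: "x * scaleC c y = scaleC c (x * y)"
    and norm_scaleC: "norm (scaleC c x) = cmod c * norm x"
    and adj_adj: "adj (adj x) = x"
    and adj_add: "adj (x + y) = adj x + adj y"
    and adj_scaleC: "adj (scaleC c x) = scaleC (cnj c) (adj x)"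
    and adj_mult: "adj (x * y) = adj y * adj x"
    and cstar_identity: "norm (adj x * x) = (norm x)\<^sup>2"

instantiation complex :: unital_cstar_algebra
begin

definition "scaleC_complex = (\<lambda>(c::complex) x. c * x)"
definition "adj_complex = cnj"

instance
  by standard
    (auto simp: scaleC_complex_def adj_complex_def algebra_simps norm_mult scaleR_conv_of_real
       power2_eq_square)

end

global_interpretation complex_vector:
  vector_space "scaleC :: complex \<Rightarrow> 'a \<Rightarrow> 'a::unital_cstar_algebra"
proof
  show "scaleC 1 x = x" for x :: 'a
    using scaleC_of_real[of 1 x] by simp
qed (fact scaleC_add_right scaleC_add_left scaleC_scaleC)+

definition commutative_algebra :: "'a::unital_cstar_algebra itself \<Rightarrow> bool" where
  "commutative_algebra _ \<longleftrightarrow> (\<forall>x y :: 'a. x * y = y * x)"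

definition finite_dimensional :: "'a::unital_cstar_algebra itself \<Rightarrow> bool" where
  "finite_dimensional _ \<longleftrightarrow> (\<exists>B :: 'a set. finite B \<and> complex_vector.span B = UNIV)"

definition algebra_dim :: "'a::unital_cstar_algebra itself \<Rightarrow> nat" where
  "algebra_dim _ = complex_vector.dim (UNIV :: 'a set)"


section \<open>Spaces of continuous functions and possibly infinite norms\<close>

text \<open>
  A point of \<open>\<real>\<^sup>m\<close> is a function \<open>nat \<Rightarrow> real\<close> supported (in the sense of
  \<open>extensional\<close>) on the index set \<open>{1..m}\<close>. The product topology on \<open>nat \<Rightarrow> real\<close> induces the
  usual topology on these sets of points.
\<close>

definition real_space :: "nat \<Rightarrow> (nat \<Rightarrow> real) set" where
  "real_space m = {1..m} \<rightarrow>\<^sub>E UNIV"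

definition cube :: "real \<Rightarrow> nat \<Rightarrow> (nat \<Rightarrow> real) set" where
  "cube r m = {1..m} \<rightarrow>\<^sub>E {-r..r}"

text \<open>
  Elements of \<open>C(X)\<close> are represented by functions vanishing outside \<open>X\<close>, so that equality in
  \<open>C(X)\<close> is equality of functions and the operations are pointwise; \<open>restr X \<phi>\<close> is
  the restriction of \<open>\<phi>\<close> to \<open>X\<close> in this representation.
\<close>

definition cfun :: "'x::topological_space set \<Rightarrow> ('x \<Rightarrow> complex) set" where
  "cfun X = {\<phi>. continuous_on X \<phi> \<and> (\<forall>x. x \<notin> X \<longrightarrow> \<phi> x = 0)}"

definition restr :: "'x set \<Rightarrow> ('x \<Rightarrow> complex) \<Rightarrow> 'x \<Rightarrow> complex" where
  "restr X \<phi> = (\<lambda>x. if x \<in> X then \<phi> x else 0)"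

text \<open>In \<open>ennreal\<close> one has \<open>0 * \<infinity> = 0\<close>, as required in the homogeneity condition.\<close>

definition possibly_infinite_norm ::
    "('x \<Rightarrow> complex) set \<Rightarrow> (('x \<Rightarrow> complex) \<Rightarrow> ennreal) \<Rightarrow> bool" where
  "possibly_infinite_norm V \<eta> \<longleftrightarrow>
     (\<forall>c. \<forall>v\<in>V. \<eta> (\<lambda>x. c * v x) = ennreal (cmod c) * \<eta> v) \<and>
     (\<forall>v\<in>V. \<forall>w\<in>V. \<eta> (\<lambda>x. v x + w x) \<le> \<eta> v + \<eta> w) \<and>
     (\<forall>v\<in>V. \<eta> v = 0 \<longleftrightarrow> v = (\<lambda>_. 0))"

definition sup_norm :: "'x set \<Rightarrow> ('x \<Rightarrow> complex) \<Rightarrow> ennreal" where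
  "sup_norm X \<phi> = (SUP x\<in>X. ennreal (cmod (\<phi> x)))"


section \<open>Polynomials\<close>

text \<open>
  Polynomials in \<open>\<lambda>\<^sub>1, \<dots>, \<lambda>\<^sub>m\<close>: finitely supported families of coefficients \<open>c\<^sub>\<delta>\<close> indexed by
  exponents \<open>\<delta>\<close>, which are themselves finitely supported maps, here with support in \<open>{1..m}\<close>.
\<close>

type_synonym mpoly = "(nat \<Rightarrow>\<^sub>0 nat) \<Rightarrow>\<^sub>0 complex"

definition polys :: "nat \<Rightarrow> mpoly set" where
  "polys m = {P. \<forall>\<delta>\<in>Poly_Mapping.keys P. Poly_Mapping.keys \<delta> \<subseteq> {1..m}}"

definition poly_eval :: "nat \<Rightarrow> mpoly \<Rightarrow> (nat \<Rightarrow> real) \<Rightarrow> complex" where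
  "poly_eval m P x =
     (\<Sum>\<delta>\<in>Poly_Mapping.keys P. Poly_Mapping.lookup P \<delta> *
        (\<Prod>i\<in>{1..m}. complex_of_real (x i) ^ Poly_Mapping.lookup \<delta> i))"

text \<open>
  \<open>poly_tensor m P a b\<close> is \<open>P\<^sub>\<otimes>(a)#b\<close>. The factors do not commute, hence \<open>prod_list\<close> over the
  ordered list of indices \<open>1, \<dots>, m - 1\<close>.
\<close>

definition poly_tensor ::
    "nat \<Rightarrow> mpoly \<Rightarrow> (nat \<Rightarrow> 'a) \<Rightarrow> (nat \<Rightarrow> 'a) \<Rightarrow> 'a::unital_cstar_algebra" where
  "poly_tensor m P a b =
     (\<Sum>\<delta>\<in>Poly_Mapping.keys P. scaleC (Poly_Mapping.lookup P \<delta>)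
        (prod_list (map (\<lambda>i. a i ^ Poly_Mapping.lookup \<delta> i * b i) [1..<m]) *
         a m ^ Poly_Mapping.lookup \<delta> m))"


section \<open>Families of norms and admissibility\<close>

text \<open>
  Only the values \<open>\<alpha> r m \<phi>\<close> with \<open>r > 0\<close>, \<open>m \<ge> 1\<close> and \<open>\<phi> \<in> cfun (cube r m)\<close> are relevant.
\<close>

type_synonym norm_family = "real \<Rightarrow> nat \<Rightarrow> ((nat \<Rightarrow> real) \<Rightarrow> complex) \<Rightarrow> ennreal"

definition LFC_admissible :: "'a::unital_cstar_algebra itself \<Rightarrow> norm_family \<Rightarrow> bool" where
  "LFC_admissible _ \<alpha> \<longleftrightarrow>
     (\<forall>r>0. \<forall>m\<ge>1. possibly_infinite_norm (cfun (cube r m)) (\<alpha> r m)) \<and>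
     (\<forall>r>0. \<forall>m\<ge>1. \<forall>P\<in>polys m. \<alpha> r m (restr (cube r m) (poly_eval m P)) < \<infinity>) \<and>
     (\<forall>m\<ge>2. \<forall>P\<in>polys m. \<forall>b :: nat \<Rightarrow> 'a. \<forall>r>0.
        (SUP a\<in>{a :: nat \<Rightarrow> 'a. \<forall>i\<in>{1..m}. adj (a i) = a i \<and> norm (a i) \<le> r}.
           ennreal (norm (poly_tensor m P a b)))
        \<le> \<alpha> r m (restr (cube r m) (poly_eval m P)) * ennreal (\<Prod>i\<in>{1..m-1}. norm (b i)))"

definition uniform_family :: norm_family where
  "uniform_family r m \<phi> = sup_norm (cube r m) \<phi>"

definition scaled_uniform_family :: "'a::unital_cstar_algebra itself \<Rightarrow> norm_family" where
  "scaled_uniform_family A r m \<phi> = of_nat (algebra_dim A) ^ (m - 1) * uniform_family r m \<phi>"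

definition varopoulos_family :: norm_family where
  "varopoulos_family r m \<phi> =
     Inf {suminf (\<lambda>n. \<Prod>i\<in>{1..m}. sup_norm {-r..r} (\<psi> i n)) | \<psi> :: nat \<Rightarrow> nat \<Rightarrow> real \<Rightarrow> complex.
           (\<forall>i\<in>{1..m}. \<forall>n. \<psi> i n \<in> cfun {-r..r}) \<and>
           suminf (\<lambda>n. \<Prod>i\<in>{1..m}. sup_norm {-r..r} (\<psi> i n)) < \<infinity> \<and>
           (\<forall>x\<in>cube r m. (\<lambda>n. \<Prod>i\<in>{1..m}. \<psi> i n (x i)) sums \<phi> x)}"


section \<open>The lexicographic functional calculus\<close>

definition finite_space :: "norm_family \<Rightarrow> nat \<Rightarrow> ((nat \<Rightarrow> real) \<Rightarrow> complex) set" where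
  "finite_space \<alpha> m =
     {\<phi> \<in> cfun (real_space m). \<forall>r>0. \<alpha> r m (restr (cube r m) \<phi>) < \<infinity>}"

definition seminorm_topology :: "norm_family \<Rightarrow> nat \<Rightarrow> ((nat \<Rightarrow> real) \<Rightarrow> complex) topology" where
  "seminorm_topology \<alpha> m = topology_generated_by
     {{\<psi> \<in> finite_space \<alpha> m. \<alpha> r m (restr (cube r m) (\<lambda>x. \<psi> x - \<phi> x)) < \<epsilon>} | \<phi> r \<epsilon>.
        \<phi> \<in> finite_space \<alpha> m \<and> r > 0 \<and> \<epsilon> > 0}"

definition poly_functions :: "nat \<Rightarrow> ((nat \<Rightarrow> real) \<Rightarrow> complex) set" where
  "poly_functions m = {restr (real_space m) (poly_eval m P) | P. P \<in> polys m}"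

definition C_space :: "norm_family \<Rightarrow> nat \<Rightarrow> ((nat \<Rightarrow> real) \<Rightarrow> complex) set" where
  "C_space \<alpha> m = seminorm_topology \<alpha> m closure_of poly_functions m"

definition C_topology :: "norm_family \<Rightarrow> nat \<Rightarrow> ((nat \<Rightarrow> real) \<Rightarrow> complex) topology" where
  "C_topology \<alpha> m = subtopology (seminorm_topology \<alpha> m) (C_space \<alpha> m)"

definition linear_on_C_space ::
    "norm_family \<Rightarrow> nat \<Rightarrow> (((nat \<Rightarrow> real) \<Rightarrow> complex) \<Rightarrow> 'a::unital_cstar_algebra) \<Rightarrow> bool" where
  "linear_on_C_space \<alpha> m T \<longleftrightarrow>
     (\<forall>\<phi>\<in>C_space \<alpha> m. \<forall>\<psi>\<in>C_space \<alpha> m. T (\<lambda>x. \<phi> x + \<psi> x) = T \<phi> + T \<psi>) \<and>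
     (\<forall>c. \<forall>\<phi>\<in>C_space \<alpha> m. T (\<lambda>x. c * \<phi> x) = scaleC c (T \<phi>))"

text \<open>
  Maps on \<open>C_space \<alpha> m\<close> are taken to be \<open>extensional\<close>, so that \<open>\<exists>!\<close> expresses
  uniqueness of the map on \<open>C_space \<alpha> m\<close>. The inclusion of the polynomials, which is implicit in
  speaking of an extension, is made explicit.
\<close>

definition LFC_defined :: "'a::unital_cstar_algebra itself \<Rightarrow> norm_family \<Rightarrow> bool" where
  "LFC_defined _ \<alpha> \<longleftrightarrow>
     (\<forall>m\<ge>2. poly_functions m \<subseteq> C_space \<alpha> m \<and>
       (\<forall>a b :: nat \<Rightarrow> 'a. (\<forall>i\<in>{1..m}. adj (a i) = a i) \<longrightarrow>
         (\<exists>!T. T \<in> extensional (C_space \<alpha> m) \<and>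
               linear_on_C_space \<alpha> m T \<and>
               continuous_map (C_topology \<alpha> m) euclidean T \<and>
               (\<forall>P\<in>polys m. T (restr (real_space m) (poly_eval m P)) = poly_tensor m P a b))))"

end

theory Submission
  imports Defs "HOL-Library.Real_Mod" "HOL-Computational_Algebra.Fundamental_Theorem_Algebra"
begin

text \<open>
  Everything rests on one inequality for a self-adjoint element \<open>a\<close> with \<open>\<parallel>a\<parallel> \<le> r\<close>: a polynomial in \<open>a\<close>
  is bounded in norm by the supremum of the polynomial over \<open>[-r, r]\<close>, even when its coefficients are
  elements of the algebra, provided these commute with \<open>a\<close> and with each other's adjoints
  (\<open>von_neumann_inequality\<close>). For \<open>\<parallel>a\<parallel> < r\<close> one writes \<open>a = r Re u\<close> with a
  unitary \<open>u = a/r + \<i> (1 - a\<^sup>2/r\<^sup>2)\<^sup>1\<^sup>/\<^sup>2\<close>; averaging over roots of unity bounds a polynomial of degree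
  \<open>n\<close> by \<open>2n + 1\<close> times its supremum, and applying this to its \<open>2\<^sup>k\<close>-th power and extracting the root
  removes the factor.

  (i) In a commutative algebra the \<open>b\<^sub>i\<close> can be collected, and the elements \<open>a\<^sub>1, \<dots>, a\<^sub>m\<close> are replaced by
  scalars one after the other, each time by the inequality
  (\<open>norm_poly_tensor_commutative_le\<close>).

  (ii) In a finite-dimensional algebra every self-adjoint element is a real combination of at most
  \<open>dim \<A>\<close> self-adjoint idempotents (\<open>spectral_decomposition\<close>). Expanding the slots \<open>a\<^sub>1, \<dots>, a\<^sub>m\<^sub>-\<^sub>1\<close>
  produces at most \<open>(dim \<A>)\<^sup>m\<^sup>-\<^sup>1\<close> terms, each containing a polynomial in \<open>a\<^sub>m\<close> that the inequality
  bounds (\<open>norm_poly_tensor_finite_dimensional_le\<close>).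

  (iii) For the Varopoulos norm, Bernstein operators in each variable turn a series of elementary
  tensors of continuous functions into a series of elementary tensors of polynomials without
  increasing the uniform norms of the factors. The inequality bounds each term, and in the limit
  the Bernstein approximations of \<open>P\<close> give back \<open>P\<close> (\<open>norm_poly_tensor_varopoulos_le\<close>).

  That the functional calculus is defined follows from admissibility for an arbitrary family: the
  polynomial calculus is bounded by one of the seminorms and extends by continuity
  (\<open>LFC_defined_if_admissible\<close>).
\<close>

section \<open>The involution and the norm\<close>

lemma adj_zero: "adj (0::'a::unital_cstar_algebra) = 0"
  using adj_add[of "0::'a" 0] by simp

lemma adj_one: "adj (1::'a::unital_cstar_algebra) = 1"
  by (metis adj_adj adj_mult mult.right_neutral)

lemma adj_sum: "adj (sum f S) = (\<Sum>s\<in>S. adj (f s :: 'a::unital_cstar_algebra))"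
  by (induction S rule: infinite_finite_induct) (auto simp: adj_zero adj_add)

lemma adj_power: "adj (x ^ n) = adj (x::'a::unital_cstar_algebra) ^ n"
  by (induction n) (auto simp: adj_one adj_mult power_commutes)

lemma adj_scaleR: "adj (scaleR t x) = scaleR t (adj (x::'a::unital_cstar_algebra))"
  by (metis adj_scaleC complex_cnj_complex_of_real scaleC_of_real)

lemma adj_minus: "adj (- x) = - adj (x::'a::unital_cstar_algebra)"
  using adj_scaleR[of "-1" x] by simp

lemma adj_diff: "adj (x - y) = adj x - adj (y::'a::unital_cstar_algebra)"
  using adj_add[of x "- y"] by (simp add: adj_minus)

lemma norm_adj: "norm (adj x) = norm (x::'a::unital_cstar_algebra)"
proof -
  have le: "norm y \<le> norm (adj y)" for y :: 'a
  proof (cases "y = 0")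
    case False
    have "norm y * norm y \<le> norm (adj y) * norm y"
      using norm_mult_ineq[of "adj y" y] by (simp add: cstar_identity power2_eq_square)
    then show ?thesis using False by simp
  qed simp
  show ?thesis using le[of x] le[of "adj x"] by (simp add: adj_adj)
qed

lemma bounded_linear_adj: "bounded_linear (adj :: 'a \<Rightarrow> 'a::unital_cstar_algebra)"
  by (rule bounded_linear_intro[where K = 1]) (auto simp: adj_add adj_scaleR norm_adj)

lemma bounded_linear_scaleC_right:
  "bounded_linear (\<lambda>x::'a::unital_cstar_algebra. scaleC c x)"
proof (rule bounded_linear_intro[where K = "cmod c"])
  show "scaleC c (scaleR t x) = scaleR t (scaleC c x)" for t and x :: 'a
    by (simp flip: scaleC_of_real add: scaleC_scaleC mult.commute)
qed (auto simp: scaleC_add_right norm_scaleC)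

text \<open>
  The C*-identity turns submultiplicativity into equality on normal elements, for powers that are
  iterated squares. It is the source of the power trick below: a bound on all \<open>x ^ 2 ^ k\<close> with a
  constant growing slower than exponentially in the exponent yields a bound on \<open>x\<close> with constant 1.
\<close>

lemma norm_normal_power:
  fixes x :: "'a::unital_cstar_algebra"
  assumes "adj x * x = x * adj x"
  shows "norm (x ^ (2 ^ k)) = norm x ^ (2 ^ k)"
proof -
  have square: "norm (y * y) = (norm y)\<^sup>2" if "adj y * y = y * adj y" for y :: 'a
  proof -
    let ?h = "adj y * y"
    have "adj (y * y) * (y * y) = adj y * (adj y * y) * y"
      by (simp add: adj_mult mult.assoc)
    also have "\<dots> = ?h * ?h"
      by (subst that) (simp add: mult.assoc)
    also have "\<dots> = adj ?h * ?h"
      by (simp add: adj_mult adj_adj)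
    finally have "(norm (y * y))\<^sup>2 = ((norm y)\<^sup>2)\<^sup>2"
      by (metis cstar_identity)
    then show ?thesis by (rule power2_eq_imp_eq) auto
  qed
  have normal: "adj (x ^ n) * x ^ n = x ^ n * adj (x ^ n)" for n
    unfolding adj_power
    by (rule power_commuting_commutes, rule sym, rule power_commuting_commutes) (simp add: assms)
  show ?thesis
  proof (induction k)
    case (Suc k)
    have "x ^ 2 ^ Suc k = x ^ 2 ^ k * x ^ 2 ^ k"
      by (simp add: mult_2 power_add)
    then show ?case
      using square[OF normal] Suc by (simp add: power_mult power2_eq_square power_add mult_2)
  qed simp
qed

text \<open>
  The analytic half of the power trick: taking \<open>2 ^ k\<close>-th roots kills a factor that is linear in
  \<open>2 ^ k\<close>.
\<close>

lemma le_if_powers_le_linear_growth: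
  fixes x M :: real
  assumes "x \<ge> 0" "M \<ge> 0"
    and le: "\<And>k. x ^ (2 ^ k) \<le> (C * 2 ^ k + 1) * M ^ (2 ^ k)"
  shows "x \<le> M"
proof (rule ccontr)
  assume "\<not> x \<le> M"
  then have "x > 0" "M < x" using assms by auto
  define s where "s = M / x"
  have s: "0 \<le> s" "s < 1" using assms \<open>x > 0\<close> \<open>M < x\<close> by (auto simp: s_def)
  have ge: "1 \<le> C * (of_nat (2 ^ k) * s ^ (2 ^ k)) + s ^ (2 ^ k)" for k
    using le[of k] \<open>x > 0\<close> by (simp add: s_def power_divide field_simps)
  have "(\<lambda>n. C * (of_nat n * s ^ n) + s ^ n) \<longlonglongrightarrow> C * 0 + 0"
    using s by (intro tendsto_intros powser_times_n_limit_0 LIMSEQ_power_zero) auto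
  moreover have "filterlim (\<lambda>k. 2 ^ k :: nat) sequentially sequentially"
    by (rule filterlim_subseq) (auto simp: strict_mono_def)
  ultimately have "(\<lambda>k. C * (of_nat (2 ^ k) * s ^ (2 ^ k)) + s ^ (2 ^ k)) \<longlonglongrightarrow> C * 0 + 0"
    by (rule filterlim_compose)
  then have "1 \<le> C * 0 + 0"
    by (rule LIMSEQ_le_const) (use ge in blast)
  then show False by simp
qed

text \<open>
  The unitary is \<open>a + \<i> s\<close> with \<open>s\<close> a self-adjoint square root of \<open>1 - a\<^sup>2\<close> commuting with \<open>a\<close>. The
  root comes from the binomial series, which converges because \<open>\<parallel>a\<^sup>2\<parallel> < 1\<close>; that its square is
  \<open>1 - a\<^sup>2\<close> is the Vandermonde identity for the coefficients.
\<close>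

lemma unitary_with_real_part:
  fixes a :: "'a::unital_cstar_algebra"
  assumes sa: "adj a = a" and "norm a < 1"
  obtains u where "adj u * u = 1" "u * adj u = 1" "u + adj u = 2 *\<^sub>R a"
proof -
  define g :: "nat \<Rightarrow> real" where "g n = (- 1) ^ n * ((1 / 2) gchoose n)" for n
  define f where "f n = g n *\<^sub>R (a * a) ^ n" for n
  \<comment> \<open>Consecutive coefficients have a ratio of absolute value at most 1, so a geometric series dominates.\<close>
  have g_le: "\<bar>g n\<bar> \<le> 1" for n
  proof (induction n)
    case (Suc n)
    have "g (Suc n) = g n * (- (1 / 2 - real n) / real (Suc n))"
      by (simp add: g_def gbinomial_Suc_rec field_simps)
    then have "\<bar>g (Suc n)\<bar> = \<bar>g n\<bar> * (\<bar>- (1 / 2 - real n) / real (Suc n)\<bar>)"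
      by (simp only: abs_mult)
    also have "\<dots> \<le> 1 * 1"
      by (intro mult_mono Suc) (auto simp: field_simps)
    finally show ?case by simp
  qed (simp add: g_def)
  have "norm (a * a) < 1"
    using assms norm_mult_ineq[of a a] by (smt (verit) mult_left_le norm_ge_zero)
  then have geo: "summable (\<lambda>n. norm (a * a) ^ n)"
    by simp
  have sums_f: "summable (\<lambda>n. norm (f n))"
  proof (rule summable_comparison_test'[OF geo])
    fix n
    have "norm (f n) = \<bar>g n\<bar> * norm ((a * a) ^ n)" by (simp add: f_def)
    also have "\<dots> \<le> 1 * norm (a * a) ^ n"
      by (intro mult_mono g_le norm_power_ineq) auto
    finally show "norm (norm (f n)) \<le> norm (a * a) ^ n" by simp
  qed
  define s where "s = suminf f"
  have f_s: "f sums s"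
    using sums_f summable_norm_cancel s_def by blast
  have "s * s = suminf (\<lambda>k. \<Sum>i\<le>k. f i * f (k - i))"
    unfolding s_def by (rule Cauchy_product[OF sums_f sums_f])
  also have "(\<lambda>k. \<Sum>i\<le>k. f i * f (k - i)) = (\<lambda>k. ((- 1) ^ k * (1 gchoose k)) *\<^sub>R (a * a) ^ k)"
  proof
    fix k
    have "(\<Sum>i\<le>k. f i * f (k - i))
        = (\<Sum>i\<le>k. ((- 1) ^ k * (((1/2) gchoose i) * ((1/2) gchoose (k - i)))) *\<^sub>R (a * a) ^ k)"
      by (intro sum.cong) (auto simp: f_def g_def simp flip: power_add)
    also have "\<dots> = ((- 1) ^ k * (1 gchoose k)) *\<^sub>R (a * a) ^ k"
      using gbinomial_Vandermonde[of "1/2::real" "1/2" k]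
      by (simp add: atMost_atLeast0 flip: scaleR_sum_left sum_distrib_left)
    finally show "(\<Sum>i\<le>k. f i * f (k - i)) = ((- 1) ^ k * (1 gchoose k)) *\<^sub>R (a * a) ^ k" .
  qed
  also have "suminf (\<lambda>k. ((- 1) ^ k * (1 gchoose k)) *\<^sub>R (a * a) ^ k)
      = (\<Sum>k\<le>1. ((- 1) ^ k * ((1::real) gchoose k)) *\<^sub>R (a * a) ^ k)"
  proof (rule suminf_finite)
    fix k :: nat assume "k \<notin> {..1}"
    then have "1 choose k = 0" by (intro binomial_eq_0) auto
    then have "(1::real) gchoose k = 0"
      using binomial_gbinomial[of 1 k, where ?'a = real] by (simp only: of_nat_0 of_nat_1)
    then show "((- 1) ^ k * ((1::real) gchoose k)) *\<^sub>R (a * a) ^ k = 0" by simp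
  qed simp
  also have "\<dots> = 1 - a * a" by simp
  finally have ss: "s * s = 1 - a * a" .
  have as: "a * s = s * a"
  proof -
    have "(\<lambda>n. a * f n) sums (a * s)" by (rule sums_mult[OF f_s])
    moreover have "(\<lambda>n. f n * a) sums (s * a)" by (rule sums_mult2[OF f_s])
    moreover have "a * f n = f n * a" for n
    proof -
      have "(a * a) ^ n * a = a * (a * a) ^ n"
        by (rule power_commuting_commutes) (simp add: mult.assoc)
      then show ?thesis by (simp add: f_def)
    qed
    ultimately have "(\<lambda>n. f n * a) sums (a * s)" "(\<lambda>n. f n * a) sums (s * a)"
      by simp_all
    then show ?thesis by (rule sums_unique2)
  qed
  have "(\<lambda>n. adj (f n)) sums adj s"
    by (rule bounded_linear.sums[OF bounded_linear_adj f_s])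
  moreover have "adj (f n) = f n" for n
    by (simp add: f_def adj_scaleR adj_power adj_mult sa)
  ultimately have "f sums adj s" by simp
  then have sas: "adj s = s" using f_s by (rule sums_unique2)
  define t where "t = scaleC \<i> s"
  have adjt: "adj t = - t"
    by (simp add: t_def adj_scaleC sas complex_vector.scale_minus_left)
  have at: "a * t = t * a"
    by (simp add: t_def mult_scaleC_left mult_scaleC_right as)
  have "t * t = scaleC (- 1) (s * s)"
    by (simp add: t_def mult_scaleC_left mult_scaleC_right scaleC_scaleC)
  also have "\<dots> = - (s * s)"
    using complex_vector.scale_minus_left[of 1 "s * s"] by simp
  finally have tt: "t * t = a * a - 1" by (simp add: ss)
  show ?thesis
  proof (rule that[of "a + t"])
    show "adj (a + t) * (a + t) = 1" "(a + t) * adj (a + t) = 1"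
      by (simp_all add: adj_add sa adjt algebra_simps at tt)
    show "a + t + adj (a + t) = 2 *\<^sub>R a"
      by (simp add: adj_add sa adjt scaleR_2)
  qed
qed

section \<open>Complex polynomials at an element of the algebra\<close>

text \<open>
  In contrast to \<open>poly\<close>, the argument does not lie in the ring of coefficients, and its ring may be
  noncommutative.
\<close>

definition peval :: "'a::unital_cstar_algebra \<Rightarrow> complex poly \<Rightarrow> 'a" where
  "peval a p = (\<Sum>k\<le>degree p. scaleC (coeff p k) (a ^ k))"

lemma peval_degree_le:
  assumes "degree p \<le> d"
  shows "peval a p = (\<Sum>k\<le>d. scaleC (coeff p k) (a ^ k))"
  unfolding peval_def using assms
  by (intro sum.mono_neutral_left) (auto simp: coeff_eq_0 not_le)

lemma peval_0 [simp]: "peval a 0 = 0"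
  by (simp add: peval_def)

lemma peval_pCons [simp]: "peval a (pCons c p) = scaleC c 1 + a * peval a p"
proof -
  have "peval a (pCons c p) = (\<Sum>k\<le>Suc (degree p). scaleC (coeff (pCons c p) k) (a ^ k))"
    by (rule peval_degree_le) (simp add: degree_pCons_le)
  also have "\<dots> = scaleC c 1 + a * peval a p"
    by (subst sum.atMost_Suc_shift) (simp add: peval_def sum_distrib_left mult_scaleC_right)
  finally show ?thesis .
qed

lemma peval_1 [simp]: "peval a 1 = 1"
  by (simp add: one_pCons)

lemma peval_add [simp]: "peval a (p + q) = peval a p + peval a q"
proof -
  let ?d = "max (degree p) (degree q)"
  have "peval a (p + q) = (\<Sum>k\<le>?d. scaleC (coeff (p + q) k) (a ^ k))"
    by (rule peval_degree_le) (simp add: degree_add_le_max)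
  then show ?thesis
    by (simp add: peval_degree_le[of p ?d] peval_degree_le[of q ?d] scaleC_add_left sum.distrib)
qed

lemma peval_smult [simp]: "peval a (smult c p) = scaleC c (peval a p)"
  by (simp add: peval_degree_le[of "smult c p" "degree p"] peval_def degree_smult_le
      complex_vector.scale_sum_right scaleC_scaleC)

lemma peval_minus [simp]: "peval a (- p) = - peval a p"
  using peval_smult[of a "-1" p] by simp

lemma peval_diff [simp]: "peval a (p - q) = peval a p - peval a q"
  using peval_add[of a p "- q"] by simp

lemma peval_mult [simp]: "peval a (p * q) = peval a p * peval a q"
  by (induction p)
    (auto simp: algebra_simps mult_scaleC_left)

lemma peval_power [simp]: "peval a (p ^ n) = peval a p ^ n"
  by (induction n) auto

lemma peval_sum: "peval a (sum f S) = (\<Sum>s\<in>S. peval a (f s))"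
  by (induction S rule: infinite_finite_induct) auto

lemma peval_monom [simp]: "peval a (monom c n) = scaleC c (a ^ n)"
  by (simp add: monom_altdef)

lemma adj_peval:
  assumes "adj a = a"
  shows "adj (peval a p) = peval a (map_poly cnj p)"
  using assms by (simp add: peval_def adj_sum adj_scaleC adj_power coeff_map_poly degree_map_poly)

lemma poly_altdef_degree_le:
  fixes p :: "complex poly"
  assumes "degree p \<le> d"
  shows "poly p z = (\<Sum>k\<le>d. coeff p k * z ^ k)"
  unfolding poly_altdef using assms
  by (intro sum.mono_neutral_left) (auto simp: coeff_eq_0 not_le)

section \<open>Bounds by values on the unit circle\<close>

lemma sum_roots_of_unity:
  assumes "k < N" "l < N"
  shows "(\<Sum>j<N. cis (2 * pi * real j / real N) ^ k * cnj (cis (2 * pi * real j / real N)) ^ l) = (if k = l then of_nat N else 0)"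
proof -
  define q where "q = cis (2 * pi * (real k - real l) / N)"
  have "cis (2 * pi * j / N) ^ k * cnj (cis (2 * pi * j / N)) ^ l = q ^ j" for j :: nat
    unfolding q_def Complex.DeMoivre cis_cnj cis_mult by (rule arg_cong[where f = cis]) (simp add: algebra_simps diff_divide_distrib)
  then have eq: "(\<Sum>j<N. cis (2 * pi * real j / real N) ^ k * cnj (cis (2 * pi * real j / real N)) ^ l) = (\<Sum>j<N. q ^ j)"
    by simp
  show ?thesis
  proof (cases "k = l")
    case True
    then show ?thesis unfolding eq by (simp add: q_def)
  next
    case False
    have "q \<noteq> 1"
    proof
      assume "q = 1"
      then obtain n :: int where "2 * pi * (real k - real l) / N = of_int n * (2 * pi)"
        unfolding q_def cis_eq_1_iff by blast
      then have "2 * pi * (real k - real l) = 2 * pi * (of_int n * real N)"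
        using assms by (simp add: field_simps)
      then have "real k - real l = of_int n * real N"
        by (subst (asm) mult_cancel_left) simp
      then have "real_of_int (int k - int l) = of_int (n * int N)"
        by simp
      then have *: "int k - int l = n * int N"
        by (simp only: of_int_eq_iff)
      then have "int N dvd int k - int l" by simp
      then have "\<bar>int N\<bar> \<le> \<bar>int k - int l\<bar>"
        using False by (intro dvd_imp_le_int) auto
      then show False using assms by linarith
    qed
    moreover have "q ^ N = 1"
    proof -
      have "q ^ N = cis (2 * pi * of_int (int k - int l))"
        unfolding q_def Complex.DeMoivre using assms
        by (intro arg_cong[where f = cis]) (simp add: field_simps)
      then show ?thesis by (simp add: cis_multiple_2pi)
    qed
    ultimately show ?thesis unfolding eq using False by (simp add: geometric_sum)
  qed
qed

text \<open>
  A polynomial of degree at most \<open>d\<close> is determined by its values at the \<open>d + 1\<close> roots of unity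
  \<open>\<omega> j\<close>: with \<open>K j = (\<Sum>l\<le>d. cnj (\<omega> j) ^ l u ^ l) / (d + 1)\<close>, orthogonality gives
  \<open>peval u f = (\<Sum>j\<le>d. f (\<omega> j) K j)\<close>. Each \<open>K j\<close> has norm at most 1 as \<open>u\<close> is a contraction, whence
  the factor \<open>d + 1\<close>.
\<close>

lemma norm_sum_peval_le_circle:
  fixes u :: "'a::unital_cstar_algebra" and C :: "'s \<Rightarrow> 'a"
  assumes u: "norm u \<le> 1" and deg: "\<And>s. s \<in> S \<Longrightarrow> degree (f s) \<le> d"
    and le: "\<And>z. cmod z = 1 \<Longrightarrow> norm (\<Sum>s\<in>S. scaleC (poly (f s) z) (C s)) \<le> M"
  shows "norm (\<Sum>s\<in>S. C s * peval u (f s)) \<le> real (d + 1) * M"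
proof -
  have M: "0 \<le> M" by (rule order_trans[OF norm_ge_zero le[of 1]]) simp
  define N where "N = d + 1"
  define \<omega> where "\<omega> j = cis (2 * pi * real j / N)" for j :: nat
  define K where "K j = scaleC (1 / of_nat N) (\<Sum>l\<le>d. scaleC (cnj (\<omega> j) ^ l) (u ^ l))" for j
  have K: "norm (K j) \<le> 1" for j
  proof -
    have "norm (\<Sum>l\<le>d. scaleC (cnj (\<omega> j) ^ l) (u ^ l)) \<le> (\<Sum>l\<le>d. 1)"
    proof (intro sum_norm_le)
      fix l
      have "norm (u ^ l) \<le> norm u ^ l" by (rule norm_power_ineq)
      also have "\<dots> \<le> 1" using u by (simp add: power_le_one)
      finally show "norm (scaleC (cnj (\<omega> j) ^ l) (u ^ l)) \<le> 1"
        by (simp add: norm_scaleC norm_power \<omega>_def)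
    qed
    then have "norm (\<Sum>l\<le>d. scaleC (cnj (\<omega> j) ^ l) (u ^ l)) \<le> real N"
      by (simp add: N_def)
    moreover have "N > 0" by (simp add: N_def)
    ultimately show ?thesis by (simp add: K_def norm_scaleC norm_divide)
  qed
  have u_power: "u ^ k = (\<Sum>j<N. scaleC (\<omega> j ^ k) (K j))" if "k \<le> d" for k
  proof -
    have "(\<Sum>j<N. scaleC (\<omega> j ^ k) (K j))
        = (\<Sum>j<N. \<Sum>l\<le>d. scaleC (\<omega> j ^ k * cnj (\<omega> j) ^ l / of_nat N) (u ^ l))"
      by (simp add: K_def scaleC_scaleC complex_vector.scale_sum_right mult_ac)
    also have "\<dots> = (\<Sum>l\<le>d. scaleC ((\<Sum>j<N. \<omega> j ^ k * cnj (\<omega> j) ^ l) / of_nat N) (u ^ l))"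
      by (subst sum.swap) (simp add: complex_vector.scale_sum_left sum_divide_distrib)
    also have "\<dots> = (\<Sum>l\<le>d. if l = k then u ^ l else 0)"
      using that
      by (intro sum.cong refl) (auto simp: \<omega>_def sum_roots_of_unity N_def simp del: of_nat_Suc sum.lessThan_Suc)
    also have "\<dots> = u ^ k" using that by simp
    finally show ?thesis by simp
  qed
  have "peval u (f s) = (\<Sum>j<N. scaleC (poly (f s) (\<omega> j)) (K j))" if "s \<in> S" for s
  proof -
    have "peval u (f s) = (\<Sum>k\<le>d. \<Sum>j<N. scaleC (coeff (f s) k * \<omega> j ^ k) (K j))"
      unfolding peval_degree_le[OF deg[OF that]]
      by (intro sum.cong refl) (simp add: u_power complex_vector.scale_sum_right scaleC_scaleC)
    also have "\<dots> = (\<Sum>j<N. scaleC (poly (f s) (\<omega> j)) (K j))"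
      by (subst sum.swap) (simp add: poly_altdef_degree_le[OF deg[OF that]] complex_vector.scale_sum_left)
    finally show ?thesis .
  qed
  then have "(\<Sum>s\<in>S. C s * peval u (f s)) = (\<Sum>s\<in>S. \<Sum>j<N. scaleC (poly (f s) (\<omega> j)) (C s) * K j)"
    by (simp add: sum_distrib_left mult_scaleC_left mult_scaleC_right)
  also have "\<dots> = (\<Sum>j<N. (\<Sum>s\<in>S. scaleC (poly (f s) (\<omega> j)) (C s)) * K j)"
    by (subst sum.swap) (simp add: sum_distrib_right)
  also have "norm \<dots> \<le> (\<Sum>j<N. M)"
  proof (intro sum_norm_le)
    fix j
    have "norm ((\<Sum>s\<in>S. scaleC (poly (f s) (\<omega> j)) (C s)) * K j)
        \<le> norm (\<Sum>s\<in>S. scaleC (poly (f s) (\<omega> j)) (C s)) * norm (K j)"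
      by (rule norm_mult_ineq)
    also have "\<dots> \<le> M * 1"
      using M by (intro mult_mono le K) (auto simp: \<omega>_def)
    finally show "norm ((\<Sum>s\<in>S. scaleC (poly (f s) (\<omega> j)) (C s)) * K j) \<le> M" by simp
  qed
  finally show ?thesis by (simp add: N_def)
qed

section \<open>Von Neumann inequality for self-adjoint elements\<close>

lemma power_mult_distrib_commuting:
  fixes x y :: "'a::monoid_mult"
  assumes "x * y = y * x"
  shows "(x * y) ^ n = x ^ n * y ^ n"
proof (induction n)
  case (Suc n)
  have "y * x ^ n = x ^ n * y"
    by (rule power_commuting_commutes[symmetric]) (rule assms)
  then show ?case using Suc by (simp add: mult.assoc) (simp flip: mult.assoc)
qed simp

lemma of_real_power_eq_scaleC:
  "(of_real t :: 'a::unital_cstar_algebra) ^ i = scaleC (of_real t ^ i) 1"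
proof -
  have "(of_real t :: 'a) ^ i = (t ^ i) *\<^sub>R 1" by (metis of_real_def of_real_power)
  also have "\<dots> = scaleC (of_real t ^ i) 1" by (simp only: scaleC_of_real[symmetric] of_real_power)
  finally show ?thesis .
qed

text \<open>
  Write \<open>a = (r / 2) (u + adj u)\<close> with \<open>u\<close> unitary. Then \<open>a ^ i u ^ n\<close>, for \<open>i \<le> n\<close>, is a polynomial in
  \<open>u\<close> of degree at most \<open>2 n\<close>, whose scalar counterpart at \<open>z\<close> on the unit circle is
  \<open>(r Re z) ^ i z ^ n\<close>. So the bound on the circle becomes a bound by the values of the polynomial
  at the real points \<open>r Re z\<close>, up to a factor linear in the degree.
\<close>

lemma norm_poly_at_selfadjoint_le_degree:
  fixes a :: "'a::unital_cstar_algebra"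
  assumes sa: "adj a = a" and r: "norm a < r"
    and le: "\<And>t. \<bar>t\<bar> \<le> r \<Longrightarrow> norm (\<Sum>i\<le>n. c i * of_real t ^ i) \<le> M"
  shows "norm (\<Sum>i\<le>n. c i * a ^ i) \<le> real (2 * n + 1) * M"
proof -
  have "r > 0" using r norm_ge_zero[of a] by linarith
  have "adj (a /\<^sub>R r) = a /\<^sub>R r" by (simp add: adj_scaleR sa)
  moreover have "norm (a /\<^sub>R r) < 1" using r \<open>r > 0\<close> by (simp add: field_simps)
  ultimately obtain u where u: "adj u * u = 1" "u * adj u = 1" "u + adj u = 2 *\<^sub>R (a /\<^sub>R r)"
    by (rule unitary_with_real_part)
  have norm_u: "norm u = 1"
    using cstar_identity[of u] u(1) power2_eq_imp_eq[of "norm u" 1] by simp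
  have a_eq: "a = (r / 2) *\<^sub>R (u + adj u)"
    unfolding u(3) using \<open>r > 0\<close> by simp
  have ua: "a * u = u * a"
  proof -
    have "(u + adj u) * u = u * (u + adj u)" by (simp add: distrib_left distrib_right u(1,2))
    then have "(r / 2) *\<^sub>R (u + adj u) * u = u * ((r / 2) *\<^sub>R (u + adj u))"
      by (simp only: mult_scaleR_left mult_scaleR_right)
    then show ?thesis by (simp only: a_eq[symmetric])
  qed
  have au: "a * u = (r / 2) *\<^sub>R (1 + u * u)"
  proof -
    have "(r / 2) *\<^sub>R (u + adj u) * u = (r / 2) *\<^sub>R (1 + u * u)"
      by (simp only: mult_scaleR_left distrib_right u(1,2) add.commute)
    then show ?thesis by (simp only: a_eq[symmetric])
  qed
  \<comment> \<open>The factor \<open>u ^ n\<close> shifts the Laurent polynomial \<open>((r / 2) (u + 1 / u)) ^ i\<close> into the nonnegative degrees.\<close>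
  define f :: "nat \<Rightarrow> complex poly" where "f i = smult (of_real (r / 2) ^ i) (monom 1 (n - i) * [:1, 0, 1:] ^ i)" for i
  have f_deg: "degree (f i) \<le> 2 * n" if "i \<le> n" for i
  proof -
    have "degree (f i) \<le> degree (monom 1 (n - i) * [:1, 0, 1::complex:] ^ i)"
      by (simp add: f_def degree_smult_le)
    also have "\<dots> \<le> (n - i) + 2 * i"
      by (intro order_trans[OF degree_mult_le] add_mono degree_monom_le
          order_trans[OF degree_power_le]) auto
    finally show ?thesis using that by linarith
  qed
  have f_u: "peval u (f i) = a ^ i * u ^ n" if "i \<le> n" for i
  proof -
    have "peval u (f i) = scaleC (of_real (r / 2) ^ i) (u ^ (n - i) * (1 + u * u) ^ i)"
      by (simp add: f_def)
    also have "\<dots> = u ^ (n - i) * ((r / 2) *\<^sub>R (1 + u * u)) ^ i"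
      by (simp only: scaleR_power mult_scaleR_right scaleC_of_real flip: of_real_power)
    also have "\<dots> = u ^ (n - i) * (u * a) ^ i"
      by (simp flip: au add: ua)
    also have "\<dots> = u ^ (n - i + i) * a ^ i"
      by (simp add: power_mult_distrib_commuting ua power_add mult.assoc)
    also have "\<dots> = a ^ i * u ^ n"
    proof -
      have "a ^ i * u = u * a ^ i" by (rule power_commuting_commutes) (rule ua)
      then have "u ^ n * a ^ i = a ^ i * u ^ n" by (intro power_commuting_commutes) simp
      then show ?thesis using that by simp
    qed
    finally show ?thesis .
  qed
  have f_z: "poly (f i) z = z ^ n * of_real (r * Re z) ^ i" if "i \<le> n" "cmod z = 1" for i z
  proof -
    have "z * cnj z = 1" using that by (simp add: complex_norm_square[symmetric])
    then have "1 + z * z = z * (z + cnj z)" by (simp add: algebra_simps)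
    then have zz: "1 + z * z = z * (2 * of_real (Re z))" by (simp add: complex_add_cnj)
    have "poly (f i) z = of_real (r / 2) ^ i * (z ^ (n - i) * (1 + z * z) ^ i)"
      by (simp add: f_def poly_monom)
    also have "\<dots> = z ^ (n - i) * (of_real (r / 2) * (1 + z * z)) ^ i"
      by (simp only: power_mult_distrib mult_ac)
    also have "\<dots> = z ^ (n - i) * (z * of_real (r * Re z)) ^ i"
      unfolding zz by (simp add: mult_ac)
    also have "\<dots> = z ^ (n - i + i) * of_real (r * Re z) ^ i"
      by (simp only: power_mult_distrib power_add mult.assoc)
    finally show ?thesis using that by simp
  qed
  have "norm (\<Sum>i\<in>{..n}. c i * peval u (f i)) \<le> real (2 * n + 1) * M"
  proof (rule norm_sum_peval_le_circle)
    fix z assume z: "cmod z = 1"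
    have eq: "scaleC (poly (f i) z) (c i) = scaleC (z ^ n) (c i * of_real (r * Re z) ^ i)" if "i \<le> n" for i
      by (simp only: f_z[OF that z] of_real_power_eq_scaleC[where ?'a = 'a] mult_scaleC_right scaleC_scaleC mult_1_right)
    have "(\<Sum>i\<le>n. scaleC (poly (f i) z) (c i))
        = scaleC (z ^ n) (\<Sum>i\<le>n. c i * of_real (r * Re z) ^ i)"
      unfolding complex_vector.scale_sum_right by (intro sum.cong refl) (simp only: eq atMost_iff)
    then have "norm (\<Sum>i\<le>n. scaleC (poly (f i) z) (c i))
        = norm (\<Sum>i\<le>n. c i * of_real (r * Re z) ^ i)"
      by (simp only: norm_scaleC norm_power z power_one mult_1_left)
    also have "\<dots> \<le> M"
      using abs_Re_le_cmod[of z] z \<open>r > 0\<close> by (intro le) (simp add: abs_mult mult_left_le)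
    finally show "norm (\<Sum>i\<le>n. scaleC (poly (f i) z) (c i)) \<le> M" .
  qed (use norm_u f_deg in auto)
  also have "(\<Sum>i\<le>n. c i * peval u (f i)) = (\<Sum>i\<le>n. c i * a ^ i) * u ^ n"
    by (simp add: f_u sum_distrib_right mult.assoc)
  finally have *: "norm ((\<Sum>i\<le>n. c i * a ^ i) * u ^ n) \<le> real (2 * n + 1) * M" .
  have "u ^ n * adj u ^ n = 1"
    using power_mult_distrib_commuting[of u "adj u" n] u(1,2) by simp
  then have "(\<Sum>i\<le>n. c i * a ^ i) = (\<Sum>i\<le>n. c i * a ^ i) * u ^ n * adj u ^ n"
    by (simp add: mult.assoc)
  also have "norm \<dots> \<le> norm ((\<Sum>i\<le>n. c i * a ^ i) * u ^ n) * norm (adj u ^ n)"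
    by (rule norm_mult_ineq)
  also have "\<dots> \<le> norm ((\<Sum>i\<le>n. c i * a ^ i) * u ^ n) * 1"
    using norm_power_ineq[of "adj u" n] by (intro mult_left_mono) (auto simp: norm_adj norm_u)
  finally show ?thesis using * by simp
qed

lemma sum_collect_powers:
  fixes x :: "'a::semiring_1"
  assumes "finite S" "\<And>s. s \<in> S \<Longrightarrow> d s \<le> n"
  shows "(\<Sum>s\<in>S. C s * x ^ d s) = (\<Sum>i\<le>n. (\<Sum>s | s \<in> S \<and> d s = i. C s) * x ^ i)"
proof -
  have "(\<Sum>i\<le>n. (\<Sum>s | s \<in> S \<and> d s = i. C s) * x ^ i)
      = (\<Sum>i\<le>n. \<Sum>s | s \<in> S \<and> d s = i. C s * x ^ d s)"
    by (simp add: sum_distrib_right)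
  also have "\<dots> = (\<Sum>s\<in>S. C s * x ^ d s)"
    by (rule sum.group) (use assms in auto)
  finally show ?thesis by simp
qed

text \<open>
  The coefficients \<open>e\<close> work for all \<open>x\<close> commuting with the \<open>c i\<close> simultaneously; they are needed both
  at the self-adjoint element and at the scalars of the interval.
\<close>

lemma power_of_polynomial_is_polynomial:
  fixes c :: "nat \<Rightarrow> 'a::semiring_1"
  shows "\<exists>e. \<forall>x. (\<forall>i. c i * x = x * c i) \<longrightarrow>
           (\<Sum>i\<le>n * N. e i * x ^ i) = (\<Sum>i\<le>n. c i * x ^ i) ^ N"
proof (induction N)
  case 0
  show ?case by (rule exI[of _ "\<lambda>_. 1"]) simp
next
  case (Suc N)
  then obtain e where e: "\<And>x. (\<forall>i. c i * x = x * c i) \<Longrightarrow>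
      (\<Sum>i\<le>n * N. e i * x ^ i) = (\<Sum>i\<le>n. c i * x ^ i) ^ N" by blast
  define e' where "e' k = (\<Sum>s | s \<in> {..n * N} \<times> {..n} \<and> fst s + snd s = k. e (fst s) * c (snd s))" for k
  show ?case
  proof (rule exI[of _ e'], intro allI impI)
    fix x assume x: "\<forall>i. c i * x = x * c i"
    have "(\<Sum>i\<le>n. c i * x ^ i) ^ Suc N = (\<Sum>i\<le>n * N. e i * x ^ i) * (\<Sum>i\<le>n. c i * x ^ i)"
      by (simp only: power_Suc2 e[OF x])
    also have "\<dots> = (\<Sum>s\<in>{..n * N} \<times> {..n}. e (fst s) * c (snd s) * x ^ (fst s + snd s))"
    proof -
      have "e i * x ^ i * (c j * x ^ j) = e i * c j * x ^ (i + j)" for i j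
        using power_commuting_commutes[of x "c j" i] x by (simp add: power_add) (metis mult.assoc)
      then show ?thesis by (simp add: sum_product sum.cartesian_product case_prod_unfold)
    qed
    also have "\<dots> = (\<Sum>k\<le>n * Suc N. e' k * x ^ k)"
      unfolding e'_def by (rule sum_collect_powers) auto
    finally show "(\<Sum>k\<le>n * Suc N. e' k * x ^ k) = (\<Sum>i\<le>n. c i * x ^ i) ^ Suc N" by simp
  qed
qed

text \<open>
  The coefficients \<open>c i\<close> are elements of the algebra, so that the lemma can replace one variable of
  a polynomial in several commuting variables by a scalar. The factor linear in the degree in
  \<open>norm_poly_at_selfadjoint_le_degree\<close> disappears by the power trick:
  the \<open>2 ^ k\<close>-th power of the polynomial has degree at most \<open>2 ^ k n\<close>, and at the normal element the norm of the power is the power of the norm. The boundary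
  case \<open>\<parallel>a\<parallel> = r\<close> follows by applying this to \<open>s a\<close> and letting \<open>s\<close> increase to 1.
\<close>

theorem von_neumann_inequality:
  fixes a :: "'a::unital_cstar_algebra"
  assumes sa: "adj a = a" and r: "norm a \<le> r"
    and ca: "\<And>i. c i * a = a * c i" and cc: "\<And>i j. c i * adj (c j) = adj (c j) * c i"
    and le: "\<And>t. \<bar>t\<bar> \<le> r \<Longrightarrow> norm (\<Sum>i\<le>n. c i * of_real t ^ i) \<le> M"
  shows "norm (\<Sum>i\<le>n. c i * a ^ i) \<le> M"
proof -
  have "0 \<le> r" using norm_ge_zero r by (rule order_trans)
  then have M: "0 \<le> M" by (intro order_trans[OF norm_ge_zero le[of 0]]) simp
  have strict: "norm (\<Sum>i\<le>n. c i * x ^ i) \<le> M"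
    if sx: "adj x = x" and rx: "norm x < r" and cx: "\<And>i. c i * x = x * c i" for x :: 'a
  proof (rule le_if_powers_le_linear_growth[OF norm_ge_zero M])
    fix k
    let ?p = "\<Sum>i\<le>n. c i * x ^ i"
    obtain e where e: "\<And>y. (\<forall>i. c i * y = y * c i) \<Longrightarrow>
        (\<Sum>i\<le>n * 2 ^ k. e i * y ^ i) = (\<Sum>i\<le>n. c i * y ^ i) ^ (2 ^ k)"
      using power_of_polynomial_is_polynomial[of c n "2 ^ k"] by blast
    have cx': "c i * x ^ j = x ^ j * c i" for i j
      using power_commuting_commutes[of x "c i" j] cx by simp
    have cx'': "adj (c i) * x ^ j = x ^ j * adj (c i)" for i j
      using arg_cong[OF cx'[of i j], of adj] by (simp add: adj_mult adj_power sx)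
    have comm: "(adj (c i) * x ^ i) * (c j * x ^ j) = (c j * x ^ j) * (adj (c i) * x ^ i)" for i j
    proof -
      have "(adj (c i) * x ^ i) * (c j * x ^ j) = adj (c i) * c j * x ^ (i + j)"
        by (metis cx' mult.assoc power_add)
      moreover have "(c j * x ^ j) * (adj (c i) * x ^ i) = c j * adj (c i) * x ^ (j + i)"
        by (metis cx'' mult.assoc power_add)
      ultimately show ?thesis by (simp add: cc add.commute)
    qed
    have "adj ?p = (\<Sum>i\<le>n. adj (c i) * x ^ i)"
      by (simp add: adj_sum adj_mult adj_power sx cx'')
    then have "adj ?p * ?p = ?p * adj ?p"
      by (simp only: sum_product comm) (rule sum.swap)
    then have "norm ?p ^ (2 ^ k) = norm (\<Sum>i\<le>n * 2 ^ k. e i * x ^ i)"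
      using e[of x] cx by (simp add: norm_normal_power)
    also have "\<dots> \<le> real (2 * (n * 2 ^ k) + 1) * M ^ (2 ^ k)"
    proof (rule norm_poly_at_selfadjoint_le_degree[OF sx rx])
      fix t :: real assume "\<bar>t\<bar> \<le> r"
      have "(\<Sum>i\<le>n * 2 ^ k. e i * of_real t ^ i) = (\<Sum>i\<le>n. c i * of_real t ^ i) ^ (2 ^ k)"
        by (rule e) (simp add: of_real_def)
      also have "norm \<dots> \<le> norm (\<Sum>i\<le>n. c i * of_real t ^ i) ^ (2 ^ k)"
        by (rule norm_power_ineq)
      also have "\<dots> \<le> M ^ (2 ^ k)"
        using le[OF \<open>\<bar>t\<bar> \<le> r\<close>] by (intro power_mono) auto
      finally show "norm (\<Sum>i\<le>n * 2 ^ k. e i * of_real t ^ i) \<le> M ^ (2 ^ k)" .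
    qed
    finally show "norm ?p ^ (2 ^ k) \<le> (real (2 * n) * 2 ^ k + 1) * M ^ (2 ^ k)" by (simp add: mult.assoc add.commute)
  qed
  show ?thesis
  proof (cases "a = 0")
    case True
    then show ?thesis using le[of 0] \<open>0 \<le> r\<close> by simp
  next
    case False
    have "((\<lambda>s. norm (\<Sum>i\<le>n. c i * (s *\<^sub>R a) ^ i)) \<longlongrightarrow> norm (\<Sum>i\<le>n. c i * (1 *\<^sub>R a) ^ i)) (at_left 1)"
      by (intro tendsto_intros)
    moreover have "eventually (\<lambda>s. norm (\<Sum>i\<le>n. c i * (s *\<^sub>R a) ^ i) \<le> M) (at_left (1::real))"
    proof -
      have "eventually (\<lambda>s. s \<in> {0<..<1}) (at_left (1::real))"
        by (rule eventually_at_leftI[of 0]) auto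
      then show ?thesis
      proof eventually_elim
        case (elim s)
        have "s * norm a < 1 * norm a"
          using elim False by (intro mult_strict_right_mono) auto
        then show ?case using elim r
          by (intro strict) (auto simp: adj_scaleR sa ca)
      qed
    qed
    ultimately have "norm (\<Sum>i\<le>n. c i * (1 *\<^sub>R a) ^ i) \<le> M"
      by (rule tendsto_upperbound) simp
    then show ?thesis by simp
  qed
qed

text \<open>
  The case of scalar coefficients, valid in every C*-algebra.
\<close>

lemma norm_peval_le:
  fixes a :: "'a::unital_cstar_algebra"
  assumes "adj a = a" "norm a \<le> r"
    and "\<And>t. \<bar>t\<bar> \<le> r \<Longrightarrow> cmod (poly p (of_real t)) \<le> M"
  shows "norm (peval a p) \<le> M"
proof -
  have eq: "scaleC (coeff p i) 1 * of_real t ^ i = scaleC (coeff p i * of_real t ^ i) (1::'a)" for i t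
    by (simp add: of_real_power_eq_scaleC[where ?'a = 'a] mult_scaleC_right scaleC_scaleC mult.commute)
  have "norm (\<Sum>i\<le>degree p. scaleC (coeff p i) 1 * a ^ i) \<le> M"
  proof (rule von_neumann_inequality[OF assms(1,2)])
    fix t :: real assume t: "\<bar>t\<bar> \<le> r"
    have "(\<Sum>i\<le>degree p. scaleC (coeff p i) 1 * of_real t ^ i) = scaleC (poly p (of_real t)) (1::'a)"
      by (simp add: eq poly_altdef complex_vector.scale_sum_left)
    then show "norm (\<Sum>i\<le>degree p. scaleC (coeff p i) 1 * (of_real t :: 'a) ^ i) \<le> M"
      using assms(3)[OF t] by (simp add: norm_scaleC)
  qed (simp_all add: mult_scaleC_left mult_scaleC_right adj_scaleC adj_one scaleC_scaleC mult.commute)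
  then show ?thesis by (simp add: peval_def mult_scaleC_left)
qed

section \<open>Alternating products\<close>

text \<open>
  With \<open>n = m\<close>, \<open>y i = a i ^ \<delta> i\<close> and \<open>b m = 1\<close> this is the monomial
  \<open>a\<^sub>1 ^ \<delta>\<^sub>1 b\<^sub>1 \<dots> b\<^sub>m\<^sub>-\<^sub>1 a\<^sub>m ^ \<delta>\<^sub>m\<close> in \<open>poly_tensor\<close>, and it is multilinear in the slots \<open>y i\<close>, in which
  all approximations take place.
\<close>

primrec alternating_prod :: "nat \<Rightarrow> (nat \<Rightarrow> 'a) \<Rightarrow> (nat \<Rightarrow> 'a) \<Rightarrow> 'a::monoid_mult" where
  "alternating_prod 0 y b = 1"
| "alternating_prod (Suc n) y b = alternating_prod n y b * (y (Suc n) * b (Suc n))"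

lemma prod_list_eq_alternating_prod:
  "prod_list (map (\<lambda>i. y i * b i) [1..<Suc n]) = alternating_prod n y b"
  by (induction n) auto

lemma alternating_prod_cong:
  assumes "\<And>i. 1 \<le> i \<Longrightarrow> i \<le> n \<Longrightarrow> y i = y' i" "\<And>i. 1 \<le> i \<Longrightarrow> i \<le> n \<Longrightarrow> b i = b' i"
  shows "alternating_prod n y b = alternating_prod n y' b'"
  using assms by (induction n) auto

lemma norm_alternating_prod_le:
  fixes y b :: "nat \<Rightarrow> 'a::real_normed_algebra_1"
  shows "norm (alternating_prod n y b) \<le> (\<Prod>i\<in>{1..n}. norm (y i)) * (\<Prod>i\<in>{1..n}. norm (b i))"
proof (induction n)
  case (Suc n)
  have "norm (alternating_prod (Suc n) y b)
      \<le> norm (alternating_prod n y b) * (norm (y (Suc n)) * norm (b (Suc n)))"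
    by (simp add: order_trans[OF norm_mult_ineq] mult_left_mono norm_mult_ineq)
  also have "\<dots> \<le> ((\<Prod>i\<in>{1..n}. norm (y i)) * (\<Prod>i\<in>{1..n}. norm (b i)))
      * (norm (y (Suc n)) * norm (b (Suc n)))"
    by (intro mult_right_mono Suc) auto
  finally show ?case by (simp add: prod.cl_ivl_Suc mult_ac)
qed simp

lemma tendsto_alternating_prod:
  fixes y :: "'x \<Rightarrow> nat \<Rightarrow> 'a::real_normed_algebra_1"
  assumes "\<And>i. 1 \<le> i \<Longrightarrow> i \<le> n \<Longrightarrow> ((\<lambda>x. y x i) \<longlongrightarrow> z i) F"
  shows "((\<lambda>x. alternating_prod n (y x) b) \<longlongrightarrow> alternating_prod n z b) F"
  using assms by (induction n) (auto intro!: tendsto_intros)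

lemma sum_PiE_insert:
  assumes "finite S" "finite (J x)" "\<And>i. i \<in> S \<Longrightarrow> finite (J i)" "x \<notin> S"
  shows "(\<Sum>f\<in>PiE (insert x S) J. F f) = (\<Sum>g\<in>PiE S J. \<Sum>j\<in>J x. F (g(x := j)))"
proof -
  have "(\<Sum>f\<in>PiE (insert x S) J. F f) = (\<Sum>(j, g)\<in>J x \<times> PiE S J. F (g(x := j)))"
    unfolding PiE_insert_eq
    by (subst sum.reindex[OF inj_combinator[OF assms(4)]]) (auto intro: sum.cong)
  also have "\<dots> = (\<Sum>j\<in>J x. \<Sum>g\<in>PiE S J. F (g(x := j)))"
    by (simp add: sum.cartesian_product)
  also have "\<dots> = (\<Sum>g\<in>PiE S J. \<Sum>j\<in>J x. F (g(x := j)))"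
    by (rule sum.swap)
  finally show ?thesis .
qed

lemma alternating_prod_sum:
  fixes p :: "nat \<Rightarrow> 'j \<Rightarrow> 'a::unital_cstar_algebra"
  assumes "\<And>i. 1 \<le> i \<Longrightarrow> i \<le> n \<Longrightarrow> finite (J i)"
  shows "alternating_prod n (\<lambda>i. \<Sum>j\<in>J i. scaleC (c i j) (p i j)) b
    = (\<Sum>f\<in>PiE {1..n} J. scaleC (\<Prod>i\<in>{1..n}. c i (f i)) (alternating_prod n (\<lambda>i. p i (f i)) b))"
  using assms
proof (induction n)
  case (Suc n)
  let ?A = "\<lambda>f. alternating_prod n (\<lambda>i. p i (f i)) b"
  let ?k = "Suc n"
  have "alternating_prod ?k (\<lambda>i. \<Sum>j\<in>J i. scaleC (c i j) (p i j)) b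
      = (\<Sum>f\<in>PiE {1..n} J. scaleC (\<Prod>i\<in>{1..n}. c i (f i)) (?A f))
        * ((\<Sum>j\<in>J ?k. scaleC (c ?k j) (p ?k j)) * b ?k)"
    using Suc by simp
  also have "\<dots> = (\<Sum>f\<in>PiE {1..n} J. \<Sum>j\<in>J ?k.
      scaleC ((\<Prod>i\<in>{1..n}. c i (f i)) * c ?k j) (?A f * (p ?k j * b ?k)))"
    unfolding sum_distrib_right[of _ _ "b ?k"] sum_product
    by (simp add: mult_scaleC_left mult_scaleC_right scaleC_scaleC mult_ac)
  also have "\<dots> = (\<Sum>f\<in>PiE {1..n} J. \<Sum>j\<in>J ?k.
      scaleC (\<Prod>i\<in>{1..?k}. c i ((f(?k := j)) i))
        (alternating_prod ?k (\<lambda>i. p i ((f(?k := j)) i)) b))"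
  proof (intro sum.cong refl)
    fix f j
    have "?A (f(?k := j)) = ?A f" by (rule alternating_prod_cong) auto
    moreover have "(\<Prod>i\<in>{1..n}. c i ((f(?k := j)) i)) = (\<Prod>i\<in>{1..n}. c i (f i))"
      by (rule prod.cong) auto
    ultimately show "scaleC ((\<Prod>i\<in>{1..n}. c i (f i)) * c ?k j) (?A f * (p ?k j * b ?k))
        = scaleC (\<Prod>i\<in>{1..?k}. c i ((f(?k := j)) i))
        (alternating_prod ?k (\<lambda>i. p i ((f(?k := j)) i)) b)"
      by (simp add: prod.cl_ivl_Suc del: fun_upd_apply) simp
  qed
  also have "\<dots> = (\<Sum>f\<in>PiE (insert ?k {1..n}) J. scaleC (\<Prod>i\<in>{1..?k}. c i (f i))
        (alternating_prod ?k (\<lambda>i. p i (f i)) b))"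
    by (subst sum_PiE_insert) (use Suc.prems in auto)
  also have "insert ?k {1..n} = {1..?k}" by auto
  finally show ?case .
qed simp

lemma alternating_prod_scaleC:
  fixes y :: "nat \<Rightarrow> 'a::unital_cstar_algebra"
  shows "alternating_prod n (\<lambda>i. scaleC (c i) (y i)) b
    = scaleC (\<Prod>i\<in>{1..n}. c i) (alternating_prod n y b)"
  by (induction n)
    (simp_all add: mult_scaleC_left mult_scaleC_right scaleC_scaleC prod.cl_ivl_Suc mult_ac)

lemma poly_tensor_eq_alternating_prod:
  fixes a b :: "nat \<Rightarrow> 'a::unital_cstar_algebra"
  assumes "m \<ge> 1"
  shows "poly_tensor m P a b = (\<Sum>\<delta>\<in>Poly_Mapping.keys P. scaleC (Poly_Mapping.lookup P \<delta>)
    (alternating_prod m (\<lambda>i. a i ^ Poly_Mapping.lookup \<delta> i) (b(m := 1))))"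
proof -
  obtain n where m: "m = Suc n" using assms by (cases m) auto
  have "prod_list (map (\<lambda>i. a i ^ Poly_Mapping.lookup \<delta> i * b i) [1..<m])
      = alternating_prod n (\<lambda>i. a i ^ Poly_Mapping.lookup \<delta> i) (b(m := 1))" for \<delta>
    unfolding m prod_list_eq_alternating_prod by (rule alternating_prod_cong) auto
  then show ?thesis by (simp add: poly_tensor_def m)
qed

lemma poly_eval_superset:
  assumes "finite K" "Poly_Mapping.keys P \<subseteq> K"
  shows "poly_eval m P x = (\<Sum>\<delta>\<in>K. Poly_Mapping.lookup P \<delta> *
    (\<Prod>i\<in>{1..m}. complex_of_real (x i) ^ Poly_Mapping.lookup \<delta> i))"
  unfolding poly_eval_def using assms
  by (intro sum.mono_neutral_left) (auto simp: in_keys_iff)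

lemma poly_tensor_superset:
  assumes "finite K" "Poly_Mapping.keys P \<subseteq> K"
  shows "poly_tensor m P a b = (\<Sum>\<delta>\<in>K. scaleC (Poly_Mapping.lookup P \<delta>)
    (prod_list (map (\<lambda>i. a i ^ Poly_Mapping.lookup \<delta> i * b i) [1..<m]) *
      a m ^ Poly_Mapping.lookup \<delta> m))"
  unfolding poly_tensor_def using assms
  by (intro sum.mono_neutral_left) (auto simp: in_keys_iff)

lemma polys_lincomb:
  assumes "P \<in> polys m" "Q \<in> polys m"
  obtains R where "R \<in> polys m"
    "\<And>x. poly_eval m R x = c * poly_eval m P x + d * poly_eval m Q x"
    "\<And>a b :: nat \<Rightarrow> 'a::unital_cstar_algebra.
       poly_tensor m R a b = scaleC c (poly_tensor m P a b) + scaleC d (poly_tensor m Q a b)"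
proof -
  define R where "R = Poly_Mapping.map ((*) c) P + Poly_Mapping.map ((*) d) Q"
  let ?K = "Poly_Mapping.keys P \<union> Poly_Mapping.keys Q"
  have l: "Poly_Mapping.lookup R \<delta> = c * Poly_Mapping.lookup P \<delta> + d * Poly_Mapping.lookup Q \<delta>" for \<delta>
    by (auto simp: R_def lookup_add map.rep_eq when_def)
  have K: "Poly_Mapping.keys R \<subseteq> ?K"
    by (auto simp: in_keys_iff l)
  show ?thesis
  proof (rule that[of R])
    show "R \<in> polys m" using assms K by (auto simp: polys_def)
    show "poly_eval m R x = c * poly_eval m P x + d * poly_eval m Q x" for x
      using K by (simp add: poly_eval_superset[of ?K] l distrib_right sum.distrib sum_distrib_left mult.assoc)
    show "poly_tensor m R a b = scaleC c (poly_tensor m P a b) + scaleC d (poly_tensor m Q a b)"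
      for a b :: "nat \<Rightarrow> 'a"
      using K by (simp add: poly_tensor_superset[of ?K] l scaleC_add_left sum.distrib
          complex_vector.scale_sum_right scaleC_scaleC)
  qed
qed

section \<open>Extension by continuity\<close>

text \<open>
  The map is given on indices \<open>p\<close> of the dense points \<open>\<iota> p\<close>, so that \<open>T0\<close> may be the polynomial
  calculus. The pseudo-distance \<open>N \<phi> \<psi>\<close> will be \<open>q r (\<phi> - \<psi>)\<close> for a seminorm \<open>q r\<close>; the Lipschitz bound
  then makes \<open>T0 p\<close> depend on the polynomial function \<open>\<iota> p\<close> alone.
\<close>

lemma extend_dense_lipschitz:
  fixes T0 :: "'p \<Rightarrow> 'a::{real_normed_vector, complete_space}" and N :: "'v \<Rightarrow> 'v \<Rightarrow> real"
  assumes bound: "\<And>p p'. p \<in> D \<Longrightarrow> p' \<in> D \<Longrightarrow> norm (T0 p - T0 p') \<le> B * N (\<iota> p) (\<iota> p')"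
    and B: "B \<ge> 0"
    and \<iota>: "\<And>p. p \<in> D \<Longrightarrow> \<iota> p \<in> F" and CF: "C \<subseteq> F"
    and sym: "\<And>u v. u \<in> F \<Longrightarrow> v \<in> F \<Longrightarrow> N u v = N v u"
    and tri: "\<And>u v w. u \<in> F \<Longrightarrow> v \<in> F \<Longrightarrow> w \<in> F \<Longrightarrow> N u w \<le> N u v + N v w"
    and nonneg: "\<And>u v. 0 \<le> N u v"
    and dense: "\<And>v e. v \<in> C \<Longrightarrow> e > 0 \<Longrightarrow> \<exists>p\<in>D. N (\<iota> p) v < e"
  obtains T where
    "\<And>v p. v \<in> C \<Longrightarrow> (\<And>n. p n \<in> D) \<Longrightarrow> (\<lambda>n::nat. N (\<iota> (p n)) v) \<longlonglongrightarrow> 0 \<Longrightarrow> (\<lambda>n. T0 (p n)) \<longlonglongrightarrow> T v"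
    "\<And>v w. v \<in> C \<Longrightarrow> w \<in> C \<Longrightarrow> norm (T v - T w) \<le> B * N v w"
    "\<And>v. v \<in> C \<Longrightarrow> \<exists>p. (\<forall>n::nat. p n \<in> D) \<and> (\<lambda>n. N (\<iota> (p n)) v) \<longlonglongrightarrow> 0"
proof -
  have seq: "\<exists>p. (\<forall>n::nat. p n \<in> D) \<and> (\<lambda>n. N (\<iota> (p n)) v) \<longlonglongrightarrow> 0" if v: "v \<in> C" for v
  proof -
    have "\<exists>p\<in>D. N (\<iota> p) v < 1 / real (Suc n)" for n
      by (rule dense[OF v]) simp
    then obtain p where p: "\<And>n. p n \<in> D" "\<And>n. N (\<iota> (p n)) v < 1 / real (Suc n)"
      by metis
    have "(\<lambda>n. N (\<iota> (p n)) v) \<longlonglongrightarrow> 0"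
      by (rule tendsto_sandwich[OF _ _ tendsto_const LIMSEQ_Suc[OF lim_1_over_n]])
        (use p nonneg in \<open>auto intro!: always_eventually less_imp_le\<close>)
    then show ?thesis using p(1) by blast
  qed
  have lim_N: "(\<lambda>n. N (\<iota> (p n)) (\<iota> (p' n))) \<longlonglongrightarrow> 0"
    if "v \<in> C" "\<And>n. p n \<in> D" "\<And>n. p' n \<in> D" "(\<lambda>n::nat. N (\<iota> (p n)) v) \<longlonglongrightarrow> 0"
      "(\<lambda>n. N (\<iota> (p' n)) v) \<longlonglongrightarrow> 0" for v p p'
  proof (rule tendsto_sandwich[OF _ _ tendsto_const tendsto_add_zero[OF that(4,5)]])
    show "\<forall>\<^sub>F n in sequentially. N (\<iota> (p n)) (\<iota> (p' n)) \<le> N (\<iota> (p n)) v + N (\<iota> (p' n)) v"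
    proof (intro always_eventually allI)
      fix n
      have "v \<in> F" using that(1) CF by blast
      then show "N (\<iota> (p n)) (\<iota> (p' n)) \<le> N (\<iota> (p n)) v + N (\<iota> (p' n)) v"
        using tri[of "\<iota> (p n)" v "\<iota> (p' n)"] sym[of v "\<iota> (p' n)"] \<iota> that(2,3) by simp
    qed
  qed (simp add: nonneg)
  have conv: "convergent (\<lambda>n. T0 (p n))"
    if v: "v \<in> C" and p: "\<And>n. p n \<in> D" and lim: "(\<lambda>n::nat. N (\<iota> (p n)) v) \<longlonglongrightarrow> 0" for v p
  proof (rule Cauchy_convergent, rule metric_CauchyI)
    fix e :: real assume e: "e > 0"
    define d where "d = e / (2 * (B + 1))"
    have d: "d > 0" using e B by (simp add: d_def)
    then obtain M where M: "\<And>n. n \<ge> M \<Longrightarrow> N (\<iota> (p n)) v < d"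
      using order_tendstoD(2)[OF lim] unfolding eventually_sequentially by blast
    have "dist (T0 (p m)) (T0 (p n)) < e" if "m \<ge> M" "n \<ge> M" for m n
    proof -
      have "v \<in> F" using v CF by blast
      then have "N (\<iota> (p m)) (\<iota> (p n)) \<le> N (\<iota> (p m)) v + N (\<iota> (p n)) v"
        using tri[of "\<iota> (p m)" v "\<iota> (p n)"] sym[of v "\<iota> (p n)"] \<iota> p by simp
      also have "\<dots> \<le> 2 * d" using M[OF that(1)] M[OF that(2)] by simp
      finally have "B * N (\<iota> (p m)) (\<iota> (p n)) \<le> B * (2 * d)"
        using B by (rule mult_left_mono)
      also have "\<dots> < (B + 1) * (2 * d)" using d by simp
      also have "\<dots> = e"
      proof -
        have "B + 1 \<noteq> 0" using B by linarith
        then show ?thesis by (simp add: d_def field_simps)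
      qed
      finally show ?thesis using bound[OF p p, of m n] by (simp add: dist_norm)
    qed
    then show "\<exists>M. \<forall>m\<ge>M. \<forall>n\<ge>M. dist (T0 (p m)) (T0 (p n)) < e" by blast
  qed
  define S where "S v = (SOME p. (\<forall>n::nat. p n \<in> D) \<and> (\<lambda>n. N (\<iota> (p n)) v) \<longlonglongrightarrow> 0)" for v
  have S: "S v n \<in> D" "(\<lambda>n. N (\<iota> (S v n)) v) \<longlonglongrightarrow> 0" if "v \<in> C" for v n
    using someI_ex[OF seq[OF that]] unfolding S_def by blast+
  define T where "T v = lim (\<lambda>n. T0 (S v n))" for v
  have T_S: "(\<lambda>n. T0 (S v n)) \<longlonglongrightarrow> T v" if "v \<in> C" for v
    using conv[OF that S(1)[OF that] S(2)[OF that]] unfolding T_def by (simp add: convergent_LIMSEQ_iff)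
  have T: "(\<lambda>n. T0 (p n)) \<longlonglongrightarrow> T v"
    if v: "v \<in> C" and p: "\<And>n. p n \<in> D" and lim: "(\<lambda>n::nat. N (\<iota> (p n)) v) \<longlonglongrightarrow> 0" for v p
  proof -
    have "(\<lambda>n. T0 (p n) - T0 (S v n)) \<longlonglongrightarrow> 0"
    proof (rule Lim_null_comparison)
      show "\<forall>\<^sub>F n in sequentially. norm (T0 (p n) - T0 (S v n)) \<le> B * N (\<iota> (p n)) (\<iota> (S v n))"
        by (intro always_eventually allI bound p S v)
      show "(\<lambda>n. B * N (\<iota> (p n)) (\<iota> (S v n))) \<longlonglongrightarrow> 0"
        by (intro tendsto_mult_right_zero lim_N[OF v p S(1)[OF v] lim S(2)[OF v]])
    qed
    from tendsto_add[OF this T_S[OF v]] show ?thesis by simp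
  qed
  have "norm (T v - T w) \<le> B * N v w" if vw: "v \<in> C" "w \<in> C" for v w
  proof -
    have F: "v \<in> F" "w \<in> F" using vw CF by auto
    have le: "norm (T0 (S v n) - T0 (S w n)) \<le> B * (N (\<iota> (S v n)) v + N v w + N (\<iota> (S w n)) w)" for n
    proof -
      note SF = \<iota>[OF S(1)[OF vw(1), of n]] \<iota>[OF S(1)[OF vw(2), of n]]
      have "N (\<iota> (S v n)) (\<iota> (S w n)) \<le> N (\<iota> (S v n)) v + N v w + N (\<iota> (S w n)) w"
        using tri[OF SF(1) F(1) SF(2)] tri[OF F SF(2)] sym[OF F(2) SF(2)] by linarith
      then show ?thesis
        using bound[OF S(1)[OF vw(1)] S(1)[OF vw(2)], of n n] mult_left_mono[OF _ B] by fastforce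
    qed
    have "(\<lambda>n. norm (T0 (S v n) - T0 (S w n))) \<longlonglongrightarrow> norm (T v - T w)"
      by (intro tendsto_intros T_S vw)
    moreover have "(\<lambda>n. B * (N (\<iota> (S v n)) v + N v w + N (\<iota> (S w n)) w)) \<longlonglongrightarrow> B * (0 + N v w + 0)"
      by (intro tendsto_intros S vw)
    ultimately have "norm (T v - T w) \<le> B * (0 + N v w + 0)"
      by (rule LIMSEQ_le) (use le in blast)
    then show ?thesis by simp
  qed
  then show ?thesis using that[of T] T seq by blast
qed

section \<open>The functional calculus of an admissible family\<close>

lemma polys_eval_lincomb:
  assumes "P \<in> polys m" "Q \<in> polys m"
  shows "\<exists>R\<in>polys m. \<forall>x. poly_eval m R x = c * poly_eval m P x + d * poly_eval m Q x"
  by (rule polys_lincomb[OF assms, where c = c and d = d and ?'a = complex]) blast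

lemma cube_subset_real_space: "cube r m \<subseteq> real_space m"
  by (auto simp: cube_def real_space_def PiE_def)

lemma restr_cube_restr_real_space: "restr (cube r m) (restr (real_space m) \<phi>) = restr (cube r m) \<phi>"
  using cube_subset_real_space[of r m] by (auto simp: restr_def fun_eq_iff)

lemma restr_cfun:
  assumes "\<phi> \<in> cfun Y" "X \<subseteq> Y"
  shows "restr X \<phi> \<in> cfun X"
proof -
  have "continuous_on X \<phi>" using assms continuous_on_subset by (auto simp: cfun_def)
  then have "continuous_on X (restr X \<phi>)"
    by (rule continuous_on_eq) (simp add: restr_def)
  then show ?thesis by (simp add: cfun_def restr_def)
qed

lemma cfun_lincomb:
  assumes "\<phi> \<in> cfun X" "\<psi> \<in> cfun X"
  shows "(\<lambda>x. c * \<phi> x + d * \<psi> x) \<in> cfun X"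
  using assms by (auto simp: cfun_def intro!: continuous_intros)

lemma cfun_restr_poly_eval: "restr X (poly_eval m P) \<in> cfun X"
proof -
  have "continuous_on UNIV (poly_eval m P)"
    unfolding poly_eval_def by (intro continuous_intros continuous_on_product_coordinates)
  then have "poly_eval m P \<in> cfun UNIV" by (simp add: cfun_def)
  then show ?thesis by (rule restr_cfun) simp
qed

text \<open>
  The topology is generated by the finite seminorms \<open>q r\<close> for all \<open>r > 0\<close>. Those for different \<open>r\<close> need
  not be comparable, so a basic neighbourhood involves finitely many radii. A single radius
  suffices, however, to bound the polynomial calculus at fixed self-adjoint elements, and a linear
  map bounded by one \<open>q r\<close> on the polynomials extends to their closure.
\<close>

locale norms_on_cubes =
  fixes \<alpha> :: norm_family and m :: nat
  assumes norm: "\<And>r. r > 0 \<Longrightarrow> possibly_infinite_norm (cfun (cube r m)) (\<alpha> r m)"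
    and finite_poly: "\<And>r P. r > 0 \<Longrightarrow> P \<in> polys m \<Longrightarrow> \<alpha> r m (restr (cube r m) (poly_eval m P)) < \<infinity>"
begin

abbreviation F where "F \<equiv> finite_space \<alpha> m"

definition q :: "real \<Rightarrow> ((nat \<Rightarrow> real) \<Rightarrow> complex) \<Rightarrow> real" where
  "q r \<phi> = enn2real (\<alpha> r m (restr (cube r m) \<phi>))"

lemma q_nonneg: "0 \<le> q r \<phi>"
  by (simp add: q_def)

lemma ennreal_q:
  assumes "\<phi> \<in> F" "r > 0"
  shows "\<alpha> r m (restr (cube r m) \<phi>) = ennreal (q r \<phi>)"
  using assms by (auto simp: q_def finite_space_def ennreal_enn2real_if less_top)

lemma \<alpha>_lincomb_le:
  assumes "\<phi> \<in> F" "\<psi> \<in> F" "r > 0"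
  shows "\<alpha> r m (restr (cube r m) (\<lambda>x. c * \<phi> x + d * \<psi> x))
    \<le> ennreal (cmod c * q r \<phi> + cmod d * q r \<psi>)"
proof -
  let ?R = "restr (cube r m)"
  have mem: "?R \<phi> \<in> cfun (cube r m)" "?R \<psi> \<in> cfun (cube r m)"
    using assms restr_cfun[OF _ cube_subset_real_space] by (auto simp: finite_space_def)
  have mem': "(\<lambda>x. c * ?R \<phi> x) \<in> cfun (cube r m)" "(\<lambda>x. d * ?R \<psi> x) \<in> cfun (cube r m)"
    using cfun_lincomb[OF mem, of c 0] cfun_lincomb[OF mem, of 0 d] by simp_all
  have eq: "?R (\<lambda>x. c * \<phi> x + d * \<psi> x) = (\<lambda>x. c * ?R \<phi> x + d * ?R \<psi> x)"
    by (auto simp: restr_def)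
  have "\<alpha> r m (?R (\<lambda>x. c * \<phi> x + d * \<psi> x))
      \<le> \<alpha> r m (\<lambda>x. c * ?R \<phi> x) + \<alpha> r m (\<lambda>x. d * ?R \<psi> x)"
    unfolding eq using norm[OF assms(3)] mem' by (simp add: possibly_infinite_norm_def)
  also have "\<dots> = ennreal (cmod c) * \<alpha> r m (?R \<phi>) + ennreal (cmod d) * \<alpha> r m (?R \<psi>)"
    using norm[OF assms(3)] mem by (simp add: possibly_infinite_norm_def)
  also have "\<dots> = ennreal (cmod c * q r \<phi> + cmod d * q r \<psi>)"
    by (simp add: ennreal_q assms q_nonneg ennreal_mult ennreal_plus)
  finally show ?thesis .
qed

lemma F_lincomb:
  assumes "\<phi> \<in> F" "\<psi> \<in> F"
  shows "(\<lambda>x. c * \<phi> x + d * \<psi> x) \<in> F"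
proof -
  have "\<phi> \<in> cfun (real_space m)" "\<psi> \<in> cfun (real_space m)"
    using assms by (simp_all add: finite_space_def)
  then have "(\<lambda>x. c * \<phi> x + d * \<psi> x) \<in> cfun (real_space m)"
    by (rule cfun_lincomb)
  moreover have "\<alpha> r m (restr (cube r m) (\<lambda>x. c * \<phi> x + d * \<psi> x)) < \<infinity>" if "r > 0" for r
    using \<alpha>_lincomb_le[OF assms that] by (rule le_less_trans) simp
  ultimately show ?thesis by (simp add: finite_space_def)
qed

lemma q_lincomb_le:
  assumes "\<phi> \<in> F" "\<psi> \<in> F" "r > 0"
  shows "q r (\<lambda>x. c * \<phi> x + d * \<psi> x) \<le> cmod c * q r \<phi> + cmod d * q r \<psi>"
proof -
  have "0 \<le> cmod c * q r \<phi> + cmod d * q r \<psi>" by (simp add: q_nonneg)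
  then show ?thesis
    using \<alpha>_lincomb_le[OF assms, of c d]
    unfolding ennreal_q[OF F_lincomb[OF assms(1,2)] assms(3), of c d] by (subst (asm) ennreal_le_iff)
qed

lemma F_diff: "\<phi> \<in> F \<Longrightarrow> \<psi> \<in> F \<Longrightarrow> (\<lambda>x. \<phi> x - \<psi> x) \<in> F"
  using F_lincomb[of \<phi> \<psi> 1 "-1"] by simp

lemma q_diff_commute:
  assumes "\<phi> \<in> F" "\<psi> \<in> F" "r > 0"
  shows "q r (\<lambda>x. \<phi> x - \<psi> x) = q r (\<lambda>x. \<psi> x - \<phi> x)"
  using q_lincomb_le[OF F_diff[OF assms(1,2)] F_diff[OF assms(1,2)] assms(3), of "-1" 0]
    q_lincomb_le[OF F_diff[OF assms(2,1)] F_diff[OF assms(2,1)] assms(3), of "-1" 0]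
  by simp

lemma q_diff_triangle:
  assumes "\<phi> \<in> F" "\<psi> \<in> F" "\<xi> \<in> F" "r > 0"
  shows "q r (\<lambda>x. \<phi> x - \<xi> x) \<le> q r (\<lambda>x. \<phi> x - \<psi> x) + q r (\<lambda>x. \<psi> x - \<xi> x)"
  using q_lincomb_le[OF F_diff[OF assms(1,2)] F_diff[OF assms(2,3)] assms(4), of 1 1] by simp

lemma q_zero: "r > 0 \<Longrightarrow> q r (\<lambda>x. 0) = 0"
proof -
  assume "r > 0"
  moreover have "(\<lambda>x. 0) \<in> cfun (cube r m)" by (simp add: cfun_def)
  ultimately have "\<alpha> r m (\<lambda>x. 0) = 0"
    using norm[of r] unfolding possibly_infinite_norm_def by blast
  then show "q r (\<lambda>x. 0) = 0" by (simp add: q_def restr_def)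
qed

lemma q_diff_self: "r > 0 \<Longrightarrow> q r (\<lambda>x. \<phi> x - \<phi> x) = 0"
  by (simp add: q_zero)

lemma \<alpha>_less_iff:
  assumes "\<phi> \<in> F" "\<psi> \<in> F" "r > 0"
  shows "\<alpha> r m (restr (cube r m) (\<lambda>x. \<psi> x - \<phi> x)) < ennreal e \<longleftrightarrow> q r (\<lambda>x. \<psi> x - \<phi> x) < e"
  using ennreal_q[OF F_diff[OF assms(2,1)] assms(3)] by (simp add: ennreal_less_iff q_nonneg)

lemma openin_q_ball:
  assumes "\<phi> \<in> F" "r > 0" "e > 0"
  shows "openin (seminorm_topology \<alpha> m) {\<psi> \<in> F. q r (\<lambda>x. \<psi> x - \<phi> x) < e}"
proof -
  have "{\<psi> \<in> F. q r (\<lambda>x. \<psi> x - \<phi> x) < e}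
      = {\<psi> \<in> F. \<alpha> r m (restr (cube r m) (\<lambda>x. \<psi> x - \<phi> x)) < ennreal e}"
    using \<alpha>_less_iff assms by blast
  also have "openin (seminorm_topology \<alpha> m) \<dots>"
    unfolding seminorm_topology_def
    by (rule topology_generated_by_Basis) (use assms in \<open>auto intro!: exI[of _ r] exI[of _ "ennreal e"]\<close>)
  finally show ?thesis .
qed

lemma topspace_seminorm_topology: "topspace (seminorm_topology \<alpha> m) = F"
proof
  show "topspace (seminorm_topology \<alpha> m) \<subseteq> F"
    unfolding seminorm_topology_def by auto
  show "F \<subseteq> topspace (seminorm_topology \<alpha> m)"
  proof
    fix \<phi> assume "\<phi> \<in> F"
    then have "\<phi> \<in> {\<psi> \<in> F. q 1 (\<lambda>x. \<psi> x - \<phi> x) < 1}"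
      by (simp add: q_zero)
    then show "\<phi> \<in> topspace (seminorm_topology \<alpha> m)"
      using openin_subset[OF openin_q_ball[OF \<open>\<phi> \<in> F\<close>, of 1 1]] by auto
  qed
qed

lemma seminorm_topology_nbhd:
  assumes "openin (seminorm_topology \<alpha> m) W" "\<phi> \<in> W"
  shows "\<exists>R e. finite R \<and> R \<subseteq> {0<..} \<and> e > 0 \<and> {\<psi> \<in> F. \<forall>r\<in>R. q r (\<lambda>x. \<psi> x - \<phi> x) < e} \<subseteq> W"
  using assms unfolding seminorm_topology_def openin_topology_generated_by_iff
proof (induction arbitrary: \<phi> rule: generate_topology_on.induct)
  case (Int a b)
  obtain R e where 1: "finite R" "R \<subseteq> {0<..}" "e > 0" "{\<psi> \<in> F. \<forall>r\<in>R. q r (\<lambda>x. \<psi> x - \<phi> x) < e} \<subseteq> a"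
    using Int.IH(1)[of \<phi>] Int.prems by auto
  obtain R' e' where 2: "finite R'" "R' \<subseteq> {0<..}" "e' > 0" "{\<psi> \<in> F. \<forall>r\<in>R'. q r (\<lambda>x. \<psi> x - \<phi> x) < e'} \<subseteq> b"
    using Int.IH(2)[of \<phi>] Int.prems by auto
  show ?case
    by (rule exI[of _ "R \<union> R'"], rule exI[of _ "min e e'"]) (use 1 2 in auto)
next
  case (UN K)
  then obtain k where k: "k \<in> K" "\<phi> \<in> k" by blast
  from UN.IH[OF this] show ?case using k(1) by (meson Union_upper order_trans)
next
  case (Basis s)
  then obtain \<phi>0 r \<epsilon> where s: "s = {\<psi> \<in> F. \<alpha> r m (restr (cube r m) (\<lambda>x. \<psi> x - \<phi>0 x)) < \<epsilon>}"
    and \<phi>0: "\<phi>0 \<in> F" and r: "r > 0"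
    by blast
  have \<phi>: "\<phi> \<in> F" and "ennreal (q r (\<lambda>x. \<phi> x - \<phi>0 x)) < \<epsilon>"
    using Basis.prems unfolding s by (auto simp: ennreal_q[OF F_diff[OF _ \<phi>0] r])
  then obtain d where d: "ennreal (q r (\<lambda>x. \<phi> x - \<phi>0 x)) < d" "d < \<epsilon>"
    using dense by blast
  define d' where "d' = enn2real d"
  have d': "d = ennreal d'" using d(2) by (simp add: d'_def ennreal_enn2real_if less_top[symmetric]) auto
  have lt: "q r (\<lambda>x. \<phi> x - \<phi>0 x) < d'"
    using d(1) by (simp add: d' ennreal_less_iff q_nonneg)
  have sub: "{\<psi> \<in> F. \<forall>r'\<in>{r}. q r' (\<lambda>x. \<psi> x - \<phi> x) < d' - q r (\<lambda>x. \<phi> x - \<phi>0 x)} \<subseteq> s"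
  proof
    fix \<psi> assume "\<psi> \<in> {\<psi> \<in> F. \<forall>r'\<in>{r}. q r' (\<lambda>x. \<psi> x - \<phi> x) < d' - q r (\<lambda>x. \<phi> x - \<phi>0 x)}"
    then have \<psi>: "\<psi> \<in> F" "q r (\<lambda>x. \<psi> x - \<phi>0 x) < d'"
      using q_diff_triangle[OF _ \<phi> \<phi>0 r, of \<psi>] by auto
    then have "ennreal (q r (\<lambda>x. \<psi> x - \<phi>0 x)) < \<epsilon>"
      using d(2) unfolding d' by (meson ennreal_leI le_less_trans less_imp_le)
    then show "\<psi> \<in> s" unfolding s using \<psi>(1) by (simp add: ennreal_q[OF F_diff[OF _ \<phi>0] r])
  qed
  have "finite {r} \<and> {r} \<subseteq> {0<..} \<and> 0 < d' - q r (\<lambda>x. \<phi> x - \<phi>0 x)"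
    using r lt by simp
  then show ?case using sub by blast
qed auto

lemma C_space_subset: "C_space \<alpha> m \<subseteq> F"
  using closure_of_subset_topspace[of "seminorm_topology \<alpha> m" "poly_functions m"]
  by (simp add: C_space_def topspace_seminorm_topology)

text \<open>
  The closure in the generated topology, described by simultaneous approximation in finitely many
  seminorms.
\<close>

lemma mem_C_space_iff:
  "\<phi> \<in> C_space \<alpha> m \<longleftrightarrow> \<phi> \<in> F \<and>
     (\<forall>R e. finite R \<longrightarrow> R \<subseteq> {0<..} \<longrightarrow> e > 0 \<longrightarrow> (\<exists>p\<in>poly_functions m. p \<in> F \<and> (\<forall>r\<in>R. q r (\<lambda>x. p x - \<phi> x) < e)))"
  (is "_ \<longleftrightarrow> _ \<and> ?R")
proof (intro iffI conjI)
  assume \<phi>: "\<phi> \<in> C_space \<alpha> m"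
  then show \<phi>F: "\<phi> \<in> F" using C_space_subset by blast
  show ?R
  proof (intro allI impI)
    fix R :: "real set" and e :: real
    assume R: "finite R" "R \<subseteq> {0<..}" "e > 0"
    have "openin (seminorm_topology \<alpha> m) {\<psi> \<in> F. \<forall>r\<in>R. q r (\<lambda>x. \<psi> x - \<phi> x) < e}"
      using R
    proof (induction R rule: finite_induct)
      case empty
      then show ?case using openin_topspace[of "seminorm_topology \<alpha> m"] topspace_seminorm_topology by simp
    next
      case (insert r R)
      have "{\<psi> \<in> F. \<forall>r\<in>insert r R. q r (\<lambda>x. \<psi> x - \<phi> x) < e}
          = {\<psi> \<in> F. q r (\<lambda>x. \<psi> x - \<phi> x) < e} \<inter> {\<psi> \<in> F. \<forall>r\<in>R. q r (\<lambda>x. \<psi> x - \<phi> x) < e}"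
        by auto
      then show ?case using insert openin_q_ball[OF \<phi>F, of r e] by auto
    qed
    moreover have "\<phi> \<in> {\<psi> \<in> F. \<forall>r\<in>R. q r (\<lambda>x. \<psi> x - \<phi> x) < e}"
      using \<phi>F R by (auto simp: q_zero)
    ultimately have "\<exists>p. p \<in> poly_functions m \<and> p \<in> {\<psi> \<in> F. \<forall>r\<in>R. q r (\<lambda>x. \<psi> x - \<phi> x) < e}"
      using \<phi>[unfolded C_space_def in_closure_of, THEN conjunct2, rule_format] by (simp only: simp_thms)
    then obtain p where p: "p \<in> poly_functions m"
      "p \<in> {\<psi> \<in> F. \<forall>r\<in>R. q r (\<lambda>x. \<psi> x - \<phi> x) < e}"
      by (elim exE conjE)
    show "\<exists>p\<in>poly_functions m. p \<in> F \<and> (\<forall>r\<in>R. q r (\<lambda>x. p x - \<phi> x) < e)"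
      by (rule bexI[OF _ p(1)]) (use p(2) in simp)
  qed
next
  assume *: "\<phi> \<in> F \<and> ?R"
  show "\<phi> \<in> C_space \<alpha> m"
    unfolding C_space_def in_closure_of topspace_seminorm_topology
  proof (intro conjI allI impI)
    fix W assume W: "\<phi> \<in> W \<and> openin (seminorm_topology \<alpha> m) W"
    from seminorm_topology_nbhd[OF conjunct2[OF W] conjunct1[OF W]]
    obtain R e where R: "finite R" "R \<subseteq> {0<..}" "e > 0"
      and sub: "{\<psi> \<in> F. \<forall>r\<in>R. q r (\<lambda>x. \<psi> x - \<phi> x) < e} \<subseteq> W"
      by (elim exE conjE)
    from *[THEN conjunct2, rule_format, OF R]
    obtain p where p: "p \<in> poly_functions m" "p \<in> F \<and> (\<forall>r\<in>R. q r (\<lambda>x. p x - \<phi> x) < e)"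
      by (rule bexE)
    from p(2) have "p \<in> W" by (intro subsetD[OF sub]) simp
    with p(1) show "\<exists>y. y \<in> poly_functions m \<and> y \<in> W" by blast
  qed (rule *[THEN conjunct1])
qed

lemma C_space_approx:
  assumes "\<phi> \<in> C_space \<alpha> m" "finite R" "R \<subseteq> {0<..}" "e > 0"
  obtains p where "p \<in> poly_functions m" "p \<in> F" "\<And>r. r \<in> R \<Longrightarrow> q r (\<lambda>x. p x - \<phi> x) < e"
proof -
  from mem_C_space_iff[THEN iffD1, OF assms(1), THEN conjunct2, rule_format, OF assms(2-4)]
  obtain p where p: "p \<in> poly_functions m" "p \<in> F \<and> (\<forall>r\<in>R. q r (\<lambda>x. p x - \<phi> x) < e)"
    by (rule bexE)
  show ?thesis by (rule that[OF p(1)]) (use p(2) in simp_all)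
qed

lemma poly_functions_subset_F: "poly_functions m \<subseteq> F"
proof
  fix p assume "p \<in> poly_functions m"
  then obtain P where P: "P \<in> polys m" "p = restr (real_space m) (poly_eval m P)"
    unfolding poly_functions_def by blast
  have "\<alpha> r m (restr (cube r m) p) < \<infinity>" if "r > 0" for r
    unfolding P(2) restr_cube_restr_real_space by (rule finite_poly[OF that P(1)])
  then show "p \<in> F"
    using cfun_restr_poly_eval unfolding P(2) finite_space_def by blast
qed

lemma poly_functions_subset_C_space: "poly_functions m \<subseteq> C_space \<alpha> m"
  unfolding C_space_def
  by (rule closure_of_subset) (simp add: topspace_seminorm_topology poly_functions_subset_F)

lemma poly_functions_lincomb:
  assumes "p \<in> poly_functions m" "p' \<in> poly_functions m"
  shows "(\<lambda>x. c * p x + d * p' x) \<in> poly_functions m"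
proof -
  obtain P P' where P: "P \<in> polys m" "p = restr (real_space m) (poly_eval m P)"
    "P' \<in> polys m" "p' = restr (real_space m) (poly_eval m P')"
    using assms by (auto simp: poly_functions_def)
  obtain R where R: "R \<in> polys m" "\<And>x. poly_eval m R x = c * poly_eval m P x + d * poly_eval m P' x"
    using polys_eval_lincomb[OF P(1,3), of c d] by blast
  have "(\<lambda>x. c * p x + d * p' x) = restr (real_space m) (poly_eval m R)"
    unfolding P by (auto simp: restr_def R(2))
  then show ?thesis unfolding poly_functions_def using R(1) by blast
qed

lemma C_space_lincomb:
  assumes "\<phi> \<in> C_space \<alpha> m" "\<psi> \<in> C_space \<alpha> m"
  shows "(\<lambda>x. c * \<phi> x + d * \<psi> x) \<in> C_space \<alpha> m"
  unfolding mem_C_space_iff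
proof (intro conjI allI impI)
  have F: "\<phi> \<in> F" "\<psi> \<in> F" using assms C_space_subset by auto
  show "(\<lambda>x. c * \<phi> x + d * \<psi> x) \<in> F" using F by (rule F_lincomb)
  fix R :: "real set" and e :: real
  assume R: "finite R" "R \<subseteq> {0<..}" "e > 0"
  define K where "K = cmod c + cmod d + 1"
  have K: "K > 0" by (simp add: K_def add_nonneg_pos)
  have eK: "e / K > 0" using R(3) K by simp
  obtain p where p: "p \<in> poly_functions m" "p \<in> F" "\<And>r. r \<in> R \<Longrightarrow> q r (\<lambda>x. p x - \<phi> x) < e / K"
    using C_space_approx[OF assms(1) R(1,2) eK] by blast
  obtain p' where p': "p' \<in> poly_functions m" "p' \<in> F" "\<And>r. r \<in> R \<Longrightarrow> q r (\<lambda>x. p' x - \<psi> x) < e / K"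
    using C_space_approx[OF assms(2) R(1,2) eK] by blast
  show "\<exists>p\<in>poly_functions m. p \<in> F \<and> (\<forall>r\<in>R. q r (\<lambda>x. p x - (c * \<phi> x + d * \<psi> x)) < e)"
  proof (rule bexI[of _ "\<lambda>x. c * p x + d * p' x"], intro conjI ballI)
    fix r assume r: "r \<in> R"
    then have "r > 0" using R by auto
    have "q r (\<lambda>x. c * p x + d * p' x - (c * \<phi> x + d * \<psi> x))
        = q r (\<lambda>x. c * (p x - \<phi> x) + d * (p' x - \<psi> x))"
      by (simp add: algebra_simps)
    also have "\<dots> \<le> cmod c * q r (\<lambda>x. p x - \<phi> x) + cmod d * q r (\<lambda>x. p' x - \<psi> x)"
      by (intro q_lincomb_le F_diff F p p' \<open>r > 0\<close>)
    also have "\<dots> \<le> cmod c * (e / K) + cmod d * (e / K)"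
      by (intro add_mono mult_left_mono less_imp_le[OF p(3)] less_imp_le[OF p'(3)] r) auto
    also have "\<dots> < cmod c * (e / K) + cmod d * (e / K) + e / K" using eK by simp
    also have "\<dots> = K * (e / K)" unfolding K_def by (simp only: distrib_right mult_1_left)
    also have "\<dots> = e" using K by simp
    finally show "q r (\<lambda>x. c * p x + d * p' x - (c * \<phi> x + d * \<psi> x)) < e" .
  qed (use p p' in \<open>auto intro: F_lincomb poly_functions_lincomb\<close>)
qed

lemma C_topology_closure_poly: "C_topology \<alpha> m closure_of poly_functions m = C_space \<alpha> m"
proof -
  have "C_topology \<alpha> m closure_of poly_functions m
      = C_space \<alpha> m \<inter> (seminorm_topology \<alpha> m closure_of (C_space \<alpha> m \<inter> poly_functions m))"
    unfolding C_topology_def by (rule closure_of_subtopology)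
  also have "C_space \<alpha> m \<inter> poly_functions m = poly_functions m"
    using poly_functions_subset_C_space by blast
  finally show ?thesis by (simp flip: C_space_def)
qed

lemma topspace_C_topology: "topspace (C_topology \<alpha> m) = C_space \<alpha> m"
  unfolding C_topology_def by (simp add: topspace_seminorm_topology Int_absorb1 C_space_subset)

lemma unique_continuous_extension:
  fixes T0 :: "mpoly \<Rightarrow> 'a::unital_cstar_algebra"
  assumes lin: "\<And>P Q R c d. P \<in> polys m \<Longrightarrow> Q \<in> polys m \<Longrightarrow> R \<in> polys m \<Longrightarrow>
      (\<And>x. poly_eval m R x = c * poly_eval m P x + d * poly_eval m Q x) \<Longrightarrow>
      T0 R = scaleC c (T0 P) + scaleC d (T0 Q)"
    and bound: "\<And>P. P \<in> polys m \<Longrightarrow> norm (T0 P) \<le> B * q r (restr (real_space m) (poly_eval m P))"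
    and B: "B \<ge> 0" and r: "r > 0"
  shows "\<exists>!T. T \<in> extensional (C_space \<alpha> m) \<and> linear_on_C_space \<alpha> m T \<and>
     continuous_map (C_topology \<alpha> m) euclidean T \<and>
     (\<forall>P\<in>polys m. T (restr (real_space m) (poly_eval m P)) = T0 P)"
proof -
  let ?C = "C_space \<alpha> m"
  define \<iota> where "\<iota> P = restr (real_space m) (poly_eval m P)" for P
  define N where "N \<phi> \<psi> = q r (\<lambda>x. \<phi> x - \<psi> x)" for \<phi> \<psi>
  have \<iota>_poly: "\<iota> P \<in> poly_functions m" if "P \<in> polys m" for P
    using that by (auto simp: \<iota>_def poly_functions_def)
  have \<iota>F: "\<iota> P \<in> F" if "P \<in> polys m" for P
    using \<iota>_poly[OF that] poly_functions_subset_F by blast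
  obtain T where
    T_lim: "\<And>v p. v \<in> ?C \<Longrightarrow> (\<And>n. p n \<in> polys m) \<Longrightarrow> (\<lambda>n::nat. N (\<iota> (p n)) v) \<longlonglongrightarrow> 0 \<Longrightarrow> (\<lambda>n. T0 (p n)) \<longlonglongrightarrow> T v"
    and T_bound: "\<And>v w. v \<in> ?C \<Longrightarrow> w \<in> ?C \<Longrightarrow> norm (T v - T w) \<le> B * N v w"
    and seq: "\<And>v. v \<in> ?C \<Longrightarrow> \<exists>p. (\<forall>n::nat. p n \<in> polys m) \<and> (\<lambda>n. N (\<iota> (p n)) v) \<longlonglongrightarrow> 0"
  proof (rule extend_dense_lipschitz[of "polys m" T0 B N \<iota> F ?C])
    fix P Q assume PQ: "P \<in> polys m" "Q \<in> polys m"
    obtain R where R: "R \<in> polys m" "\<And>x. poly_eval m R x = 1 * poly_eval m P x + (-1) * poly_eval m Q x"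
      using polys_eval_lincomb[OF PQ, of 1 "-1"] by blast
    have "T0 R = T0 P - T0 Q"
      using lin[OF PQ R] by simp
    moreover have "\<iota> R = (\<lambda>x. \<iota> P x - \<iota> Q x)"
      by (auto simp: \<iota>_def restr_def R(2))
    ultimately show "norm (T0 P - T0 Q) \<le> B * N (\<iota> P) (\<iota> Q)"
      using bound[OF R(1)] by (simp add: N_def \<iota>_def)
  next
    fix v e assume "v \<in> ?C" "0 < (e::real)"
    then obtain p where "p \<in> poly_functions m" "q r (\<lambda>x. p x - v x) < e"
      using r by (elim C_space_approx[where R = "{r}" and e = e]) auto
    then show "\<exists>p\<in>polys m. N (\<iota> p) v < e"
      by (auto simp: poly_functions_def N_def \<iota>_def)
  qed (use B \<iota>F C_space_subset q_diff_commute q_diff_triangle q_nonneg r in \<open>auto simp: N_def\<close>)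
  have T_\<iota>: "T (\<iota> P) = T0 P" if P: "P \<in> polys m" for P
  proof -
    have "(\<lambda>n::nat. T0 P) \<longlonglongrightarrow> T (\<iota> P)"
    proof (rule T_lim)
      show "\<iota> P \<in> ?C" using \<iota>_poly[OF P] poly_functions_subset_C_space by blast
      show "(\<lambda>n::nat. N (\<iota> P) (\<iota> P)) \<longlonglongrightarrow> 0"
        unfolding N_def q_diff_self[OF r] by simp
    qed (rule P)
    then show ?thesis using LIMSEQ_unique tendsto_const by blast
  qed
  have T_lincomb: "T (\<lambda>x. c * \<phi> x + d * \<psi> x) = scaleC c (T \<phi>) + scaleC d (T \<psi>)"
    if C: "\<phi> \<in> ?C" "\<psi> \<in> ?C" for c d \<phi> \<psi>
  proof -
    have F: "\<phi> \<in> F" "\<psi> \<in> F" using C C_space_subset by auto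
    obtain p where p: "\<And>n. p n \<in> polys m" "(\<lambda>n::nat. N (\<iota> (p n)) \<phi>) \<longlonglongrightarrow> 0"
      using seq[OF C(1)] by blast
    obtain p' where p': "\<And>n. p' n \<in> polys m" "(\<lambda>n::nat. N (\<iota> (p' n)) \<psi>) \<longlonglongrightarrow> 0"
      using seq[OF C(2)] by blast
    have "\<forall>n. \<exists>R. R \<in> polys m \<and> (\<forall>x. poly_eval m R x = c * poly_eval m (p n) x + d * poly_eval m (p' n) x)"
      using polys_eval_lincomb[OF p(1) p'(1)] by blast
    from choice[OF this] obtain R where R: "\<And>n. R n \<in> polys m"
      "\<And>n x. poly_eval m (R n) x = c * poly_eval m (p n) x + d * poly_eval m (p' n) x"
      by blast
    have T0_R: "T0 (R n) = scaleC c (T0 (p n)) + scaleC d (T0 (p' n))" for n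
      by (rule lin) (use p p' R in auto)
    have N_R: "N (\<iota> (R n)) (\<lambda>x. c * \<phi> x + d * \<psi> x)
        \<le> cmod c * N (\<iota> (p n)) \<phi> + cmod d * N (\<iota> (p' n)) \<psi>" for n
    proof -
      have "(\<lambda>x. \<iota> (R n) x - (c * \<phi> x + d * \<psi> x))
          = (\<lambda>x. c * (\<iota> (p n) x - \<phi> x) + d * (\<iota> (p' n) x - \<psi> x))"
        by (auto simp: \<iota>_def restr_def R(2) algebra_simps)
      then show ?thesis unfolding N_def
        using q_lincomb_le[OF F_diff[OF \<iota>F[OF p(1)] F(1)] F_diff[OF \<iota>F[OF p'(1)] F(2)] r, of c n d n]
        by simp
    qed
    have "(\<lambda>n. N (\<iota> (R n)) (\<lambda>x. c * \<phi> x + d * \<psi> x)) \<longlonglongrightarrow> 0"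
    proof (rule tendsto_sandwich[OF _ _ tendsto_const])
      show "(\<lambda>n. cmod c * N (\<iota> (p n)) \<phi> + cmod d * N (\<iota> (p' n)) \<psi>) \<longlonglongrightarrow> 0"
        by (intro tendsto_add_zero tendsto_mult_right_zero p p')
    qed (use N_R q_nonneg in \<open>auto simp: N_def intro!: always_eventually\<close>)
    then have "(\<lambda>n. T0 (R n)) \<longlonglongrightarrow> T (\<lambda>x. c * \<phi> x + d * \<psi> x)"
      by (intro T_lim C_space_lincomb C R)
    moreover have "(\<lambda>n. T0 (R n)) \<longlonglongrightarrow> scaleC c (T \<phi>) + scaleC d (T \<psi>)"
      unfolding T0_R
      by (intro tendsto_add bounded_linear.tendsto[OF bounded_linear_scaleC_right] T_lim C p p')
    ultimately show ?thesis by (rule LIMSEQ_unique)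
  qed
  define T' where "T' = (\<lambda>\<phi>. if \<phi> \<in> ?C then T \<phi> else undefined)"
  have T': "T' \<phi> = T \<phi>" if "\<phi> \<in> ?C" for \<phi> using that by (simp add: T'_def)
  have cont: "continuous_map (C_topology \<alpha> m) euclidean T'"
    unfolding continuous_map_def topspace_C_topology
  proof (intro conjI allI impI)
    fix U :: "'a set" assume U: "openin euclidean U"
    show "openin (C_topology \<alpha> m) {\<phi> \<in> ?C. T' \<phi> \<in> U}"
    proof (subst openin_subopen, intro ballI)
      fix \<phi> assume \<phi>: "\<phi> \<in> {\<phi> \<in> ?C. T' \<phi> \<in> U}"
      then have \<phi>C: "\<phi> \<in> ?C" and "T \<phi> \<in> U" by (auto simp: T')
      then obtain e where e: "e > 0" "ball (T \<phi>) e \<subseteq> U"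
        using U by (auto simp: open_contains_ball)
      define d where "d = e / (B + 1)"
      have d: "d > 0" using e B by (simp add: d_def)
      let ?W = "{\<psi> \<in> F. q r (\<lambda>x. \<psi> x - \<phi> x) < d} \<inter> ?C"
      have \<phi>F: "\<phi> \<in> F" using \<phi>C C_space_subset by blast
      have "openin (C_topology \<alpha> m) ?W"
        unfolding C_topology_def openin_subtopology
        using openin_q_ball[OF \<phi>F r d] by blast
      moreover have "\<phi> \<in> ?W" using \<phi>F \<phi>C d by (simp add: q_zero r)
      moreover have "?W \<subseteq> {\<phi> \<in> ?C. T' \<phi> \<in> U}"
      proof
        fix \<psi> assume \<psi>: "\<psi> \<in> ?W"
        have "norm (T \<psi> - T \<phi>) \<le> B * N \<psi> \<phi>" using \<psi> \<phi>C by (intro T_bound) auto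
        also have "\<dots> \<le> B * d" using \<psi> B by (intro mult_left_mono) (auto simp: N_def)
        also have "\<dots> < (B + 1) * d" using d by simp
        also have "\<dots> = e" using B by (simp add: d_def)
        finally have "T \<psi> \<in> ball (T \<phi>) e" by (simp add: dist_norm norm_minus_commute)
        then show "\<psi> \<in> {\<phi> \<in> ?C. T' \<phi> \<in> U}" using e \<psi> by (auto simp: T')
      qed
      ultimately show "\<exists>W. openin (C_topology \<alpha> m) W \<and> \<phi> \<in> W \<and> W \<subseteq> {\<phi> \<in> ?C. T' \<phi> \<in> U}"
        by blast
    qed
  qed auto
  show ?thesis
  proof (rule ex1I[of _ T'], intro conjI ballI)
    show "T' \<in> extensional ?C" by (simp add: T'_def extensional_def)
    show "linear_on_C_space \<alpha> m T'"
      unfolding linear_on_C_space_def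
    proof (intro conjI ballI allI)
      fix \<phi> \<psi> assume C: "\<phi> \<in> ?C" "\<psi> \<in> ?C"
      show "T' (\<lambda>x. \<phi> x + \<psi> x) = T' \<phi> + T' \<psi>"
        using T_lincomb[OF C, of 1 1] C_space_lincomb[OF C, of 1 1] by (simp add: T' C)
    next
      fix c \<phi> assume C: "\<phi> \<in> ?C"
      show "T' (\<lambda>x. c * \<phi> x) = scaleC c (T' \<phi>)"
        using T_lincomb[OF C C, of c 0] C_space_lincomb[OF C C, of c 0] by (simp add: T' C)
    qed
    show "continuous_map (C_topology \<alpha> m) euclidean T'" by (rule cont)
    show "T' (restr (real_space m) (poly_eval m P)) = T0 P" if P: "P \<in> polys m" for P
      using T_\<iota>[OF P] \<iota>_poly[OF P] poly_functions_subset_C_space T' by (auto simp: \<iota>_def)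
  next
    fix S assume S: "S \<in> extensional ?C \<and> linear_on_C_space \<alpha> m S \<and>
      continuous_map (C_topology \<alpha> m) euclidean S \<and>
      (\<forall>P\<in>polys m. S (restr (real_space m) (poly_eval m P)) = T0 P)"
    show "S = T'"
    proof (rule extensionalityI[of _ ?C])
      fix \<phi> assume "\<phi> \<in> ?C"
      then have cl: "\<phi> \<in> C_topology \<alpha> m closure_of poly_functions m"
        by (simp add: C_topology_closure_poly)
      show "S \<phi> = T' \<phi>"
      proof (rule forall_in_closure_of_eq[OF cl _ _ cont])
        fix p assume "p \<in> poly_functions m"
        then obtain P where P: "P \<in> polys m" "p = \<iota> P" by (auto simp: poly_functions_def \<iota>_def)
        then have "p \<in> ?C" using \<iota>_poly poly_functions_subset_C_space by blast
        then show "S p = T' p" using S P T_\<iota> T' by (simp add: \<iota>_def)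
      qed (use S in auto)
    qed (use S in \<open>auto simp: T'_def extensional_def\<close>)
  qed
qed

end

text \<open>
  Admissibility for one radius \<open>r\<close> exceeding all \<open>\<parallel>a i\<parallel>\<close> says that the polynomial calculus is bounded
  by a multiple of \<open>q r\<close>. In particular \<open>poly_tensor\<close> vanishes on polynomials that vanish on the
  cube, so it depends on the polynomial function only and is linear in it.
\<close>

theorem LFC_defined_if_admissible:
  fixes A :: "'a::unital_cstar_algebra itself"
  assumes adm: "LFC_admissible A \<alpha>"
  shows "LFC_defined A \<alpha>"
  unfolding LFC_defined_def
proof (intro allI impI)
  fix m :: nat assume m: "m \<ge> 2"
  then have m1: "m \<ge> 1" by simp
  interpret norms_on_cubes \<alpha> m
    by unfold_locales (use adm m1 in \<open>auto simp: LFC_admissible_def\<close>)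
  show "poly_functions m \<subseteq> C_space \<alpha> m \<and>
       (\<forall>a b :: nat \<Rightarrow> 'a. (\<forall>i\<in>{1..m}. adj (a i) = a i) \<longrightarrow>
         (\<exists>!T. T \<in> extensional (C_space \<alpha> m) \<and>
               linear_on_C_space \<alpha> m T \<and>
               continuous_map (C_topology \<alpha> m) euclidean T \<and>
               (\<forall>P\<in>polys m. T (restr (real_space m) (poly_eval m P)) = poly_tensor m P a b)))"
  proof (intro conjI allI impI)
    show "poly_functions m \<subseteq> C_space \<alpha> m" by (rule poly_functions_subset_C_space)
    fix a b :: "nat \<Rightarrow> 'a" assume sa: "\<forall>i\<in>{1..m}. adj (a i) = a i"
    define r where "r = 1 + (\<Sum>i\<in>{1..m}. norm (a i))"
    have r: "r > 0" unfolding r_def by (intro add_pos_nonneg sum_nonneg) auto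
    have ar: "norm (a i) \<le> r" if "i \<in> {1..m}" for i
      using member_le_sum[of i "{1..m}" "\<lambda>i. norm (a i)"] that unfolding r_def by simp
    define B where "B = (\<Prod>i\<in>{1..m-1}. norm (b i))"
    have B: "B \<ge> 0" unfolding B_def by (intro prod_nonneg) auto
    have bound: "norm (poly_tensor m P a b) \<le> B * q r (restr (real_space m) (poly_eval m P))"
      if P: "P \<in> polys m" for P
    proof -
      have PF: "restr (real_space m) (poly_eval m P) \<in> finite_space \<alpha> m"
        using P poly_functions_subset_F by (auto simp: poly_functions_def)
      have "ennreal (norm (poly_tensor m P a b))
          \<le> (SUP a\<in>{a :: nat \<Rightarrow> 'a. \<forall>i\<in>{1..m}. adj (a i) = a i \<and> norm (a i) \<le> r}.
               ennreal (norm (poly_tensor m P a b)))"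
        by (rule SUP_upper) (use sa ar in auto)
      also have "\<dots> \<le> \<alpha> r m (restr (cube r m) (poly_eval m P)) * ennreal B"
        using adm m P r unfolding LFC_admissible_def B_def by blast
      also have "\<dots> = ennreal (q r (restr (real_space m) (poly_eval m P))) * ennreal B"
        using ennreal_q[OF PF r] by (simp add: restr_cube_restr_real_space)
      also have "\<dots> = ennreal (B * q r (restr (real_space m) (poly_eval m P)))"
        using B q_nonneg by (simp add: ennreal_mult mult.commute)
      finally show ?thesis using B q_nonneg by simp
    qed
    show "\<exists>!T. T \<in> extensional (C_space \<alpha> m) \<and>
               linear_on_C_space \<alpha> m T \<and>
               continuous_map (C_topology \<alpha> m) euclidean T \<and>
               (\<forall>P\<in>polys m. T (restr (real_space m) (poly_eval m P)) = poly_tensor m P a b)"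
    proof (rule unique_continuous_extension[OF _ bound B r])
      fix P Q R :: mpoly and c d
      assume P: "P \<in> polys m" "Q \<in> polys m" "R \<in> polys m"
        and eq: "\<And>x. poly_eval m R x = c * poly_eval m P x + d * poly_eval m Q x"
      obtain S where S: "S \<in> polys m" "\<And>x. poly_eval m S x = c * poly_eval m P x + d * poly_eval m Q x"
        "poly_tensor m S a b = scaleC c (poly_tensor m P a b) + scaleC d (poly_tensor m Q a b)"
        using polys_lincomb[OF P(1,2), where c = c and d = d and ?'a = 'a] by metis
      \<comment> \<open>The polynomial \<open>D = R - S\<close> vanishes identically, so the bound kills its value.\<close>
      obtain D where D: "D \<in> polys m" "\<And>x. poly_eval m D x = 1 * poly_eval m R x + (-1) * poly_eval m S x"
        "poly_tensor m D a b = scaleC 1 (poly_tensor m R a b) + scaleC (-1) (poly_tensor m S a b)"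
        using polys_lincomb[OF P(3) S(1), where c = 1 and d = "-1" and ?'a = 'a] by metis
      have PF: "restr (real_space m) (poly_eval m P) \<in> finite_space \<alpha> m"
        using P poly_functions_subset_F by (auto simp: poly_functions_def)
      have "restr (real_space m) (poly_eval m D)
          = (\<lambda>x. restr (real_space m) (poly_eval m P) x - restr (real_space m) (poly_eval m P) x)"
        by (auto simp: restr_def D(2) S(2) eq)
      then have "poly_tensor m D a b = 0"
        using bound[OF D(1)] q_diff_self[OF r] by simp
      then have "poly_tensor m R a b = poly_tensor m S a b"
        using D(3) by simp
      then show "poly_tensor m R a b = scaleC c (poly_tensor m P a b) + scaleC d (poly_tensor m Q a b)"
        by (simp add: S(3))
    qed
  qed
qed

section \<open>Uniform norms\<close>

lemma sup_norm_le_iff: "sup_norm X \<phi> \<le> ennreal M \<longleftrightarrow> (\<forall>x\<in>X. ennreal (cmod (\<phi> x)) \<le> ennreal M)"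
  by (simp add: sup_norm_def SUP_le_iff)

lemma sup_norm_scale:
  "sup_norm X (\<lambda>x. c * \<phi> x) = ennreal (cmod c) * sup_norm X \<phi>"
  unfolding sup_norm_def by (simp add: norm_mult ennreal_mult SUP_mult_left_ennreal)

lemma possibly_infinite_norm_sup_norm: "possibly_infinite_norm (cfun X) (sup_norm X)"
  unfolding possibly_infinite_norm_def
proof (intro conjI allI ballI)
  fix c \<phi> assume "\<phi> \<in> cfun X"
  show "sup_norm X (\<lambda>x. c * \<phi> x) = ennreal (cmod c) * sup_norm X \<phi>"
    by (rule sup_norm_scale)
next
  fix \<phi> \<psi> assume "\<phi> \<in> cfun X" "\<psi> \<in> cfun X"
  show "sup_norm X (\<lambda>x. \<phi> x + \<psi> x) \<le> sup_norm X \<phi> + sup_norm X \<psi>"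
    unfolding sup_norm_def
  proof (rule SUP_least)
    fix x assume x: "x \<in> X"
    have "ennreal (cmod (\<phi> x + \<psi> x)) \<le> ennreal (cmod (\<phi> x) + cmod (\<psi> x))"
      by (intro ennreal_leI norm_triangle_ineq)
    also have "\<dots> = ennreal (cmod (\<phi> x)) + ennreal (cmod (\<psi> x))"
      by (simp add: ennreal_plus)
    also have "\<dots> \<le> (SUP x\<in>X. ennreal (cmod (\<phi> x))) + (SUP x\<in>X. ennreal (cmod (\<psi> x)))"
      using x by (intro add_mono SUP_upper)
    finally show "ennreal (cmod (\<phi> x + \<psi> x)) \<le> \<dots>" .
  qed
next
  fix \<phi> assume "\<phi> \<in> cfun X"
  then show "sup_norm X \<phi> = 0 \<longleftrightarrow> \<phi> = (\<lambda>_. 0)"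
    using sup_norm_le_iff[of X \<phi> 0] by (auto simp: cfun_def fun_eq_iff) 
qed

lemma cmod_poly_eval_le:
  assumes "x \<in> cube r m"
  shows "cmod (poly_eval m P x) \<le> (\<Sum>\<delta>\<in>Poly_Mapping.keys P. cmod (Poly_Mapping.lookup P \<delta>) *
        (\<Prod>i\<in>{1..m}. r ^ Poly_Mapping.lookup \<delta> i))"
  unfolding poly_eval_def
proof (intro sum_norm_le)
  fix \<delta>
  have "\<bar>x i\<bar> \<le> r" if "i \<in> {1..m}" for i
  proof -
    have "x i \<in> {-r..r}" using assms that unfolding cube_def by (rule PiE_mem)
    then show ?thesis by (simp add: abs_le_iff)
  qed
  then have "(\<Prod>i\<in>{1..m}. \<bar>x i\<bar> ^ Poly_Mapping.lookup \<delta> i) \<le> (\<Prod>i\<in>{1..m}. r ^ Poly_Mapping.lookup \<delta> i)"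
    by (intro prod_mono conjI power_mono) auto
  then show "cmod (Poly_Mapping.lookup P \<delta> * (\<Prod>i\<in>{1..m}. complex_of_real (x i) ^ Poly_Mapping.lookup \<delta> i))
    \<le> cmod (Poly_Mapping.lookup P \<delta>) * (\<Prod>i\<in>{1..m}. r ^ Poly_Mapping.lookup \<delta> i)"
    by (simp add: norm_mult prod_norm[symmetric] norm_power mult_left_mono)
qed

lemma sup_norm_poly_finite: "sup_norm (cube r m) (restr (cube r m) (poly_eval m P)) < top"
proof -
  have "sup_norm (cube r m) (restr (cube r m) (poly_eval m P))
      \<le> ennreal (\<Sum>\<delta>\<in>Poly_Mapping.keys P. cmod (Poly_Mapping.lookup P \<delta>) *
        (\<Prod>i\<in>{1..m}. r ^ Poly_Mapping.lookup \<delta> i))"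
    unfolding sup_norm_le_iff using cmod_poly_eval_le by (auto simp: restr_def intro!: ennreal_leI)
  then show ?thesis by (rule le_less_trans) simp
qed

lemma prod_norm_last_one:
  fixes b :: "nat \<Rightarrow> 'a::real_normed_algebra_1"
  assumes "m \<ge> 1"
  shows "(\<Prod>i\<in>{1..m}. norm ((b(m := 1)) i)) = (\<Prod>i\<in>{1..m-1}. norm (b i))"
proof -
  obtain n where m: "m = Suc n" using assms by (cases m) auto
  have "(\<Prod>i\<in>{1..n}. norm ((b(m := 1)) i)) = (\<Prod>i\<in>{1..n}. norm (b i))"
    by (rule prod.cong) (auto simp: m)
  then show ?thesis by (simp add: m)
qed

text \<open>
  For multiples of the uniform norm, admissibility is a statement about finite bounds \<open>M\<close> of \<open>\<bar>P\<bar>\<close> on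
  the cube. Positivity of the constant makes the multiple definite.
\<close>

lemma LFC_admissible_scaled_uniform:
  fixes A :: "'a::unital_cstar_algebra itself"
  assumes K: "\<And>m. m \<ge> 1 \<Longrightarrow> K m > 0"
    and bound: "\<And>m P r M a b :: nat \<Rightarrow> 'a. m \<ge> 2 \<Longrightarrow> P \<in> polys m \<Longrightarrow> r > 0 \<Longrightarrow>
      (\<And>x. x \<in> cube r m \<Longrightarrow> cmod (poly_eval m P x) \<le> M) \<Longrightarrow>
      (\<And>i. i \<in> {1..m} \<Longrightarrow> adj (a i) = a i \<and> norm (a i) \<le> r) \<Longrightarrow>
      norm (poly_tensor m P a b) \<le> K m * M * (\<Prod>i\<in>{1..m-1}. norm (b i))"
  shows "LFC_admissible A (\<lambda>r m \<phi>. ennreal (K m) * uniform_family r m \<phi>)"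
  unfolding LFC_admissible_def
proof (intro conjI allI impI ballI)
  fix r :: real and m :: nat assume "r > 0" "m \<ge> 1"
  have "possibly_infinite_norm (cfun (cube r m)) (sup_norm (cube r m))"
    by (rule possibly_infinite_norm_sup_norm)
  then show "possibly_infinite_norm (cfun (cube r m)) (\<lambda>\<phi>. ennreal (K m) * uniform_family r m \<phi>)"
    using K[OF \<open>m \<ge> 1\<close>]
    by (auto simp: possibly_infinite_norm_def uniform_family_def mult.left_commute
        simp flip: distrib_left intro!: mult_left_mono)
next
  fix r :: real and m P assume "r > 0" "m \<ge> 1" "P \<in> polys m"
  show "ennreal (K m) * uniform_family r m (restr (cube r m) (poly_eval m P)) < \<infinity>"
    using sup_norm_poly_finite[of r m P] by (simp add: uniform_family_def ennreal_mult_less_top)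
next
  fix m P and b :: "nat \<Rightarrow> 'a" and r :: real
  assume m: "m \<ge> 2" and P: "P \<in> polys m" and r: "r > 0"
  let ?u = "sup_norm (cube r m) (restr (cube r m) (poly_eval m P))"
  have "?u < top" by (rule sup_norm_poly_finite)
  then obtain M where M: "?u = ennreal M" "M \<ge> 0" by (cases ?u) auto
  have le: "cmod (poly_eval m P x) \<le> M" if "x \<in> cube r m" for x
    using sup_norm_le_iff[of "cube r m" "restr (cube r m) (poly_eval m P)" M] M that
    by (auto simp: restr_def)
  let ?B = "\<Prod>i\<in>{1..m-1}. norm (b i)"
  have B: "?B \<ge> 0" by (intro prod_nonneg) auto
  show "(SUP a\<in>{a :: nat \<Rightarrow> 'a. \<forall>i\<in>{1..m}. adj (a i) = a i \<and> norm (a i) \<le> r}.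
           ennreal (norm (poly_tensor m P a b)))
      \<le> ennreal (K m) * uniform_family r m (restr (cube r m) (poly_eval m P)) * ennreal ?B"
  proof (rule SUP_least)
    fix a :: "nat \<Rightarrow> 'a" assume "a \<in> {a. \<forall>i\<in>{1..m}. adj (a i) = a i \<and> norm (a i) \<le> r}"
    then have "norm (poly_tensor m P a b) \<le> K m * M * ?B"
      by (intro bound[OF m P r le]) auto
    then have "ennreal (norm (poly_tensor m P a b)) \<le> ennreal (K m * M * ?B)"
      by (rule ennreal_leI)
    also have "\<dots> = ennreal (K m) * ennreal M * ennreal ?B"
      using K[of m] m M(2) B by (simp add: ennreal_mult)
    finally show "ennreal (norm (poly_tensor m P a b))
        \<le> ennreal (K m) * uniform_family r m (restr (cube r m) (poly_eval m P)) * ennreal ?B"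
      by (simp add: uniform_family_def M)
  qed
qed

section \<open>Commutative algebras\<close>

lemma alternating_prod_commutative_factor:
  fixes y b :: "nat \<Rightarrow> 'a::monoid_mult"
  assumes comm: "\<And>x y :: 'a. x * y = y * x" and "j \<in> {1..n}"
  shows "alternating_prod n (y(j := z)) b = alternating_prod n (y(j := 1)) b * z"
  using assms(2)
proof (induction n)
  case (Suc n)
  show ?case
  proof (cases "j = Suc n")
    case True
    have "alternating_prod n (y(j := z)) b = alternating_prod n (y(j := 1)) b"
      by (rule alternating_prod_cong) (use True in auto)
    then show ?thesis using True by (simp add: mult.assoc del: fun_upd_apply) (simp, subst comm[of z "b (Suc n)"], rule refl)
  next
    case False
    then have "j \<in> {1..n}" using Suc.prems by auto
    then have IH: "alternating_prod n (y(j := z)) b = alternating_prod n (y(j := 1)) b * z"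
      by (rule Suc.IH)
    show ?thesis using False comm[of z "y (Suc n) * b (Suc n)"]
      by (simp add: IH mult.assoc del: fun_upd_apply) (simp add: mult.assoc)
  qed
qed simp

lemma alternating_prod_commutative_split:
  fixes y b :: "nat \<Rightarrow> 'a::monoid_mult"
  assumes comm: "\<And>x y :: 'a. x * y = y * x"
  shows "alternating_prod n y b = alternating_prod n y (\<lambda>_. 1) * alternating_prod n (\<lambda>_. 1) b"
proof (induction n)
  case (Suc n)
  let ?B = "alternating_prod n (\<lambda>_. 1) b"
  have "?B * (y (Suc n) * b (Suc n)) = y (Suc n) * (?B * b (Suc n))"
    by (simp only: mult.assoc[symmetric] comm[of ?B "y (Suc n)"])
  then show ?case by (simp add: Suc mult.assoc)
qed simp

lemma alternating_prod_one: "alternating_prod n (\<lambda>_. 1) (\<lambda>_. 1) = 1"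
  by (induction n) auto

text \<open>
  In the commutative case the \<open>b i\<close> factor out, and what remains is \<open>\<parallel>P(a)\<parallel> \<le> M\<close>. The self-adjoint
  elements are traded for scalars one at a time: \<open>?y k t\<close> has \<open>a i\<close> in the slots \<open>i \<le> k\<close> and the scalar
  \<open>t i\<close> in the others. Passing from \<open>k\<close> to \<open>k + 1\<close> is the von Neumann inequality in the variable
  \<open>k + 1\<close>, whose coefficients are elements of the algebra.
\<close>

lemma norm_poly_tensor_commutative_le:
  fixes a b :: "nat \<Rightarrow> 'a::unital_cstar_algebra"
  assumes comm: "\<And>x y :: 'a. x * y = y * x" and m: "m \<ge> 1"
    and le: "\<And>x. x \<in> cube r m \<Longrightarrow> cmod (poly_eval m P x) \<le> M"
    and a: "\<And>i. i \<in> {1..m} \<Longrightarrow> adj (a i) = a i \<and> norm (a i) \<le> r"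
  shows "norm (poly_tensor m P a b) \<le> M * (\<Prod>i\<in>{1..m-1}. norm (b i))"
proof -
  let ?L = Poly_Mapping.lookup
  let ?y = "\<lambda>k t \<delta> i. if i \<le> k then a i ^ ?L \<delta> i else (of_real (t i) :: 'a) ^ ?L \<delta> i"
  define \<Phi> where "\<Phi> y = (\<Sum>\<delta>\<in>Poly_Mapping.keys P. scaleC (?L P \<delta>) (alternating_prod m (y \<delta>) (\<lambda>_. 1)))"
    for y :: "(nat \<Rightarrow>\<^sub>0 nat) \<Rightarrow> nat \<Rightarrow> 'a"
  have step: "norm (\<Phi> (?y k t)) \<le> M" if "k \<le> m" "\<And>i. i \<in> {1..m} \<Longrightarrow> \<bar>t i\<bar> \<le> r" for k t
    using that
  proof (induction k arbitrary: t)
    case 0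
    define t' where "t' = restrict t {1..m}"
    have "\<Phi> (?y 0 t) = scaleC (poly_eval m P t') 1"
    proof -
      have "alternating_prod m (?y 0 t \<delta>) (\<lambda>_. 1)
          = scaleC (\<Prod>i\<in>{1..m}. complex_of_real (t' i) ^ ?L \<delta> i) 1" for \<delta>
      proof -
        have "alternating_prod m (?y 0 t \<delta>) (\<lambda>_. 1)
            = alternating_prod m (\<lambda>i. scaleC (complex_of_real (t' i) ^ ?L \<delta> i) 1) (\<lambda>_. 1)"
          by (rule alternating_prod_cong) (auto simp: t'_def of_real_power_eq_scaleC[where ?'a = 'a])
        then show ?thesis by (simp add: alternating_prod_scaleC alternating_prod_one)
      qed
      then show ?thesis
        by (simp add: \<Phi>_def poly_eval_def complex_vector.scale_sum_left scaleC_scaleC)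
    qed
    moreover have "t' \<in> cube r m"
      using 0 by (auto simp: t'_def cube_def abs_le_iff) (metis atLeastAtMost_iff minus_le_iff)
    ultimately show ?case using le by (simp add: norm_scaleC)
  next
    case (Suc k)
    let ?k = "Suc k"
    define C where "C \<delta> = scaleC (?L P \<delta>) (alternating_prod m ((?y k t \<delta>)(?k := 1)) (\<lambda>_. 1))" for \<delta>
    define N where "N = (\<Sum>\<delta>\<in>Poly_Mapping.keys P. ?L \<delta> ?k)"
    define c where "c j = (\<Sum>\<delta> | \<delta> \<in> Poly_Mapping.keys P \<and> ?L \<delta> ?k = j. C \<delta>)" for j
    have collect: "\<Phi> (\<lambda>\<delta>. (?y k t \<delta>)(?k := x ^ ?L \<delta> ?k)) = (\<Sum>j\<le>N. c j * x ^ j)" for x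
    proof -
      have "alternating_prod m ((?y k t \<delta>)(?k := x ^ ?L \<delta> ?k)) (\<lambda>_. 1)
          = alternating_prod m ((?y k t \<delta>)(?k := 1)) (\<lambda>_. 1) * x ^ ?L \<delta> ?k" for \<delta>
        by (rule alternating_prod_commutative_factor[OF comm]) (use Suc.prems in auto)
      then have "\<Phi> (\<lambda>\<delta>. (?y k t \<delta>)(?k := x ^ ?L \<delta> ?k)) = (\<Sum>\<delta>\<in>Poly_Mapping.keys P. C \<delta> * x ^ ?L \<delta> ?k)"
        by (simp add: \<Phi>_def C_def mult_scaleC_left)
      also have "\<dots> = (\<Sum>j\<le>N. c j * x ^ j)"
        unfolding c_def by (rule sum_collect_powers) (auto simp: N_def intro: member_le_sum)
      finally show ?thesis .
    qed
    have "norm (\<Sum>j\<le>N. c j * a ?k ^ j) \<le> M"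
    proof (rule von_neumann_inequality)
      show "adj (a ?k) = a ?k" "norm (a ?k) \<le> r" using a[of ?k] Suc.prems by auto
      fix s :: real assume s: "\<bar>s\<bar> \<le> r"
      have "(\<Sum>j\<le>N. c j * of_real s ^ j) = \<Phi> (?y k (t(?k := s)))"
        unfolding collect[symmetric] \<Phi>_def
        by (intro sum.cong refl arg_cong2[where f = scaleC] alternating_prod_cong) auto
      then show "norm (\<Sum>j\<le>N. c j * of_real s ^ j) \<le> M"
        using Suc.IH[of "t(?k := s)"] Suc.prems s by auto
    qed (rule comm)+
    moreover have "\<Phi> (?y ?k t) = \<Phi> (\<lambda>\<delta>. (?y k t \<delta>)(?k := a ?k ^ ?L \<delta> ?k))"
      unfolding \<Phi>_def
      by (intro sum.cong refl arg_cong2[where f = scaleC] alternating_prod_cong) auto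
    ultimately show ?case by (simp only: collect)
  qed
  have M: "norm (\<Phi> (\<lambda>\<delta> i. a i ^ ?L \<delta> i)) \<le> M"
  proof -
    have "norm (a 1) \<le> r" using a[of 1] m by simp
    then have "r \<ge> 0" by (rule order_trans[OF norm_ge_zero])
    then have "norm (\<Phi> (?y m (\<lambda>_. 0))) \<le> M" by (intro step) auto
    also have "\<Phi> (?y m (\<lambda>_. 0)) = \<Phi> (\<lambda>\<delta> i. a i ^ ?L \<delta> i)"
      unfolding \<Phi>_def
      by (intro sum.cong refl arg_cong2[where f = scaleC] alternating_prod_cong) auto
    finally show ?thesis .
  qed
  have "poly_tensor m P a b = \<Phi> (\<lambda>\<delta> i. a i ^ ?L \<delta> i) * alternating_prod m (\<lambda>_. 1) (b(m := 1))"
    unfolding poly_tensor_eq_alternating_prod[OF m] \<Phi>_def sum_distrib_right mult_scaleC_left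
    by (intro sum.cong refl arg_cong2[where f = scaleC] alternating_prod_commutative_split comm)
  also have "norm \<dots> \<le> norm (\<Phi> (\<lambda>\<delta> i. a i ^ ?L \<delta> i)) * norm (alternating_prod m (\<lambda>_. 1) (b(m := 1)))"
    by (rule norm_mult_ineq)
  also have "\<dots> \<le> M * (\<Prod>i\<in>{1..m-1}. norm (b i))"
  proof (intro mult_mono M)
    show "norm (alternating_prod m (\<lambda>_. 1) (b(m := 1))) \<le> (\<Prod>i\<in>{1..m-1}. norm (b i))"
      using norm_alternating_prod_le[of m "\<lambda>_. 1" "b(m := 1)"] prod_norm_last_one[OF m, of b] by simp
  qed (use order_trans[OF norm_ge_zero M] in auto)
  finally show ?thesis .
qed

theorem LFC_admissible_uniform:
  fixes A :: "'a::unital_cstar_algebra itself"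
  assumes "commutative_algebra A"
  shows "LFC_admissible A uniform_family"
proof -
  have comm: "x * y = y * x" for x y :: 'a using assms by (auto simp: commutative_algebra_def)
  have "LFC_admissible A (\<lambda>r m \<phi>. ennreal 1 * uniform_family r m \<phi>)"
  proof (rule LFC_admissible_scaled_uniform)
    fix m P r M and a b :: "nat \<Rightarrow> 'a"
    assume "2 \<le> m" "\<And>x. x \<in> cube r m \<Longrightarrow> cmod (poly_eval m P x) \<le> M"
      "\<And>i. i \<in> {1..m} \<Longrightarrow> adj (a i) = a i \<and> norm (a i) \<le> r"
    then show "norm (poly_tensor m P a b) \<le> 1 * M * (\<Prod>i\<in>{1..m-1}. norm (b i))"
      using norm_poly_tensor_commutative_le[OF comm, of m r P M a b] by simp
  qed simp
  then show ?thesis by simp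
qed

section \<open>Finite-dimensional algebras\<close>

lemma prod_linear_factors_dvd:
  fixes p :: "'a::idom poly"
  assumes "finite Z" "\<And>z. z \<in> Z \<Longrightarrow> poly p z = 0"
  shows "(\<Prod>z\<in>Z. [:- z, 1:]) dvd p"
  using assms
proof (induction Z rule: finite_induct)
  case (insert z Z)
  then obtain g where g: "p = (\<Prod>z\<in>Z. [:- z, 1:]) * g" by (auto simp: dvd_def)
  have "poly (\<Prod>z\<in>Z. [:- z, 1:]) z \<noteq> 0"
    using insert.hyps by (auto simp: poly_prod)
  then have "poly g z = 0" using insert.prems[of z] by (auto simp: g)
  then have "[:- z, 1:] dvd g" by (simp only: poly_eq_0_iff_dvd)
  then obtain h where h: "g = [:- z, 1:] * h" by (rule dvdE)
  have "p = (\<Prod>z\<in>insert z Z. [:- z, 1:]) * h"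
    by (simp only: g h prod.insert[OF insert.hyps] mult_ac)
  then show ?case by (simp add: dvd_def)
qed simp

text \<open>
  The powers \<open>a ^ 0, \<dots>, a ^ d\<close> with \<open>d\<close> the dimension are too many to be independent. If two of them
  coincide, they form a smaller set, but then their difference is the relation.
\<close>

lemma annihilating_poly_exists:
  fixes a :: "'a::unital_cstar_algebra"
  assumes "finite_dimensional TYPE('a)"
  obtains q where "q \<noteq> 0" "degree q \<le> algebra_dim TYPE('a)" "peval a q = 0"
proof -
  obtain B :: "'a set" where B: "finite B" "complex_vector.span B = UNIV"
    using assms by (auto simp: finite_dimensional_def)
  define d where "d = algebra_dim TYPE('a)"
  have card_le: "finite S \<and> card S \<le> d" if S: "complex_vector.independent S" for S :: "'a set"
  proof -
    obtain B' :: "'a set" where B': "B' \<subseteq> UNIV" "complex_vector.independent B'" "UNIV \<subseteq> complex_vector.span B'"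
      "card B' = complex_vector.dim (UNIV :: 'a set)"
      by (rule complex_vector.basis_exists[of "UNIV :: 'a set"])
    have "finite B'" using complex_vector.independent_span_bound[OF B(1) B'(2)] B(2) by simp
    moreover have "S \<subseteq> complex_vector.span B'" using B'(3) by blast
    ultimately show ?thesis
      using complex_vector.independent_span_bound[of B' S] S by (simp add: d_def algebra_dim_def B'(4))
  qed
  show ?thesis
  proof (cases "inj_on (\<lambda>k. a ^ k) {..d}")
    case True
    let ?S = "(\<lambda>k. a ^ k) ` {..d}"
    have "card ?S = Suc d" by (simp add: card_image[OF True])
    then have "complex_vector.dependent ?S" using card_le[of ?S] by auto
    then obtain u where u: "\<exists>v\<in>?S. u v \<noteq> 0" "(\<Sum>v\<in>?S. scaleC (u v) v) = 0"
      by (auto simp: complex_vector.dependent_finite)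
    define q where "q = (\<Sum>k\<le>d. monom (u (a ^ k)) k)"
    have coeff_q: "coeff q k = (if k \<le> d then u (a ^ k) else 0)" for k
      by (simp add: q_def coeff_sum)
    show ?thesis
    proof (rule that[of q])
      show "q \<noteq> 0" using u(1) coeff_q by (metis (no_types, lifting) atMost_iff coeff_0 imageE)
      show "degree q \<le> algebra_dim TYPE('a)"
        unfolding d_def[symmetric] by (rule degree_le) (simp add: coeff_q)
      show "peval a q = 0"
        using u(2) by (simp add: q_def peval_sum sum.reindex[OF True])
    qed
  next
    case False
    then obtain k l where kl: "k \<le> d" "l \<le> d" "k \<noteq> l" "a ^ k = a ^ l" by (auto simp: inj_on_def)
    show ?thesis
    proof (rule that[of "monom 1 k - monom 1 l"])
      have "coeff (monom 1 k - monom (1::complex) l) k = 1" using kl by simp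
      then show "monom 1 k - monom (1::complex) l \<noteq> 0" by (metis coeff_0 zero_neq_one)
      show "degree (monom 1 k - monom (1::complex) l) \<le> algebra_dim TYPE('a)"
        using kl by (intro degree_diff_le order_trans[OF degree_monom_le]) (auto simp: d_def)
      show "peval a (monom 1 k - monom 1 l) = 0" using kl by simp
    qed
  qed
qed

lemma mult_adj_eq_0_iff: "adj x * x = 0 \<longleftrightarrow> x = (0::'a::unital_cstar_algebra)"
  by (metis cstar_identity mult_zero_right norm_eq_zero power2_eq_iff zero_power2 power_eq_0_iff)

lemma eigenvalue_selfadjoint_real:
  fixes a y :: "'a::unital_cstar_algebra"
  assumes sa: "adj a = a" and y: "y \<noteq> 0" "a * y = scaleC z y"
  shows "z \<in> \<real>" "cmod z \<le> norm a"
proof -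
  have 1: "adj y * a * y = scaleC z (adj y * y)"
    by (simp add: mult.assoc y mult_scaleC_right)
  have "adj (adj y * a * y) = adj y * a * y"
    by (simp add: adj_mult adj_adj sa mult.assoc)
  then have "scaleC (cnj z) (adj y * y) = scaleC z (adj y * y)"
    unfolding 1 by (simp add: adj_scaleC adj_mult adj_adj)
  then have "cnj z = z"
    using y(1) by (simp add: mult_adj_eq_0_iff)
  then show "z \<in> \<real>" by (simp add: Reals_cnj_iff)
  have "cmod z * norm y \<le> norm a * norm y"
    using norm_mult_ineq[of a y] by (simp add: y norm_scaleC)
  then show "cmod z \<le> norm a" using y by simp
qed

text \<open>
  A nonzero polynomial \<open>q\<close> of least degree annihilating \<open>a\<close> has degree at most the dimension. Each root
  is an eigenvalue of left multiplication by \<open>a\<close>, hence real and of modulus at most \<open>\<parallel>a\<parallel>\<close>. The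
  roots are simple: if \<open>(a - z)\<^sup>2 s(a) = 0\<close>, then \<open>y = (a - z) s(a)\<close> satisfies \<open>adj y * y = 0\<close>, so
  \<open>y = 0\<close>, against minimality. Therefore every polynomial vanishing on the roots annihilates \<open>a\<close>,
  and the Lagrange polynomials \<open>l z\<close> of the roots, evaluated at \<open>a\<close>, are self-adjoint idempotents with
  \<open>f(a) = (\<Sum>z. f z (l z)(a))\<close>.
\<close>

lemma spectral_decomposition:
  fixes a :: "'a::unital_cstar_algebra"
  assumes fd: "finite_dimensional TYPE('a)" and sa: "adj a = a"
  obtains Z :: "real set" and e :: "real \<Rightarrow> 'a"
  where "finite Z" "card Z \<le> algebra_dim TYPE('a)" "\<forall>z\<in>Z. \<bar>z\<bar> \<le> norm a"
    "\<forall>z\<in>Z. norm (e z) \<le> 1" "\<forall>k. a ^ k = (\<Sum>z\<in>Z. scaleC (of_real z ^ k) (e z))"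
proof -
  let ?P = "\<lambda>q. q \<noteq> 0 \<and> peval a q = 0"
  obtain q0 where q0: "?P q0" "degree q0 \<le> algebra_dim TYPE('a)"
    using annihilating_poly_exists[OF fd, of a] by blast
  define q where "q = arg_min degree ?P"
  have q: "q \<noteq> 0" "peval a q = 0" and minimal: "\<And>p. p \<noteq> 0 \<Longrightarrow> peval a p = 0 \<Longrightarrow> degree q \<le> degree p"
    using arg_min_natI[of ?P q0 degree] arg_min_nat_le[of ?P _ degree] q0(1) unfolding q_def by auto
  have deg_q: "degree q \<le> algebra_dim TYPE('a)"
    using minimal[of q0] q0 by simp
  define R where "R = {z. poly q z = 0}"
  have R: "finite R" "card R \<le> algebra_dim TYPE('a)"
    using poly_roots_finite[OF q(1)] card_poly_roots_bound[OF q(1)] deg_q by (auto simp: R_def)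
  have shift: "peval a [:- z, 1:] * y = a * y - scaleC z y" for z y
    by (simp add: algebra_simps mult_scaleC_left complex_vector.scale_minus_left)
  have eigen: "\<exists>y. y \<noteq> 0 \<and> a * y = scaleC z y" if "z \<in> R" for z
  proof -
    have "[:- z, 1:] dvd q" using that by (simp only: R_def mem_Collect_eq poly_eq_0_iff_dvd)
    then obtain s where s: "q = [:- z, 1:] * s" by (rule dvdE)
    then have "s \<noteq> 0" using q by auto
    moreover have "degree q = 1 + degree s"
      unfolding s using \<open>s \<noteq> 0\<close> by (subst degree_mult_eq) auto
    ultimately have "peval a s \<noteq> 0" using minimal[of s] by linarith
    moreover have "peval a [:- z, 1:] * peval a s = 0"
      using q(2) by (simp only: s peval_mult)
    ultimately show ?thesis by (intro exI[of _ "peval a s"]) (simp only: shift, simp)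
  qed
  have real: "z \<in> \<real>" "cmod z \<le> norm a" if "z \<in> R" for z
    using eigen[OF that] eigenvalue_selfadjoint_real[OF sa] by blast+
  define w where "w = (\<Prod>z\<in>R. [:- z, 1:])"
  have "w dvd q" unfolding w_def by (rule prod_linear_factors_dvd[OF R(1)]) (simp add: R_def)
  then obtain g where g: "q = w * g" by (auto simp: dvd_def)
  have "degree g = 0"
  proof (rule ccontr)
    assume "degree g \<noteq> 0"
    then obtain z where z: "poly g z = 0"
      using fundamental_theorem_of_algebra[of g] constant_degree[of g] by auto
    then have zR: "z \<in> R" by (simp add: R_def g)
    have "[:- z, 1:] dvd g" using z by (simp only: poly_eq_0_iff_dvd)
    then obtain h where h: "g = [:- z, 1:] * h" by (rule dvdE)
    define s where "s = (\<Prod>z\<in>R - {z}. [:- z, 1:]) * h"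
    have qs: "q = [:- z, 1:] * ([:- z, 1:] * s)"
      unfolding g w_def h s_def prod.remove[OF R(1) zR] by (simp only: mult_ac)
    then have s0: "s \<noteq> 0" using q by auto
    define y where "y = peval a [:- z, 1:] * peval a s"
    have "peval a [:- z, 1:] * y = 0"
      using q(2) by (simp only: qs peval_mult y_def)
    moreover have "adj (peval a [:- z, 1:]) = peval a [:- z, 1:]"
      using real(1)[OF zR] by (simp add: adj_diff adj_scaleC adj_one sa Reals_cnj_iff)
    ultimately have "adj y * y = 0"
      unfolding y_def adj_mult by (simp add: mult.assoc del: peval_pCons)
    then have "y = 0" by (simp add: mult_adj_eq_0_iff)
    then have "peval a ([:- z, 1:] * s) = 0" by (simp only: y_def peval_mult)
    moreover have "[:- z, 1:] * s \<noteq> 0" using q qs by auto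
    moreover have "degree q = 1 + degree ([:- z, 1:] * s)"
      unfolding qs using \<open>[:- z, 1:] * s \<noteq> 0\<close> by (subst degree_mult_eq) (auto simp del: mult_pCons_left)
    ultimately show False using minimal[of "[:- z, 1:] * s"] by linarith
  qed
  then obtain c where "g = [:c:]" by (rule degree_eq_zeroE)
  then have "peval a w = 0" using q by (auto simp: g)
  then have vanish: "peval a f = 0" if "\<And>z. z \<in> R \<Longrightarrow> poly f z = 0" for f
    using prod_linear_factors_dvd[OF R(1) that] by (auto simp: w_def dvd_def)
  define l where "l z = (\<Prod>z'\<in>R - {z}. smult (inverse (z - z')) [:- z', 1:])" for z
  have l: "poly (l z) z' = (if z = z' then 1 else 0)" if "z \<in> R" "z' \<in> R" for z z'
  proof (cases "z = z'")
    case True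
    have "poly (l z) z = (\<Prod>z'\<in>R - {z}. 1)"
      unfolding l_def poly_prod by (rule prod.cong) (auto simp: field_simps)
    then show ?thesis using True by simp
  next
    case False
    then show ?thesis unfolding l_def poly_prod using that R by auto
  qed
  have idem: "peval a (l z) * peval a (l z) = peval a (l z)" if "z \<in> R" for z
    using vanish[of "l z * l z - l z"] that by (simp add: l)
  have sa_l: "adj (peval a (l z)) = peval a (l z)" if z: "z \<in> R" for z
  proof -
    have "peval a (map_poly cnj (l z) - l z) = 0"
    proof (rule vanish)
      fix z' assume z': "z' \<in> R"
      have "poly (map_poly cnj (l z)) (cnj z') = cnj (poly (l z) z')"
        by (simp add: poly_altdef degree_map_poly coeff_map_poly)
      then show "poly (map_poly cnj (l z) - l z) z' = 0"
        using real(1)[OF z'] l[OF z z'] by (simp add: Reals_cnj_iff)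
    qed
    then show ?thesis by (simp add: adj_peval[OF sa])
  qed
  have norm_l: "norm (peval a (l z)) \<le> 1" if "z \<in> R" for z
  proof -
    have "norm (peval a (l z)) = (norm (peval a (l z)))\<^sup>2"
      using cstar_identity[of "peval a (l z)"] by (simp add: sa_l idem that)
    then show ?thesis by (auto simp: power2_eq_square)
  qed
  have pow: "a ^ k = (\<Sum>z\<in>R. scaleC (z ^ k) (peval a (l z)))" for k
  proof -
    have "peval a (monom 1 k - (\<Sum>z\<in>R. smult (z ^ k) (l z))) = 0"
    proof (rule vanish)
      fix z assume z: "z \<in> R"
      have "(\<Sum>z'\<in>R. z' ^ k * poly (l z') z) = (\<Sum>z'\<in>R. if z' = z then z ^ k else 0)"
        by (rule sum.cong) (auto simp: l z)
      then show "poly (monom 1 k - (\<Sum>z\<in>R. smult (z ^ k) (l z))) z = 0"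
        using z R by (simp add: poly_monom poly_sum)
    qed
    then show ?thesis by (simp add: peval_sum)
  qed
  have Re: "of_real (Re z) = z" if "z \<in> R" for z
    using real(1)[OF that] by (simp add: of_real_Re)
  have inj: "inj_on Re R" by (metis Re inj_onI)
  show ?thesis
  proof (rule that[of "Re ` R" "\<lambda>z. peval a (l (of_real z))"])
    show "card (Re ` R) \<le> algebra_dim TYPE('a)" using R card_image_le order_trans by blast
    show "\<forall>z\<in>Re ` R. \<bar>z\<bar> \<le> norm a"
    proof
      fix x assume "x \<in> Re ` R"
      then obtain z where "z \<in> R" "x = Re z" by blast
      then show "\<bar>x\<bar> \<le> norm a" using abs_Re_le_cmod[of z] real(2)[of z] by linarith
    qed
    show "\<forall>k. a ^ k = (\<Sum>z\<in>Re ` R. scaleC (of_real z ^ k) (peval a (l (of_real z))))"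
      unfolding sum.reindex[OF inj] pow by (intro allI sum.cong refl) (simp add: Re)
  qed (use R norm_l Re in auto)
qed

text \<open>
  Expanding the first \<open>m - 1\<close> slots by the spectral decomposition gives at most \<open>dim\<^sup>m\<^sup>-\<^sup>1\<close> terms. The
  last slot is left unexpanded: each term ends with a polynomial in \<open>a m\<close>, which is bounded by \<open>M\<close>
  through the von Neumann inequality. This saves one factor of the dimension.
\<close>

lemma norm_poly_tensor_finite_dimensional_le:
  fixes a b :: "nat \<Rightarrow> 'a::unital_cstar_algebra"
  assumes fd: "finite_dimensional TYPE('a)" and m: "m \<ge> 1"
    and le: "\<And>x. x \<in> cube r m \<Longrightarrow> cmod (poly_eval m P x) \<le> M"
    and a: "\<And>i. i \<in> {1..m} \<Longrightarrow> adj (a i) = a i \<and> norm (a i) \<le> r"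
  shows "norm (poly_tensor m P a b)
    \<le> real (algebra_dim TYPE('a)) ^ (m - 1) * M * (\<Prod>i\<in>{1..m-1}. norm (b i))"
proof -
  let ?L = Poly_Mapping.lookup
  let ?d = "algebra_dim TYPE('a)"
  obtain n where n: "m = Suc n" using m by (cases m) auto
  define Q where "Q i Z e \<longleftrightarrow> finite Z \<and> card Z \<le> ?d \<and> (\<forall>z\<in>Z. \<bar>z\<bar> \<le> norm (a i)) \<and>
      (\<forall>z\<in>Z. norm (e z) \<le> 1) \<and> (\<forall>k. a i ^ k = (\<Sum>z\<in>Z. scaleC (of_real z ^ k) (e z)))"
    for i and Z :: "real set" and e :: "real \<Rightarrow> 'a"
  have "\<exists>Z e. Q i Z e" if "i \<in> {1..m}" for i
  proof -
    have "adj (a i) = a i" using a[OF that] by simp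
    then obtain Z e where "finite Z" "card Z \<le> ?d" "\<forall>z\<in>Z. \<bar>z\<bar> \<le> norm (a i)"
      "\<forall>z\<in>Z. norm (e z) \<le> 1" "\<forall>k. a i ^ k = (\<Sum>z\<in>Z. scaleC (of_real z ^ k) (e z))"
      by (rule spectral_decomposition[OF fd])
    then show ?thesis unfolding Q_def by (intro exI[of _ Z] exI[of _ e] conjI)
  qed
  then obtain Z e where "\<And>i. i \<in> {1..m} \<Longrightarrow> Q i (Z i) (e i)" by metis
  then have Z: "i \<in> {1..m} \<Longrightarrow> finite (Z i) \<and> card (Z i) \<le> ?d \<and> (\<forall>z\<in>Z i. \<bar>z\<bar> \<le> norm (a i))
      \<and> (\<forall>z\<in>Z i. norm (e i z) \<le> 1) \<and> (\<forall>k. a i ^ k = (\<Sum>z\<in>Z i. scaleC (of_real z ^ k) (e i z)))" for i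
    unfolding Q_def by blast
  define X where "X f = alternating_prod n (\<lambda>i. e i (f i)) b" for f
  define p where "p f = (\<Sum>\<delta>\<in>Poly_Mapping.keys P.
      monom (?L P \<delta> * (\<Prod>i\<in>{1..n}. complex_of_real (f i) ^ ?L \<delta> i)) (?L \<delta> m))" for f
  have "poly_tensor m P a b = (\<Sum>\<delta>\<in>Poly_Mapping.keys P. scaleC (?L P \<delta>)
      (alternating_prod n (\<lambda>i. a i ^ ?L \<delta> i) b * a m ^ ?L \<delta> m))"
    by (simp only: poly_tensor_def n diff_Suc_1 prod_list_eq_alternating_prod)
  also have "\<dots> = (\<Sum>\<delta>\<in>Poly_Mapping.keys P. \<Sum>f\<in>PiE {1..n} Z.
      X f * scaleC (?L P \<delta> * (\<Prod>i\<in>{1..n}. complex_of_real (f i) ^ ?L \<delta> i)) (a m ^ ?L \<delta> m))"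
  proof (intro sum.cong refl)
    fix \<delta>
    have "alternating_prod n (\<lambda>i. a i ^ ?L \<delta> i) b
        = alternating_prod n (\<lambda>i. \<Sum>z\<in>Z i. scaleC (complex_of_real z ^ ?L \<delta> i) (e i z)) b"
      by (rule alternating_prod_cong) (use Z n in auto)
    also have "\<dots> = (\<Sum>f\<in>PiE {1..n} Z. scaleC (\<Prod>i\<in>{1..n}. complex_of_real (f i) ^ ?L \<delta> i) (X f))"
      unfolding X_def by (rule alternating_prod_sum) (use Z n in auto)
    finally show "scaleC (?L P \<delta>) (alternating_prod n (\<lambda>i. a i ^ ?L \<delta> i) b * a m ^ ?L \<delta> m)
      = (\<Sum>f\<in>PiE {1..n} Z.
      X f * scaleC (?L P \<delta> * (\<Prod>i\<in>{1..n}. complex_of_real (f i) ^ ?L \<delta> i)) (a m ^ ?L \<delta> m))"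
      by (simp only: sum_distrib_right complex_vector.scale_sum_right mult_scaleC_left
          mult_scaleC_right scaleC_scaleC)
  qed
  also have "\<dots> = (\<Sum>f\<in>PiE {1..n} Z. X f * peval (a m) (p f))"
    by (subst sum.swap) (simp add: p_def peval_sum sum_distrib_left)
  also have "norm \<dots> \<le> (\<Sum>f\<in>PiE {1..n} Z. (\<Prod>i\<in>{1..n}. norm (b i)) * M)"
  proof (intro sum_norm_le)
    fix f assume f: "f \<in> PiE {1..n} Z"
    have "norm (peval (a m) (p f)) \<le> M"
    proof (rule norm_peval_le)
      show "adj (a m) = a m" "norm (a m) \<le> r" using a[of m] m by auto
      fix t :: real assume t: "\<bar>t\<bar> \<le> r"
      let ?x = "f(m := t)"
      have "poly (p f) (of_real t) = poly_eval m P ?x"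
      proof -
        have "(\<Prod>i\<in>{1..n}. complex_of_real (?x i) ^ ?L \<delta> i)
            = (\<Prod>i\<in>{1..n}. complex_of_real (f i) ^ ?L \<delta> i)" for \<delta>
          by (rule prod.cong) (auto simp: n)
        then show ?thesis
          by (simp add: p_def poly_eval_def poly_sum poly_monom n mult.assoc)
      qed
      moreover have "?x \<in> cube r m"
      proof -
        have "\<bar>f i\<bar> \<le> r" if "i \<in> {1..n}" for i
        proof -
          have "f i \<in> Z i" using f that by (rule PiE_mem)
          then show ?thesis using Z[of i] a[of i] that n by fastforce
        qed
        then have "\<bar>?x i\<bar> \<le> r" if "i \<in> {1..m}" for i
          using that t by (cases "i = m") (auto simp: n)
        then have "?x i \<in> {-r..r}" if "i \<in> {1..m}" for i
          using that by (metis abs_le_D1 abs_le_D2 atLeastAtMost_iff neg_le_iff_le minus_minus)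
        moreover have "?x i = undefined" if "i \<notin> {1..m}" for i
          using that PiE_arb[OF f, of i] m by (auto simp: n)
        ultimately show ?thesis unfolding cube_def by (intro PiE_I) 
      qed
      ultimately show "cmod (poly (p f) (of_real t)) \<le> M" using le by simp
    qed
    moreover have "norm (X f) \<le> (\<Prod>i\<in>{1..n}. norm (b i))"
    proof -
      have "(\<Prod>i\<in>{1..n}. norm (e i (f i))) \<le> (\<Prod>i\<in>{1..n}. 1)"
      proof (intro prod_mono conjI norm_ge_zero)
        fix i assume i: "i \<in> {1..n}"
        then have "f i \<in> Z i" using f by (metis PiE_mem)
        then show "norm (e i (f i)) \<le> 1" using Z[of i] i n by auto
      qed
      then have "(\<Prod>i\<in>{1..n}. norm (e i (f i))) * (\<Prod>i\<in>{1..n}. norm (b i)) \<le> 1 * (\<Prod>i\<in>{1..n}. norm (b i))"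
        by (intro mult_right_mono prod_nonneg) auto
      then show ?thesis
        using norm_alternating_prod_le[of n "\<lambda>i. e i (f i)" b] unfolding X_def by linarith
    qed
    ultimately have "norm (X f) * norm (peval (a m) (p f)) \<le> (\<Prod>i\<in>{1..n}. norm (b i)) * M"
      by (intro mult_mono prod_nonneg) auto
    then show "norm (X f * peval (a m) (p f)) \<le> (\<Prod>i\<in>{1..n}. norm (b i)) * M"
      by (rule order_trans[OF norm_mult_ineq])
  qed
  also have "\<dots> = real (card (PiE {1..n} Z)) * ((\<Prod>i\<in>{1..n}. norm (b i)) * M)" by simp
  also have "\<dots> \<le> real (?d ^ n) * ((\<Prod>i\<in>{1..n}. norm (b i)) * M)"
  proof (intro mult_right_mono)
    have "card (PiE {1..n} Z) = (\<Prod>i\<in>{1..n}. card (Z i))" by (rule card_PiE) simp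
    also have "\<dots> \<le> (\<Prod>i\<in>{1..n}. ?d)" using Z n by (intro prod_mono) auto
    finally show "real (card (PiE {1..n} Z)) \<le> real (?d ^ n)" by (simp only: of_nat_le_iff prod_constant card_atLeastAtMost diff_Suc_1)
    have "0 \<le> r" using a[of 1] m order_trans[OF norm_ge_zero, of "a 1" r] by simp
    then have "(\<lambda>i\<in>{1..m}. 0) \<in> cube r m" by (simp add: cube_def)
    then have "0 \<le> M" using le order_trans[OF norm_ge_zero] by blast
    then show "0 \<le> (\<Prod>i\<in>{1..n}. norm (b i)) * M" by (intro mult_nonneg_nonneg prod_nonneg) auto
  qed
  finally show ?thesis by (simp add: n mult_ac)
qed

text \<open>
  That the dimension is positive, as definiteness of the scaled norm requires, is read off from an
  annihilating polynomial of \<open>0\<close>: it cannot be constant because \<open>1 \<noteq> 0\<close>.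
\<close>

theorem LFC_admissible_scaled_uniform_finite_dimensional:
  fixes A :: "'a::unital_cstar_algebra itself"
  assumes "finite_dimensional A"
  shows "LFC_admissible A (scaled_uniform_family A)"
proof -
  have fd: "finite_dimensional TYPE('a)" using assms by (simp add: finite_dimensional_def)
  let ?d = "algebra_dim TYPE('a)"
  have d: "?d > 0"
  proof -
    obtain q :: "complex poly" where q: "q \<noteq> 0" "degree q \<le> ?d" "peval (0::'a) q = 0"
      using annihilating_poly_exists[OF fd, of 0] by blast
    have "degree q \<noteq> 0"
    proof
      assume "degree q = 0"
      then obtain c where c: "q = [:c:]" by (rule degree_eq_zeroE)
      then have "scaleC c (1::'a) = 0" using q(3) by simp
      then have "cmod c = 0" using norm_scaleC[of c "1::'a"] by simp
      then show False using q(1) c by simp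
    qed
    then show ?thesis using q(2) by simp
  qed
  have "LFC_admissible A (\<lambda>r m \<phi>. ennreal (real ?d ^ (m - 1)) * uniform_family r m \<phi>)"
  proof (rule LFC_admissible_scaled_uniform)
    fix m P r M and a b :: "nat \<Rightarrow> 'a"
    assume "2 \<le> m" "\<And>x. x \<in> cube r m \<Longrightarrow> cmod (poly_eval m P x) \<le> M"
      "\<And>i. i \<in> {1..m} \<Longrightarrow> adj (a i) = a i \<and> norm (a i) \<le> r"
    then show "norm (poly_tensor m P a b) \<le> real ?d ^ (m - 1) * M * (\<Prod>i\<in>{1..m-1}. norm (b i))"
      using norm_poly_tensor_finite_dimensional_le[OF fd, of m r P M a b] by simp
  qed (use d in simp)
  also have "(\<lambda>r m \<phi>. ennreal (real ?d ^ (m - 1)) * uniform_family r m \<phi>) = scaled_uniform_family A"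
    by (intro ext) (simp add: scaled_uniform_family_def algebra_dim_def ennreal_of_nat_eq_real_of_nat
        flip: ennreal_power)
  finally show ?thesis .
qed

section \<open>The Varopoulos norm\<close>

lemma le_mult_Inf_ennreal:
  fixes c x :: ennreal
  assumes "c \<noteq> 0" "c < top" "\<And>s. s \<in> S \<Longrightarrow> x \<le> c * s"
  shows "x \<le> c * Inf S"
proof -
  have "x / c \<le> Inf S"
    using assms by (intro Inf_greatest divide_le_posI_ennreal) (auto simp: zero_less_iff_neq_zero)
  then have "c * (x / c) \<le> c * Inf S" by (intro mult_left_mono) auto
  moreover have "c * (x / c) = x"
    using assms mult_divide_eq_ennreal[of c x] by (simp add: ennreal_times_divide mult.commute less_top)
  ultimately show ?thesis by simp
qed

text \<open>
  The triangle inequality for a series, with a majorant in \<open>[0, \<infinity>]\<close>; it passes from the partial sums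
  to the limit.
\<close>

lemma norm_sums_le_suminf:
  fixes g :: "nat \<Rightarrow> 'b::real_normed_vector" and p :: "nat \<Rightarrow> ennreal"
  assumes "g sums s" "\<And>n. ennreal (norm (g n)) \<le> p n"
  shows "ennreal (norm s) \<le> suminf p"
proof -
  have "ennreal (norm (\<Sum>n<N. g n)) \<le> suminf p" for N
  proof -
    have "ennreal (norm (\<Sum>n<N. g n)) \<le> ennreal (\<Sum>n<N. norm (g n))"
      by (intro ennreal_leI norm_sum)
    also have "\<dots> = (\<Sum>n<N. ennreal (norm (g n)))" by (simp add: sum_ennreal)
    also have "\<dots> \<le> (\<Sum>n<N. p n)" by (intro sum_mono assms)
    also have "\<dots> \<le> suminf p" by (intro sum_le_suminf) auto
    finally show ?thesis .
  qed
  moreover have lim: "(\<lambda>N. ennreal (norm (\<Sum>n<N. g n))) \<longlonglongrightarrow> ennreal (norm s)"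
    using assms(1) unfolding sums_def by (intro tendsto_ennrealI tendsto_norm)
  ultimately show ?thesis by (intro LIMSEQ_le_const2[OF lim]) blast
qed

lemma sums_interleave:
  fixes f g :: "nat \<Rightarrow> 'b::{t2_space, topological_comm_monoid_add}"
  assumes "f sums s" "g sums t"
  shows "(\<lambda>n. if even n then f (n div 2) else g (n div 2)) sums (s + t)"
proof -
  have "(\<lambda>n. if even n then f (n div 2) else 0) sums s"
  proof (rule sums_mono_reindex[of "\<lambda>n. 2 * n", THEN iffD1])
    fix n :: nat assume "n \<notin> range (\<lambda>n. 2 * n)"
    then have "odd n" by (metis dvdE rangeI)
    then show "(if even n then f (n div 2) else 0) = 0" by simp
  qed (use assms(1) in \<open>simp_all add: strict_mono_def\<close>)
  moreover have "(\<lambda>n. if even n then 0 else g (n div 2)) sums t"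
  proof (rule sums_mono_reindex[of "\<lambda>n. Suc (2 * n)", THEN iffD1])
    fix n :: nat assume "n \<notin> range (\<lambda>n. Suc (2 * n))"
    then have "even n" by (metis oddE rangeI Suc_eq_plus1)
    then show "(if even n then 0 else g (n div 2)) = 0" by simp
  qed (use assms(2) in \<open>simp_all add: strict_mono_def\<close>)
  ultimately have "(\<lambda>n. (if even n then f (n div 2) else 0) + (if even n then 0 else g (n div 2))) sums (s + t)"
    by (rule sums_add)
  moreover have "(\<lambda>n. (if even n then f (n div 2) else 0) + (if even n then 0 else g (n div 2)))
      = (\<lambda>n. if even n then f (n div 2) else g (n div 2))"
    by auto
  ultimately show ?thesis by (simp only:)
qed

definition varopoulos_rep ::
    "real \<Rightarrow> nat \<Rightarrow> ((nat \<Rightarrow> real) \<Rightarrow> complex) \<Rightarrow> (nat \<Rightarrow> nat \<Rightarrow> real \<Rightarrow> complex) \<Rightarrow> bool" where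
  "varopoulos_rep r m \<phi> \<psi> \<longleftrightarrow>
     (\<forall>i\<in>{1..m}. \<forall>n. \<psi> i n \<in> cfun {-r..r}) \<and>
     suminf (\<lambda>n. \<Prod>i\<in>{1..m}. sup_norm {-r..r} (\<psi> i n)) < \<infinity> \<and>
     (\<forall>x\<in>cube r m. (\<lambda>n. \<Prod>i\<in>{1..m}. \<psi> i n (x i)) sums \<phi> x)"

definition varopoulos_cost :: "real \<Rightarrow> nat \<Rightarrow> (nat \<Rightarrow> nat \<Rightarrow> real \<Rightarrow> complex) \<Rightarrow> ennreal" where
  "varopoulos_cost r m \<psi> = suminf (\<lambda>n. \<Prod>i\<in>{1..m}. sup_norm {-r..r} (\<psi> i n))"

lemma varopoulos_family_eq:
  "varopoulos_family r m \<phi> = Inf (varopoulos_cost r m ` {\<psi>. varopoulos_rep r m \<phi> \<psi>})"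
  unfolding varopoulos_family_def varopoulos_rep_def varopoulos_cost_def image_Collect
  by (rule refl)

lemma varopoulos_family_le:
  "varopoulos_rep r m \<phi> \<psi> \<Longrightarrow> varopoulos_family r m \<phi> \<le> varopoulos_cost r m \<psi>"
  unfolding varopoulos_family_eq by (rule Inf_lower) simp

lemma varopoulos_repI:
  assumes "\<And>i n. i \<in> {1..m} \<Longrightarrow> \<psi> i n \<in> cfun {-r..r}" "varopoulos_cost r m \<psi> < \<infinity>"
    "\<And>x. x \<in> cube r m \<Longrightarrow> (\<lambda>n. \<Prod>i\<in>{1..m}. \<psi> i n (x i)) sums \<phi> x"
  shows "varopoulos_rep r m \<phi> \<psi>"
  unfolding varopoulos_rep_def varopoulos_cost_def[symmetric] by (intro conjI ballI allI assms)

lemma varopoulos_repD: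
  assumes "varopoulos_rep r m \<phi> \<psi>"
  shows "i \<in> {1..m} \<Longrightarrow> \<psi> i n \<in> cfun {-r..r}" "varopoulos_cost r m \<psi> < \<infinity>"
    "x \<in> cube r m \<Longrightarrow> (\<lambda>n. \<Prod>i\<in>{1..m}. \<psi> i n (x i)) sums \<phi> x"
  using assms[unfolded varopoulos_rep_def, folded varopoulos_cost_def] by simp_all

lemma norm_prod_le_prod_sup_norm:
  assumes "x \<in> cube r m"
  shows "ennreal (norm (\<Prod>i\<in>{1..m}. \<psi> i (x i))) \<le> (\<Prod>i\<in>{1..m}. sup_norm {-r..r} (\<psi> i))"
proof -
  have "ennreal (norm (\<Prod>i\<in>{1..m}. \<psi> i (x i))) = (\<Prod>i\<in>{1..m}. ennreal (cmod (\<psi> i (x i))))"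
    unfolding prod_norm[symmetric] by (rule prod_ennreal[symmetric]) simp
  also have "\<dots> \<le> (\<Prod>i\<in>{1..m}. sup_norm {-r..r} (\<psi> i))"
  proof (rule prod_mono_ennreal)
    fix i assume "i \<in> {1..m}"
    then have "x i \<in> {-r..r}" by (rule PiE_mem[OF assms[unfolded cube_def]])
    then show "ennreal (cmod (\<psi> i (x i))) \<le> sup_norm {-r..r} (\<psi> i)"
      unfolding sup_norm_def by (rule SUP_upper)
  qed
  finally show ?thesis .
qed

lemma cmod_le_varopoulos_cost:
  assumes "varopoulos_rep r m \<phi> \<psi>" "x \<in> cube r m"
  shows "ennreal (cmod (\<phi> x)) \<le> varopoulos_cost r m \<psi>"
  unfolding varopoulos_cost_def
proof (rule norm_sums_le_suminf)
  show "(\<lambda>n. \<Prod>i\<in>{1..m}. \<psi> i n (x i)) sums \<phi> x"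
    using assms by (rule varopoulos_repD)
  show "ennreal (norm (\<Prod>i\<in>{1..m}. \<psi> i n (x i))) \<le> (\<Prod>i\<in>{1..m}. sup_norm {-r..r} (\<psi> i n))" for n
    using norm_prod_le_prod_sup_norm[OF assms(2), of "\<lambda>i. \<psi> i n"] .
qed

text \<open>
  Scaling acts on the first factor, which exists because \<open>m \<ge> 1\<close>.
\<close>

lemma varopoulos_rep_scale:
  assumes rep: "varopoulos_rep r m \<phi> \<psi>" and m: "m \<ge> 1"
  shows "\<exists>\<psi>'. varopoulos_rep r m (\<lambda>x. c * \<phi> x) \<psi>' \<and>
    varopoulos_cost r m \<psi>' = ennreal (cmod c) * varopoulos_cost r m \<psi>"
proof -
  define \<psi>' where "\<psi>' i n = (if i = 1 then (\<lambda>t. c * \<psi> i n t) else \<psi> i n)" for i n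
  have split: "{1..m} = insert 1 {Suc 1..m}" using m by (rule Icc_eq_insert_lb_nat)
  have pr: "(\<Prod>i\<in>{1..m}. \<psi>' i n (x i)) = c * (\<Prod>i\<in>{1..m}. \<psi> i n (x i))" for n x
    unfolding split by (simp add: \<psi>'_def mult.assoc)
  have pn: "(\<Prod>i\<in>{1..m}. sup_norm {-r..r} (\<psi>' i n))
      = ennreal (cmod c) * (\<Prod>i\<in>{1..m}. sup_norm {-r..r} (\<psi> i n))" for n
    unfolding split by (simp add: \<psi>'_def sup_norm_scale mult.assoc)
  have cost: "varopoulos_cost r m \<psi>' = ennreal (cmod c) * varopoulos_cost r m \<psi>"
    unfolding varopoulos_cost_def pn by (rule ennreal_suminf_cmult)
  have cf: "\<psi>' i n \<in> cfun {-r..r}" if "i \<in> {1..m}" for i n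
  proof -
    have "\<psi> i n \<in> cfun {-r..r}" using rep that by (rule varopoulos_repD)
    then show ?thesis using cfun_lincomb[of "\<psi> i n" _ "\<psi> i n" c 0]
      by (cases "i = 1") (simp_all add: \<psi>'_def)
  qed
  have "varopoulos_cost r m \<psi> < \<infinity>" using rep by (rule varopoulos_repD)
  then have fin: "varopoulos_cost r m \<psi>' < \<infinity>" unfolding cost by (simp add: ennreal_mult_less_top)
  have "(\<lambda>n. \<Prod>i\<in>{1..m}. \<psi>' i n (x i)) sums (c * \<phi> x)" if "x \<in> cube r m" for x
    unfolding pr by (rule sums_mult[OF varopoulos_repD(3)[OF rep that]])
  with cf fin have "varopoulos_rep r m (\<lambda>x. c * \<phi> x) \<psi>'"
    by (rule varopoulos_repI)
  then show ?thesis using cost by blast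
qed

text \<open>
  Two series are added by interleaving them.
\<close>

lemma varopoulos_rep_add:
  assumes rep: "varopoulos_rep r m \<phi> \<psi>" "varopoulos_rep r m \<phi>' \<psi>'"
  shows "\<exists>\<xi>. varopoulos_rep r m (\<lambda>x. \<phi> x + \<phi>' x) \<xi> \<and>
    varopoulos_cost r m \<xi> = varopoulos_cost r m \<psi> + varopoulos_cost r m \<psi>'"
proof -
  define \<xi> where "\<xi> i n = (if even n then \<psi> i (n div 2) else \<psi>' i (n div 2))" for i n
  have cost: "varopoulos_cost r m \<xi> = varopoulos_cost r m \<psi> + varopoulos_cost r m \<psi>'"
  proof -
    have "(\<lambda>n. if even n then \<Prod>i\<in>{1..m}. sup_norm {-r..r} (\<psi> i (n div 2))
        else \<Prod>i\<in>{1..m}. sup_norm {-r..r} (\<psi>' i (n div 2)))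
      sums (varopoulos_cost r m \<psi> + varopoulos_cost r m \<psi>')"
      unfolding varopoulos_cost_def by (intro sums_interleave summable_sums) auto
    also have "(\<lambda>n. if even n then \<Prod>i\<in>{1..m}. sup_norm {-r..r} (\<psi> i (n div 2))
        else \<Prod>i\<in>{1..m}. sup_norm {-r..r} (\<psi>' i (n div 2)))
      = (\<lambda>n. \<Prod>i\<in>{1..m}. sup_norm {-r..r} (\<xi> i n))"
      by (auto simp: \<xi>_def)
    finally show ?thesis unfolding varopoulos_cost_def by (simp add: sums_iff)
  qed
  have "varopoulos_cost r m \<psi> < \<infinity>" "varopoulos_cost r m \<psi>' < \<infinity>"
    using rep by (auto dest: varopoulos_repD(2))
  then have fin: "varopoulos_cost r m \<xi> < \<infinity>" unfolding cost by simp
  have sums: "(\<lambda>n. \<Prod>i\<in>{1..m}. \<xi> i n (x i)) sums (\<phi> x + \<phi>' x)" if "x \<in> cube r m" for x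
  proof -
    have "(\<lambda>n. if even n then \<Prod>i\<in>{1..m}. \<psi> i (n div 2) (x i) else \<Prod>i\<in>{1..m}. \<psi>' i (n div 2) (x i))
        sums (\<phi> x + \<phi>' x)"
      by (rule sums_interleave[OF varopoulos_repD(3)[OF rep(1) that] varopoulos_repD(3)[OF rep(2) that]])
    also have "(\<lambda>n. if even n then \<Prod>i\<in>{1..m}. \<psi> i (n div 2) (x i) else \<Prod>i\<in>{1..m}. \<psi>' i (n div 2) (x i))
        = (\<lambda>n. \<Prod>i\<in>{1..m}. \<xi> i n (x i))"
      by (auto simp: \<xi>_def)
    finally show ?thesis .
  qed
  have "\<xi> i n \<in> cfun {-r..r}" if "i \<in> {1..m}" for i n
    using varopoulos_repD(1)[OF rep(1) that] varopoulos_repD(1)[OF rep(2) that] by (simp add: \<xi>_def)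
  then have "varopoulos_rep r m (\<lambda>x. \<phi> x + \<phi>' x) \<xi>"
    using fin sums by (rule varopoulos_repI)
  then show ?thesis using cost by blast
qed

lemma varopoulos_family_zero:
  assumes "m \<ge> 1"
  shows "varopoulos_family r m (\<lambda>_. 0) = 0"
proof -
  have 0: "sup_norm {-r..r} (\<lambda>_. 0) = 0"
    using sup_norm_scale[of "{-r..r}" 0 "\<lambda>_. 0"] by simp
  have "(\<Prod>i\<in>{1..m}. 0 :: 'z::comm_semiring_1) = 0" using assms by (simp add: power_0_left)
  moreover have "(\<lambda>n. \<Prod>i\<in>{1..m}. (0::complex)) sums 0" using assms by (simp add: power_0_left)
  ultimately have "varopoulos_rep r m (\<lambda>_. 0) (\<lambda>_ _ _. 0)" "varopoulos_cost r m (\<lambda>_ _ _. 0) = 0"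
    using assms by (simp_all add: varopoulos_rep_def varopoulos_cost_def 0 cfun_def power_0_left)
  then show ?thesis using varopoulos_family_le[of r m "\<lambda>_. 0" "\<lambda>_ _ _. 0"] by simp
qed

lemma varopoulos_family_scale_le:
  assumes "m \<ge> 1" "c \<noteq> 0"
  shows "varopoulos_family r m (\<lambda>x. c * \<phi> x) \<le> ennreal (cmod c) * varopoulos_family r m \<phi>"
  unfolding varopoulos_family_eq[of r m \<phi>]
proof (rule le_mult_Inf_ennreal)
  fix s assume "s \<in> varopoulos_cost r m ` {\<psi>. varopoulos_rep r m \<phi> \<psi>}"
  then obtain \<psi> where \<psi>: "varopoulos_rep r m \<phi> \<psi>" "s = varopoulos_cost r m \<psi>" by blast
  obtain \<psi>' where "varopoulos_rep r m (\<lambda>x. c * \<phi> x) \<psi>'"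
    "varopoulos_cost r m \<psi>' = ennreal (cmod c) * varopoulos_cost r m \<psi>"
    using varopoulos_rep_scale[OF \<psi>(1) assms(1), of c] by blast
  then show "varopoulos_family r m (\<lambda>x. c * \<phi> x) \<le> ennreal (cmod c) * s"
    using varopoulos_family_le[of r m _ \<psi>'] \<psi>(2) by simp
qed (use assms in auto)

lemma possibly_infinite_norm_varopoulos:
  assumes m: "m \<ge> 1"
  shows "possibly_infinite_norm (cfun (cube r m)) (varopoulos_family r m)"
  unfolding possibly_infinite_norm_def
proof (intro conjI allI ballI)
  fix c \<phi>
  show "varopoulos_family r m (\<lambda>x. c * \<phi> x) = ennreal (cmod c) * varopoulos_family r m \<phi>"
  proof (cases "c = 0")
    case True
    then show ?thesis by (simp add: varopoulos_family_zero[OF m])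
  next
    case False
    have "varopoulos_family r m (\<lambda>x. inverse c * (c * \<phi> x))
        \<le> ennreal (cmod (inverse c)) * varopoulos_family r m (\<lambda>x. c * \<phi> x)"
      using False by (intro varopoulos_family_scale_le m) auto
    moreover have "(\<lambda>x. inverse c * (c * \<phi> x)) = \<phi>" using False by (simp add: mult.assoc[symmetric])
    ultimately have "ennreal (cmod c) * varopoulos_family r m \<phi>
        \<le> ennreal (cmod c) * (ennreal (cmod (inverse c)) * varopoulos_family r m (\<lambda>x. c * \<phi> x))"
      by (intro mult_left_mono) auto
    also have "\<dots> = varopoulos_family r m (\<lambda>x. c * \<phi> x)"
      using False by (simp add: mult.assoc[symmetric] ennreal_mult[symmetric] norm_mult[symmetric] del: norm_mult)
    finally show ?thesis
      using varopoulos_family_scale_le[OF m False, of r \<phi>] by (intro antisym)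
  qed
next
  fix \<phi> \<phi>'
  let ?S = "\<lambda>\<phi>. varopoulos_cost r m ` {\<psi>. varopoulos_rep r m \<phi> \<psi>}"
  have le: "varopoulos_family r m (\<lambda>x. \<phi> x + \<phi>' x) \<le> s + s'" if "s \<in> ?S \<phi>" "s' \<in> ?S \<phi>'" for s s'
  proof -
    obtain \<psi> \<psi>' where "varopoulos_rep r m \<phi> \<psi>" "s = varopoulos_cost r m \<psi>"
      "varopoulos_rep r m \<phi>' \<psi>'" "s' = varopoulos_cost r m \<psi>'"
      using \<open>s \<in> ?S \<phi>\<close> \<open>s' \<in> ?S \<phi>'\<close> by blast
    moreover from this obtain \<xi> where "varopoulos_rep r m (\<lambda>x. \<phi> x + \<phi>' x) \<xi>"
      "varopoulos_cost r m \<xi> = s + s'"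
      using varopoulos_rep_add[of r m \<phi> \<psi> \<phi>' \<psi>'] by auto
    ultimately show ?thesis using varopoulos_family_le[of r m _ \<xi>] by simp
  qed
  have fin: "s \<noteq> top" if "s \<in> ?S \<phi>" for s
    using that varopoulos_repD(2) by fastforce
  have 1: "varopoulos_family r m (\<lambda>x. \<phi> x + \<phi>' x) \<le> s + varopoulos_family r m \<phi>'" if s: "s \<in> ?S \<phi>" for s
  proof -
    have "varopoulos_family r m (\<lambda>x. \<phi> x + \<phi>' x) - s \<le> varopoulos_family r m \<phi>'"
      unfolding varopoulos_family_eq[of r m \<phi>']
    proof (rule Inf_greatest)
      fix s' assume "s' \<in> ?S \<phi>'"
      from le[OF s this] show "varopoulos_family r m (\<lambda>x. \<phi> x + \<phi>' x) - s \<le> s'"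
        using fin[OF s] by (simp add: ennreal_minus_le_iff)
    qed
    then show ?thesis using fin[OF s] by (simp add: ennreal_minus_le_iff)
  qed
  show "varopoulos_family r m (\<lambda>x. \<phi> x + \<phi>' x) \<le> varopoulos_family r m \<phi> + varopoulos_family r m \<phi>'"
  proof (cases "varopoulos_family r m \<phi>' = top")
    case False
    have "varopoulos_family r m (\<lambda>x. \<phi> x + \<phi>' x) - varopoulos_family r m \<phi>' \<le> varopoulos_family r m \<phi>"
      unfolding varopoulos_family_eq[of r m \<phi>]
    proof (rule Inf_greatest)
      fix s assume "s \<in> ?S \<phi>"
      from 1[OF this] show "varopoulos_family r m (\<lambda>x. \<phi> x + \<phi>' x) - varopoulos_family r m \<phi>' \<le> s"
        using False by (simp add: ennreal_minus_le_iff add.commute)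
    qed
    then show ?thesis using False by (simp add: ennreal_minus_le_iff add.commute)
  qed simp
next
  fix \<phi> assume \<phi>: "\<phi> \<in> cfun (cube r m)"
  show "varopoulos_family r m \<phi> = 0 \<longleftrightarrow> \<phi> = (\<lambda>_. 0)"
  proof
    assume 0: "varopoulos_family r m \<phi> = 0"
    show "\<phi> = (\<lambda>_. 0)"
    proof
      fix x
      show "\<phi> x = 0"
      proof (cases "x \<in> cube r m")
        case True
        have "ennreal (cmod (\<phi> x)) \<le> varopoulos_family r m \<phi>"
          unfolding varopoulos_family_eq
          by (rule Inf_greatest) (use cmod_le_varopoulos_cost[OF _ True] in auto)
        then show ?thesis using 0 by simp
      qed (use \<phi> in \<open>simp add: cfun_def\<close>)
    qed
  qed (simp add: varopoulos_family_zero[OF m])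
qed

lemma varopoulos_monomial_finite:
  fixes \<delta> :: "nat \<Rightarrow> nat"
  assumes "r > 0" "m \<ge> 1"
  shows "varopoulos_family r m (restr (cube r m) (\<lambda>x. \<Prod>i\<in>{1..m}. complex_of_real (x i) ^ \<delta> i)) < \<infinity>"
proof -
  let ?p = "\<lambda>i. restr {-r..r} (\<lambda>t. complex_of_real t ^ \<delta> i)"
  define \<psi> where "\<psi> i n = (if n = (0::nat) then ?p i else (\<lambda>_. 0))" for i n
  have 0: "sup_norm {-r..r} (\<lambda>_. 0) = 0"
    using sup_norm_scale[of "{-r..r}" 0 "\<lambda>_. 0"] by simp
  have p: "?p i \<in> cfun {-r..r}" for i
    by (rule restr_cfun[of _ UNIV]) (auto simp: cfun_def intro!: continuous_intros)
  have "sup_norm {-r..r} (?p i) < top" for i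
  proof -
    have "sup_norm {-r..r} (?p i) \<le> ennreal (r ^ \<delta> i)"
      unfolding sup_norm_le_iff
      by (auto simp: restr_def norm_power abs_le_iff intro!: ennreal_leI power_mono)
    then show ?thesis by (rule le_less_trans) simp
  qed
  then have "(\<Prod>i\<in>{1..n}. sup_norm {-r..r} (?p i)) < top" for n
    by (induction n) (simp_all add: ennreal_mult_less_top)
  then have fin: "(\<Prod>i\<in>{1..m}. sup_norm {-r..r} (?p i)) < top" .
  have pn: "(\<Prod>i\<in>{1..m}. sup_norm {-r..r} (\<psi> i n))
      = (if n = 0 then \<Prod>i\<in>{1..m}. sup_norm {-r..r} (?p i) else 0)" for n
    using assms by (simp add: \<psi>_def 0 power_0_left)
  have cost: "varopoulos_cost r m \<psi> = (\<Prod>i\<in>{1..m}. sup_norm {-r..r} (?p i))"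
    unfolding varopoulos_cost_def pn by (subst suminf_finite[of "{0}"]) auto
  have "(\<lambda>n. \<Prod>i\<in>{1..m}. \<psi> i n (x i)) sums restr (cube r m) (\<lambda>x. \<Prod>i\<in>{1..m}. complex_of_real (x i) ^ \<delta> i) x"
    if x: "x \<in> cube r m" for x
  proof -
    have xi: "x i \<in> {-r..r}" if "i \<in> {1..m}" for i
      using x that unfolding cube_def by (rule PiE_mem)
    have "(\<Prod>i\<in>{1..m}. \<psi> i 0 (x i)) = (\<Prod>i\<in>{1..m}. complex_of_real (x i) ^ \<delta> i)"
      by (rule prod.cong) (use xi in \<open>auto simp: \<psi>_def restr_def\<close>)
    moreover have "(\<lambda>n. \<Prod>i\<in>{1..m}. \<psi> i n (x i)) sums (\<Sum>n\<in>{0}. \<Prod>i\<in>{1..m}. \<psi> i n (x i))"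
      by (rule sums_finite) (use assms in \<open>auto simp: \<psi>_def power_0_left\<close>)
    ultimately show ?thesis using x by (simp add: restr_def)
  qed
  then have "varopoulos_rep r m (restr (cube r m) (\<lambda>x. \<Prod>i\<in>{1..m}. complex_of_real (x i) ^ \<delta> i)) \<psi>"
    using fin p by (intro varopoulos_repI) (simp_all add: cost, simp add: \<psi>_def cfun_def)
  from varopoulos_family_le[OF this] show ?thesis
    using fin unfolding cost infinity_ennreal_def by (rule le_less_trans)
qed

text \<open>
  A monomial is a single elementary tensor, and the triangle inequality does the rest.
\<close>

lemma varopoulos_poly_finite:
  assumes r: "r > 0" and m: "m \<ge> 1"
  shows "varopoulos_family r m (restr (cube r m) (poly_eval m P)) < \<infinity>"
proof -
  let ?L = Poly_Mapping.lookup
  define M where "M \<delta> = restr (cube r m) (\<lambda>x. \<Prod>i\<in>{1..m}. complex_of_real (x i) ^ ?L \<delta> i)" for \<delta>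
  note norm = possibly_infinite_norm_varopoulos[OF m, of r]
  have M: "M \<delta> \<in> cfun (cube r m)" for \<delta>
  proof -
    have "(\<lambda>x. \<Prod>i\<in>{1..m}. complex_of_real (x i) ^ ?L \<delta> i) \<in> cfun UNIV"
      unfolding cfun_def by (auto intro!: continuous_intros continuous_on_product_coordinates)
    then show ?thesis unfolding M_def by (rule restr_cfun) simp
  qed
  have "(\<lambda>x. \<Sum>\<delta>\<in>K. ?L P \<delta> * M \<delta> x) \<in> cfun (cube r m) \<and>
      varopoulos_family r m (\<lambda>x. \<Sum>\<delta>\<in>K. ?L P \<delta> * M \<delta> x) < \<infinity>" if "finite K" for K
    using that
  proof (induction K rule: finite_induct)
    case empty
    then show ?case by (simp add: varopoulos_family_zero[OF m] cfun_def)
  next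
    case (insert \<delta> K)
    have Mc: "(\<lambda>x. ?L P \<delta> * M \<delta> x) \<in> cfun (cube r m)"
      using cfun_lincomb[OF M M, of "?L P \<delta>" \<delta> 0 \<delta>] by simp
    have eq: "(\<lambda>x. \<Sum>\<delta>\<in>insert \<delta> K. ?L P \<delta> * M \<delta> x) = (\<lambda>x. ?L P \<delta> * M \<delta> x + (\<Sum>\<delta>\<in>K. ?L P \<delta> * M \<delta> x))"
      using insert by simp
    have "varopoulos_family r m (\<lambda>x. ?L P \<delta> * M \<delta> x + (\<Sum>\<delta>\<in>K. ?L P \<delta> * M \<delta> x))
        \<le> varopoulos_family r m (\<lambda>x. ?L P \<delta> * M \<delta> x) + varopoulos_family r m (\<lambda>x. \<Sum>\<delta>\<in>K. ?L P \<delta> * M \<delta> x)"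
      using norm[unfolded possibly_infinite_norm_def, THEN conjunct2, THEN conjunct1, rule_format,
          OF Mc conjunct1[OF insert.IH]] .
    also have "varopoulos_family r m (\<lambda>x. ?L P \<delta> * M \<delta> x) = ennreal (cmod (?L P \<delta>)) * varopoulos_family r m (M \<delta>)"
      using norm[unfolded possibly_infinite_norm_def, THEN conjunct1, rule_format, OF M] .
    also have "\<dots> + varopoulos_family r m (\<lambda>x. \<Sum>\<delta>\<in>K. ?L P \<delta> * M \<delta> x) < \<infinity>"
      using varopoulos_monomial_finite[OF r m, of "?L \<delta>"] insert.IH
      by (simp add: M_def ennreal_mult_less_top)
    finally show ?case
      unfolding eq using cfun_lincomb[OF Mc conjunct1[OF insert.IH], of 1 1] by simp
  qed
  moreover have "restr (cube r m) (poly_eval m P) = (\<lambda>x. \<Sum>\<delta>\<in>Poly_Mapping.keys P. ?L P \<delta> * M \<delta> x)"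
    by (auto simp: restr_def poly_eval_def M_def)
  ultimately show ?thesis by simp
qed

section \<open>Bernstein approximation and the Varopoulos bound\<close>

text \<open>
  The Bernstein operators transported from \<open>[0, 1]\<close> to \<open>[-r, r]\<close> by \<open>s = 1/2 + t/(2r)\<close>. The approximation
  of \<open>f\<close> uses only its values at the nodes, does not increase the uniform norm, and converges
  uniformly; these three properties together drive the proof for the Varopoulos norm.
\<close>

definition bernstein_node :: "real \<Rightarrow> nat \<Rightarrow> nat \<Rightarrow> real" where
  "bernstein_node r k j = r * (2 * (real j / real k) - 1)"

definition bernstein_poly :: "real \<Rightarrow> nat \<Rightarrow> nat \<Rightarrow> complex poly" where
  "bernstein_poly r k j = smult (of_nat (k choose j))
     ([:1 / 2, of_real (1 / (2 * r)):] ^ j * [:1 / 2, - of_real (1 / (2 * r)):] ^ (k - j))"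

definition bernstein_approx :: "real \<Rightarrow> nat \<Rightarrow> (real \<Rightarrow> complex) \<Rightarrow> complex poly" where
  "bernstein_approx r k f = (\<Sum>j\<le>k. smult (f (bernstein_node r k j)) (bernstein_poly r k j))"

lemma poly_bernstein_poly:
  "poly (bernstein_poly r k j) (of_real t) = of_real (Bernstein k j (1 / 2 + t / (2 * r)))"
  by (simp add: bernstein_poly_def Bernstein_def field_simps)

lemma bernstein_node_mem:
  assumes "r > 0" "j \<le> k"
  shows "bernstein_node r k j \<in> {-r..r}"
proof -
  have "0 \<le> real j / real k" "real j / real k \<le> 1" using assms by (auto simp: divide_le_eq)
  then have "\<bar>2 * (real j / real k) - 1\<bar> \<le> 1" by linarith
  then have "\<bar>bernstein_node r k j\<bar> \<le> r"
    using assms unfolding bernstein_node_def abs_mult by (simp add: mult_left_le)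
  then show ?thesis by auto
qed

lemma unit_interval_rescale:
  assumes "r > 0" "\<bar>t\<bar> \<le> r"
  shows "1 / 2 + t / (2 * r) \<in> {0..1::real}"
  using assms by (auto simp: field_simps)

lemma norm_peval_bernstein_approx_le:
  fixes a :: "'a::unital_cstar_algebra"
  assumes a: "adj a = a" "norm a \<le> r" and r: "r > 0"
    and le: "\<And>t. t \<in> {-r..r} \<Longrightarrow> cmod (f t) \<le> M"
  shows "norm (peval a (bernstein_approx r k f)) \<le> M"
proof (rule norm_peval_le[OF a])
  fix t :: real assume "\<bar>t\<bar> \<le> r"
  define s where "s = 1 / 2 + t / (2 * r)"
  have s: "0 \<le> s" "s \<le> 1" using unit_interval_rescale[OF r \<open>\<bar>t\<bar> \<le> r\<close>] by (auto simp: s_def)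
  have "poly (bernstein_approx r k f) (of_real t)
      = (\<Sum>j\<le>k. f (bernstein_node r k j) * of_real (Bernstein k j s))"
    by (simp add: bernstein_approx_def poly_sum poly_bernstein_poly s_def)
  also have "cmod \<dots> \<le> (\<Sum>j\<le>k. M * Bernstein k j s)"
  proof (intro sum_norm_le)
    fix j assume "j \<in> {..k}"
    then have "cmod (f (bernstein_node r k j)) \<le> M"
      using bernstein_node_mem[OF r] by (intro le) auto
    then show "cmod (f (bernstein_node r k j) * of_real (Bernstein k j s)) \<le> M * Bernstein k j s"
      using Bernstein_nonneg[OF s] by (simp add: norm_mult mult_right_mono)
  qed
  also have "\<dots> = M" by (simp flip: sum_distrib_left)
  finally show "cmod (poly (bernstein_approx r k f) (of_real t)) \<le> M" .
qed

lemma peval_bernstein_approx_power_tendsto: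
  fixes a :: "'a::unital_cstar_algebra"
  assumes a: "adj a = a" "norm a \<le> r" and r: "r > 0"
  shows "(\<lambda>k. peval a (bernstein_approx r k (\<lambda>t. of_real t ^ d))) \<longlonglongrightarrow> a ^ d"
proof (rule LIMSEQ_I)
  fix e :: real assume e: "e > 0"
  define f where "f s = (r * (2 * s - 1)) ^ d" for s :: real
  have "continuous_on {0..1} f" unfolding f_def by (intro continuous_intros)
  then obtain N where N: "\<And>k s. N \<le> k \<Longrightarrow> s \<in> {0..1} \<Longrightarrow>
      \<bar>f s - (\<Sum>j\<le>k. f (real j / real k) * Bernstein k j s)\<bar> < e / 2"
    using Bernstein_Weierstrass[of f "e / 2"] e by auto
  have "norm (peval a (bernstein_approx r k (\<lambda>t. of_real t ^ d)) - a ^ d) < e" if "k \<ge> N" for k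
  proof -
    have "norm (peval a (bernstein_approx r k (\<lambda>t. of_real t ^ d) - monom 1 d)) \<le> e / 2"
    proof (rule norm_peval_le[OF a])
      fix t :: real assume t: "\<bar>t\<bar> \<le> r"
      define s where "s = 1 / 2 + t / (2 * r)"
      have s: "s \<in> {0..1}" using unit_interval_rescale[OF r t] by (simp add: s_def)
      have ts: "t = r * (2 * s - 1)" using r by (simp add: s_def field_simps)
      have "poly (bernstein_approx r k (\<lambda>t. of_real t ^ d) - monom 1 d) (of_real t)
          = of_real ((\<Sum>j\<le>k. f (real j / real k) * Bernstein k j s) - f s)"
        unfolding bernstein_approx_def poly_diff poly_sum poly_smult poly_bernstein_poly s_def[symmetric]
        by (simp add: bernstein_node_def f_def poly_monom ts)
      then have "cmod (poly (bernstein_approx r k (\<lambda>t. of_real t ^ d) - monom 1 d) (of_real t))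
          = \<bar>(\<Sum>j\<le>k. f (real j / real k) * Bernstein k j s) - f s\<bar>"
        by (simp only: norm_of_real)
      also have "\<dots> \<le> e / 2" using N[OF that s] by (simp add: abs_minus_commute)
      finally show "cmod (poly (bernstein_approx r k (\<lambda>t. of_real t ^ d) - monom 1 d) (of_real t)) \<le> e / 2" .
    qed
    then show ?thesis using e by simp
  qed
  then show "\<exists>N. \<forall>k\<ge>N. norm (peval a (bernstein_approx r k (\<lambda>t. of_real t ^ d)) - a ^ d) < e" by blast
qed

text \<open>
  A representation of \<open>P\<close> by a series of elementary tensors of continuous functions cannot be
  substituted directly, since the calculus is only given on polynomials. Applying the Bernstein
  operator of order \<open>k\<close> in each variable turns \<open>P\<close> into a polynomial whose value \<open>Q k\<close> in the algebra is
  a finite combination of the numbers \<open>P(x)\<close> at the grid points \<open>x\<close>. These numbers can be computed in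
  two ways. From the monomials of \<open>P\<close> one sees that \<open>Q k\<close> tends to \<open>poly_tensor m P a b\<close>. From the given
  series one sees that \<open>Q k\<close> is the sum of the alternating products \<open>U k (\<lambda>i. \<psi> i n)\<close>, because pointwise
  convergence on a finite grid suffices for that; the terms are bounded, uniformly in \<open>k\<close>, by the
  products of the uniform norms and the \<open>\<parallel>b i\<parallel>\<close>.
\<close>

lemma norm_poly_tensor_varopoulos_le:
  fixes a b :: "nat \<Rightarrow> 'a::unital_cstar_algebra"
  assumes r: "r > 0" and m: "m \<ge> 1"
    and a: "\<And>i. i \<in> {1..m} \<Longrightarrow> adj (a i) = a i \<and> norm (a i) \<le> r"
    and rep: "varopoulos_rep r m (restr (cube r m) (poly_eval m P)) \<psi>"
  shows "ennreal (norm (poly_tensor m P a b))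
    \<le> varopoulos_cost r m \<psi> * ennreal (\<Prod>i\<in>{1..m-1}. norm (b i))"
proof -
  let ?L = Poly_Mapping.lookup
  let ?B = "\<Prod>i\<in>{1..m-1}. norm (b i)"
  let ?b = "b(m := 1)"
  define V where "V k F = alternating_prod m (\<lambda>i. peval (a i) (bernstein_poly r k (F i))) ?b" for k F
  define U where "U k f = alternating_prod m (\<lambda>i. peval (a i) (bernstein_approx r k (f i))) ?b" for k f
  define G where "G k = PiE {1..m} (\<lambda>_. {..k::nat})" for k
  define x where "x k F = restrict (\<lambda>i. bernstein_node r k (F i)) {1..m}" for k F
  have finG: "finite (G k)" for k unfolding G_def by (intro finite_PiE) auto
  have x: "x k F \<in> cube r m" if "F \<in> G k" for k F
    unfolding cube_def x_def
  proof (rule restrict_PiE_iff[THEN iffD2], intro ballI)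
    fix i assume "i \<in> {1..m}"
    then have "F i \<in> {..k}" by (rule PiE_mem[OF that[unfolded G_def]])
    then show "bernstein_node r k (F i) \<in> {-r..r}" by (intro bernstein_node_mem r) simp
  qed
  have U_expand: "U k f = (\<Sum>F\<in>G k. scaleC (\<Prod>i\<in>{1..m}. f i (x k F i)) (V k F))" for k f
  proof -
    have "U k f = alternating_prod m (\<lambda>i. \<Sum>j\<le>k. scaleC (f i (bernstein_node r k j))
        (peval (a i) (bernstein_poly r k j))) ?b"
      by (simp add: U_def bernstein_approx_def peval_sum)
    also have "\<dots> = (\<Sum>F\<in>G k. scaleC (\<Prod>i\<in>{1..m}. f i (bernstein_node r k (F i))) (V k F))"
      unfolding V_def G_def by (rule alternating_prod_sum) auto
    also have "\<dots> = (\<Sum>F\<in>G k. scaleC (\<Prod>i\<in>{1..m}. f i (x k F i)) (V k F))"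
      by (intro sum.cong refl arg_cong2[where f = scaleC] prod.cong) (auto simp: x_def)
    finally show ?thesis .
  qed
  define Q where "Q k = (\<Sum>F\<in>G k. scaleC (poly_eval m P (x k F)) (V k F))" for k
  have Q_U: "Q k = (\<Sum>\<delta>\<in>Poly_Mapping.keys P. scaleC (?L P \<delta>) (U k (\<lambda>i t. of_real t ^ ?L \<delta> i)))" for k
    unfolding Q_def U_expand poly_eval_def complex_vector.scale_sum_right scaleC_scaleC
      complex_vector.scale_sum_left
    by (rule sum.swap)
  have lim: "Q \<longlonglongrightarrow> poly_tensor m P a b"
    unfolding Q_U poly_tensor_eq_alternating_prod[OF m] U_def
    by (intro tendsto_sum bounded_linear.tendsto[OF bounded_linear_scaleC_right]
        tendsto_alternating_prod peval_bernstein_approx_power_tendsto r) (use a in auto)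
  have Q_le: "ennreal (norm (Q k)) \<le> varopoulos_cost r m \<psi> * ennreal ?B" for k
  proof -
    have "(\<lambda>n. U k (\<lambda>i. \<psi> i n)) sums Q k"
      unfolding U_expand Q_def
    proof (intro sums_sum)
      fix F assume F: "F \<in> G k"
      have "(\<lambda>n. \<Prod>i\<in>{1..m}. \<psi> i n (x k F i)) sums poly_eval m P (x k F)"
        using rep x[OF F] by (auto simp: varopoulos_rep_def restr_def)
      moreover have "bounded_linear (\<lambda>c. scaleC c (V k F))"
      proof (rule bounded_linear_intro[where K = "norm (V k F)"])
        show "scaleC (t *\<^sub>R c) (V k F) = t *\<^sub>R scaleC c (V k F)" for t c
          by (simp only: scaleR_conv_of_real[where ?'a = complex] scaleC_scaleC[symmetric] scaleC_of_real)
      qed (auto simp: scaleC_add_left norm_scaleC)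
      ultimately show "(\<lambda>n. scaleC (\<Prod>i\<in>{1..m}. \<psi> i n (x k F i)) (V k F))
          sums scaleC (poly_eval m P (x k F)) (V k F)"
        by (rule bounded_linear.sums[rotated])
    qed
    moreover have "ennreal (norm (U k (\<lambda>i. \<psi> i n))) \<le> (\<Prod>i\<in>{1..m}. sup_norm {-r..r} (\<psi> i n)) * ennreal ?B" for n
    proof -
      let ?y = "\<lambda>i. peval (a i) (bernstein_approx r k (\<psi> i n))"
      have "norm (U k (\<lambda>i. \<psi> i n)) \<le> (\<Prod>i\<in>{1..m}. norm (?y i)) * ?B"
        unfolding U_def prod_norm_last_one[OF m, symmetric] by (rule norm_alternating_prod_le)
      then have "ennreal (norm (U k (\<lambda>i. \<psi> i n))) \<le> ennreal ((\<Prod>i\<in>{1..m}. norm (?y i)) * ?B)"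
        by (rule ennreal_leI)
      also have "\<dots> = (\<Prod>i\<in>{1..m}. ennreal (norm (?y i))) * ennreal ?B"
        by (simp add: ennreal_mult prod_nonneg prod_ennreal)
      also have "\<dots> \<le> (\<Prod>i\<in>{1..m}. sup_norm {-r..r} (\<psi> i n)) * ennreal ?B"
      proof (intro mult_right_mono prod_mono_ennreal)
        fix i assume i: "i \<in> {1..m}"
        show "ennreal (norm (?y i)) \<le> sup_norm {-r..r} (\<psi> i n)"
        proof (cases "sup_norm {-r..r} (\<psi> i n) = top")
          case False
          then obtain M where M: "sup_norm {-r..r} (\<psi> i n) = ennreal M" "M \<ge> 0"
            by (cases "sup_norm {-r..r} (\<psi> i n)") auto
          have "norm (?y i) \<le> M"
          proof (rule norm_peval_bernstein_approx_le[OF _ _ r])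
            show "cmod (\<psi> i n t) \<le> M" if "t \<in> {-r..r}" for t
              using sup_norm_le_iff[of "{-r..r}" "\<psi> i n" M] M that by simp
          qed (use a[OF i] in auto)
          then show ?thesis unfolding M by (rule ennreal_leI)
        qed simp
      qed simp
      finally show ?thesis .
    qed
    ultimately have "ennreal (norm (Q k)) \<le> suminf (\<lambda>n. (\<Prod>i\<in>{1..m}. sup_norm {-r..r} (\<psi> i n)) * ennreal ?B)"
      by (rule norm_sums_le_suminf)
    then show ?thesis unfolding varopoulos_cost_def ennreal_suminf_multc .
  qed
  have "(\<lambda>k. ennreal (norm (Q k))) \<longlonglongrightarrow> ennreal (norm (poly_tensor m P a b))"
    by (intro tendsto_ennrealI tendsto_norm lim)
  then show ?thesis by (rule LIMSEQ_le_const2) (use Q_le in blast)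
qed

theorem LFC_admissible_varopoulos:
  fixes A :: "'a::unital_cstar_algebra itself"
  shows "LFC_admissible A varopoulos_family"
  unfolding LFC_admissible_def
proof (intro conjI allI impI ballI)
  fix m P and b :: "nat \<Rightarrow> 'a" and r :: real
  assume m: "m \<ge> 2" and P: "P \<in> polys m" and r: "r > 0"
  have m1: "m \<ge> 1" using m by simp
  let ?\<phi> = "restr (cube r m) (poly_eval m P)"
  let ?B = "\<Prod>i\<in>{1..m-1}. norm (b i)"
  let ?S = "varopoulos_cost r m ` {\<psi>. varopoulos_rep r m ?\<phi> \<psi>}"
  show "(SUP a\<in>{a :: nat \<Rightarrow> 'a. \<forall>i\<in>{1..m}. adj (a i) = a i \<and> norm (a i) \<le> r}.
           ennreal (norm (poly_tensor m P a b)))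
      \<le> varopoulos_family r m ?\<phi> * ennreal ?B"
  proof (rule SUP_least)
    fix a :: "nat \<Rightarrow> 'a" assume "a \<in> {a. \<forall>i\<in>{1..m}. adj (a i) = a i \<and> norm (a i) \<le> r}"
    then have le: "ennreal (norm (poly_tensor m P a b)) \<le> ennreal ?B * s" if "s \<in> ?S" for s
      using that norm_poly_tensor_varopoulos_le[OF r m1, of a P _ b] by (auto simp: mult.commute)
    show "ennreal (norm (poly_tensor m P a b)) \<le> varopoulos_family r m ?\<phi> * ennreal ?B"
    \<comment> \<open>Multiplication by a zero constant does not commute with the infimum of the empty set, which is infinite.\<close>
    proof (cases "ennreal ?B = 0")
      case True
      have "?S \<noteq> {}"
      proof
        assume "?S = {}"
        then have "varopoulos_family r m ?\<phi> = top" by (simp only: varopoulos_family_eq Inf_empty)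
        then show False using varopoulos_poly_finite[OF r m1, of P] by simp
      qed
      then show ?thesis using le True by auto
    next
      case False
      then show ?thesis
        unfolding varopoulos_family_eq mult.commute[of _ "ennreal ?B"]
        by (intro le_mult_Inf_ennreal le) auto
    qed
  qed
qed (use possibly_infinite_norm_varopoulos varopoulos_poly_finite in auto)

theorem theorem1p10:
  fixes A :: "'a::unital_cstar_algebra itself"
  shows "(commutative_algebra A \<longrightarrow> LFC_admissible A uniform_family) \<and>
         (finite_dimensional A \<longrightarrow> LFC_admissible A (scaled_uniform_family A)) \<and>
         LFC_admissible A varopoulos_family \<and>
         (commutative_algebra A \<longrightarrow> LFC_defined A uniform_family) \<and>
         (finite_dimensional A \<longrightarrow> LFC_defined A (scaled_uniform_family A)) \<and>
         LFC_defined A varopoulos_family"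
  using LFC_admissible_uniform LFC_admissible_scaled_uniform_finite_dimensional
    LFC_admissible_varopoulos LFC_defined_if_admissible by blast

end
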